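(* Assume that $(G,\beta,R)$ is a finite root system such that $L(R)$ is a simple Lie algebra and the standard grading on $L(R)$ is a good inner grading. Then $(G,\beta,R)$ is reduced and irreducible, and the type of $(G,\beta,R)$ is one and only one of the following: (1) $I(n_1,\dots,n_k)$ with $k\ge1$, each $n_i>1$ and $n_i\mid n_{i+1}$ for $i=1,\dots,k-1$; (2) $II(k)$ with $k\ge2$; (3) $III(k)$ with $k\ge3$; (4) $IV(k)$ with $k\ge4$; (5) $V(k)$ with $k\ge3$.
   Context: All algebras are finite-dimensional over $\mathbb{C}$; $\mathbb{Z}_n=\mathbb{Z}/n\mathbb{Z}$. An alternating bicharacter on a finite abelian group $G$ is a map $\beta:G\times G\to\mathbb{C}^\times$ multiplicative in each variable with $\beta(a,a)=1$; $\mathrm{Rad}(\beta)=\{a:\beta(a,b)=1\ \forall b\in G\}$; $\beta$ is nonsingular if $\mathrm{Rad}(\beta)=0$. For $\beta$ nontrivial ($\mathrm{Rad}(\beta)\ne G$), a subset $R\subset G$ is a finite root system in $(G,\beta)$ if: (FRS0) $R\subset G\setminus\mathrm{Rad}(\beta)$ and $R$ generates $G$; (FRS1) $a\in R\Rightarrow -a\in R$; (FRS2) $a,b\in R$ and $\beta(a,b)\neq1$ imply $a+b\in R$. It is reduced if $\beta$ is nonsingular. It is reducible if $G$ is an orthogonal product of two subgroups $G_1,G_2$, $R$ is a disjoint union of two nonempty orthogonal subsets $R_1,R_2$, and $R_i$ is a finite root system in $G_i$; otherwise irreducible. Finite root systems $(G_i,\beta_i,R_i)$, $i=1,2$, are isomorphic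 if there is a group isomorphism $G_1\to G_2$ preserving the bicharacters and mapping $R_1$ onto $R_2$; being of a given type means being isomorphic to the model of that type below. Choose a bimultiplicative $\xi:G\times G\to\mathbb{C}^\times$ with $\xi(a,b)\xi(b,a)^{-1}=\beta(a,b)$; $L(R)=\bigoplus_{a\in R}\mathbb{C}u_a$ with $[u_a,u_b]=(\xi(a,b)-\xi(b,a))u_{a+b}$ is a Lie algebra, independent of $\xi$ up to graded isomorphism, and this decomposition is its standard $G$-grading. $\widehat G=\mathrm{Hom}(G,\mathbb{C}^\times)$ embeds in $\mathrm{Aut}(L(R))$ by $\sigma\cdot u_a=\sigma(a)u_a$. The standard grading (whose components are 1-dimensional with $0$ not in the support) is a good inner grading if $\widehat G$ is a finite maximal quasitorus in $\mathrm{Int}(L(R))$, the group of inner automorphisms; a quasitorus is an abelian algebraic group consisting of semisimple elements. Types. - $I(n_1,\dots,n_k)$ (each $n_i>1$, $n_i\mid n_{i+1}$): $G=\prod_{t=1}^k(\mathbb{Z}_{n_t}\times\mathbb{Z}_{n_t})$, $\beta\big(((i_t,j_t))_t,((s_t,l_t))_t\big)=\prod_t\varepsilon_t^{j_ts_t-i_tl_t}$ with $\varepsilon_t$ a primitive $n_t$-th root of unity, $R=G\setminus\{0\}$. - For $n\geq3$, let $\beta(a,b)=(-1)^{(\sum a_i)(\sum b_i)-\sum a_ib_i}$ on $\mathbb{Z}_2^n$, $R=\{e_i+e_j:1\le i<j\le n\}$ ($e_i$ the standard generators), and $G\cong\mathbb{Z}_2^{n-1}$ the subgroup generated by $R$.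 For $n=2k+1$, $(G,\beta|_G,R)$ is of type $II(k)$. For $n=2k$, $k\ge3$, the induced finite root system (images of $R$ and $\beta$) in $G/\mathrm{Rad}(\beta|_G)\cong\mathbb{Z}_2^{2k-2}$ is of type $IV(k)$. - On $G=\mathbb{F}_2^{2k}$ let $\beta(a,b)=(-1)^{\sum_{i=1}^k(a_{2i}b_{2i-1}-a_{2i-1}b_{2i})}$, $g(a)=\sum_{i=1}^k a_{2i-1}a_{2i}$, $f(a)=a_1^2+a_2^2+\sum_{i=1}^k a_{2i-1}a_{2i}$. Type $III(k)$: $R=\{a: f(a)=1\}$. Type $V(k)$ ($k\ge 3$): $R=\{a:g(a)=1\}$.
   Formalization: "One and only one" fails as written because IV(4) and V(3) are isomorphic finite root systems (both with L(R)=so(8)), so the formal statement asserts that the listed type is unique except that IV(4) and V(3) may both apply. *)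

theory Defs
  imports
    "HOL-Algebra.Algebra"
    "HOL-Library.Function_Algebras"
    Complex_Main
begin

section \<open>Bicharacters and finite root systems\<close>

text \<open>
  Finite abelian groups are HOL-Algebra groups written multiplicatively; the sum \<open>a + b\<close>
  of the additive notation is \<open>a \<otimes> b\<close>, and \<open>-a\<close> is \<open>inv a\<close>.
\<close>

definition Cstar :: "complex monoid" where
  "Cstar = \<lparr>carrier = - {0}, monoid.mult = (*), one = 1\<rparr>"

definition bicharacter ::
  "('a, 'm) monoid_scheme \<Rightarrow> ('a \<Rightarrow> 'a \<Rightarrow> complex) \<Rightarrow> bool" where
  "bicharacter G \<beta> \<longleftrightarrow>
     (\<forall>a\<in>carrier G. (\<lambda>b. \<beta> a b) \<in> hom G Cstar \<and> (\<lambda>b. \<beta> b a) \<in> hom G Cstar)"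

definition alternating_bicharacter ::
  "('a, 'm) monoid_scheme \<Rightarrow> ('a \<Rightarrow> 'a \<Rightarrow> complex) \<Rightarrow> bool" where
  "alternating_bicharacter G \<beta> \<longleftrightarrow> bicharacter G \<beta> \<and> (\<forall>a\<in>carrier G. \<beta> a a = 1)"

definition Rad :: "('a, 'm) monoid_scheme \<Rightarrow> ('a \<Rightarrow> 'a \<Rightarrow> complex) \<Rightarrow> 'a set" where
  "Rad G \<beta> = {a \<in> carrier G. \<forall>b\<in>carrier G. \<beta> a b = 1}"

definition nonsingular :: "('a, 'm) monoid_scheme \<Rightarrow> ('a \<Rightarrow> 'a \<Rightarrow> complex) \<Rightarrow> bool" where
  "nonsingular G \<beta> \<longleftrightarrow> Rad G \<beta> = {\<one>\<^bsub>G\<^esub>}"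

locale finite_root_system = comm_group G
  for G :: "('a, 'm) monoid_scheme" (structure) +
  fixes \<beta> :: "'a \<Rightarrow> 'a \<Rightarrow> complex" and R :: "'a set"
  assumes finite_carrier: "finite (carrier G)"
    and alternating: "alternating_bicharacter G \<beta>"
    and nontrivial: "Rad G \<beta> \<noteq> carrier G"
    and FRS0_subset: "R \<subseteq> carrier G - Rad G \<beta>"
    and FRS0_generates: "generate G R = carrier G"
    and FRS1: "a \<in> R \<Longrightarrow> inv a \<in> R"
    and FRS2: "\<lbrakk>a \<in> R; b \<in> R; \<beta> a b \<noteq> 1\<rbrakk> \<Longrightarrow> a \<otimes> b \<in> R"

definition frs_reducible ::
  "('a, 'm) monoid_scheme \<Rightarrow> ('a \<Rightarrow> 'a \<Rightarrow> complex) \<Rightarrow> 'a set \<Rightarrow> bool" where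
  "frs_reducible G \<beta> R \<longleftrightarrow>
     (\<exists>G1 G2 R1 R2.
        subgroup G1 G \<and> subgroup G2 G \<and>
        G1 \<inter> G2 = {\<one>\<^bsub>G\<^esub>} \<and> G1 <#>\<^bsub>G\<^esub> G2 = carrier G \<and>
        (\<forall>a\<in>G1. \<forall>b\<in>G2. \<beta> a b = 1) \<and>
        R1 \<union> R2 = R \<and> R1 \<inter> R2 = {} \<and> R1 \<noteq> {} \<and> R2 \<noteq> {} \<and>
        (\<forall>a\<in>R1. \<forall>b\<in>R2. \<beta> a b = 1) \<and>
        finite_root_system (G\<lparr>carrier := G1\<rparr>) \<beta> R1 \<and>
        finite_root_system (G\<lparr>carrier := G2\<rparr>) \<beta> R2)"

definition frs_isomorphic ::
  "('a, 'm) monoid_scheme \<Rightarrow> ('a \<Rightarrow> 'a \<Rightarrow> complex) \<Rightarrow> 'a set \<Rightarrow>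
   ('b, 'n) monoid_scheme \<Rightarrow> ('b \<Rightarrow> 'b \<Rightarrow> complex) \<Rightarrow> 'b set \<Rightarrow> bool" where
  "frs_isomorphic G \<beta> R G' \<beta>' R' \<longleftrightarrow>
     (\<exists>h\<in>iso G G'. (\<forall>a\<in>carrier G. \<forall>b\<in>carrier G. \<beta>' (h a) (h b) = \<beta> a b) \<and> h ` R = R')"


section \<open>The Lie algebra of a finite root system\<close>

text \<open>
  A vector of the space with basis \<open>u\<^sub>a\<close>, \<open>a \<in> S\<close>, is given by its coordinate function,
  extended by \<open>0\<close> outside \<open>S\<close>.  Addition of functions is pointwise
  (from \<open>Function_Algebras\<close>).
\<close>

definition cscale :: "complex \<Rightarrow> ('a \<Rightarrow> complex) \<Rightarrow> 'a \<Rightarrow> complex" where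
  "cscale c x = (\<lambda>a. c * x a)"

global_interpretation cfun: vector_space cscale
  defines cfun_subspace = cfun.subspace and cfun_span = cfun.span
  by standard (auto simp: cscale_def fun_eq_iff algebra_simps)

definition coord_space :: "'a set \<Rightarrow> ('a \<Rightarrow> complex) set" where
  "coord_space S = {x. \<forall>a. a \<notin> S \<longrightarrow> x a = 0}"

definition unit_vec :: "'a \<Rightarrow> 'a \<Rightarrow> complex" where
  "unit_vec a = (\<lambda>b. if b = a then 1 else 0)"

definition linear_on_coord :: "'a set \<Rightarrow> (('a \<Rightarrow> complex) \<Rightarrow> ('a \<Rightarrow> complex)) \<Rightarrow> bool" where
  "linear_on_coord S \<phi> \<longleftrightarrow>
     (\<forall>x\<in>coord_space S. \<phi> x \<in> coord_space S) \<and>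
     (\<forall>x\<in>coord_space S. \<forall>y\<in>coord_space S. \<phi> (x + y) = \<phi> x + \<phi> y) \<and>
     (\<forall>c. \<forall>x\<in>coord_space S. \<phi> (cscale c x) = cscale c (\<phi> x))"

type_synonym 'a bracket = "('a \<Rightarrow> complex) \<Rightarrow> ('a \<Rightarrow> complex) \<Rightarrow> ('a \<Rightarrow> complex)"

definition lie_algebra :: "'a set \<Rightarrow> 'a bracket \<Rightarrow> bool" where
  "lie_algebra S br \<longleftrightarrow>
     (\<forall>x\<in>coord_space S. linear_on_coord S (br x) \<and> linear_on_coord S (\<lambda>y. br y x)) \<and>
     (\<forall>x\<in>coord_space S. br x x = 0) \<and>
     (\<forall>x\<in>coord_space S. \<forall>y\<in>coord_space S. \<forall>z\<in>coord_space S.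
        br x (br y z) + br y (br z x) + br z (br x y) = 0)"

definition lie_ideal :: "'a set \<Rightarrow> 'a bracket \<Rightarrow> ('a \<Rightarrow> complex) set \<Rightarrow> bool" where
  "lie_ideal S br I \<longleftrightarrow>
     I \<subseteq> coord_space S \<and> cfun_subspace I \<and> (\<forall>x\<in>coord_space S. \<forall>y\<in>I. br x y \<in> I)"

definition simple_lie_algebra :: "'a set \<Rightarrow> 'a bracket \<Rightarrow> bool" where
  "simple_lie_algebra S br \<longleftrightarrow>
     lie_algebra S br \<and>
     (\<exists>x\<in>coord_space S. \<exists>y\<in>coord_space S. br x y \<noteq> 0) \<and>
     (\<forall>I. lie_ideal S br I \<longrightarrow> I = {0} \<or> I = coord_space S)"

text \<open>
  The bilinear extension of \<open>[u\<^sub>a, u\<^sub>b] = (\<xi>(a,b) - \<xi>(b,a)) u\<^sub>a\<^sub>+\<^sub>b\<close>.  The coefficient vanishes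
  unless \<open>\<beta>(a,b) \<noteq> 1\<close>, in which case \<open>a + b \<in> R\<close>.
\<close>

definition root_bracket ::
  "('a, 'm) monoid_scheme \<Rightarrow> ('a \<Rightarrow> 'a \<Rightarrow> complex) \<Rightarrow> 'a set \<Rightarrow> 'a bracket" where
  "root_bracket G \<xi> R x y =
     (\<Sum>a\<in>R. \<Sum>b\<in>R. cscale (x a * y b * (\<xi> a b - \<xi> b a)) (unit_vec (a \<otimes>\<^bsub>G\<^esub> b)))"


section \<open>Inner automorphisms and quasitori\<close>

text \<open>
  The exponential series is summed coordinatewise.  Transformations of the space are
  elements of \<open>BijGroup\<close>, hence extensional functions.
\<close>

definition exp_ad :: "'a set \<Rightarrow> 'a bracket \<Rightarrow> ('a \<Rightarrow> complex) \<Rightarrow> ('a \<Rightarrow> complex) \<Rightarrow> ('a \<Rightarrow> complex)"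
  where "exp_ad S br x = (\<lambda>y\<in>coord_space S. \<lambda>a. suminf (\<lambda>n. (br x ^^ n) y a / fact n))"

definition inner_automorphisms ::
  "'a set \<Rightarrow> 'a bracket \<Rightarrow> (('a \<Rightarrow> complex) \<Rightarrow> ('a \<Rightarrow> complex)) set" where
  "inner_automorphisms S br =
     generate (BijGroup (coord_space S)) (exp_ad S br ` coord_space S)"

definition general_linear :: "'a set \<Rightarrow> (('a \<Rightarrow> complex) \<Rightarrow> ('a \<Rightarrow> complex)) set" where
  "general_linear S = {\<phi> \<in> Bij (coord_space S). linear_on_coord S \<phi>}"

text \<open>Polynomial functions of the matrix entries of \<open>\<phi>\<close> in the basis \<open>u\<^sub>a\<close>, \<open>a \<in> S\<close>.\<close>

inductive_set matrix_polynomials ::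
  "'a set \<Rightarrow> ((('a \<Rightarrow> complex) \<Rightarrow> ('a \<Rightarrow> complex)) \<Rightarrow> complex) set" for S where
  const: "(\<lambda>\<phi>. c) \<in> matrix_polynomials S"
| entry: "a \<in> S \<Longrightarrow> b \<in> S \<Longrightarrow> (\<lambda>\<phi>. \<phi> (unit_vec b) a) \<in> matrix_polynomials S"
| add: "p \<in> matrix_polynomials S \<Longrightarrow> q \<in> matrix_polynomials S \<Longrightarrow>
        (\<lambda>\<phi>. p \<phi> + q \<phi>) \<in> matrix_polynomials S"
| mult: "p \<in> matrix_polynomials S \<Longrightarrow> q \<in> matrix_polynomials S \<Longrightarrow>
        (\<lambda>\<phi>. p \<phi> * q \<phi>) \<in> matrix_polynomials S"

text \<open>A linear algebraic group: a Zariski-closed subgroup of the general linear group.\<close>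

definition algebraic_group ::
  "'a set \<Rightarrow> (('a \<Rightarrow> complex) \<Rightarrow> ('a \<Rightarrow> complex)) set \<Rightarrow> bool" where
  "algebraic_group S H \<longleftrightarrow>
     subgroup H (BijGroup (coord_space S)) \<and>
     (\<exists>P \<subseteq> matrix_polynomials S. H = {\<phi> \<in> general_linear S. \<forall>p\<in>P. p \<phi> = 0})"

text \<open>Over the complex numbers, semisimple means diagonalizable: eigenvectors span.\<close>

definition semisimple_on :: "'a set \<Rightarrow> (('a \<Rightarrow> complex) \<Rightarrow> ('a \<Rightarrow> complex)) \<Rightarrow> bool" where
  "semisimple_on S \<phi> \<longleftrightarrow>
     cfun_span {x \<in> coord_space S. \<exists>c. \<phi> x = cscale c x} = coord_space S"

definition quasitorus :: "'a set \<Rightarrow> (('a \<Rightarrow> complex) \<Rightarrow> ('a \<Rightarrow> complex)) set \<Rightarrow> bool" where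
  "quasitorus S H \<longleftrightarrow>
     algebraic_group S H \<and>
     comm_group (BijGroup (coord_space S)\<lparr>carrier := H\<rparr>) \<and>
     (\<forall>\<phi>\<in>H. semisimple_on S \<phi>)"

definition maximal_quasitorus_in ::
  "'a set \<Rightarrow> (('a \<Rightarrow> complex) \<Rightarrow> ('a \<Rightarrow> complex)) set \<Rightarrow>
   (('a \<Rightarrow> complex) \<Rightarrow> ('a \<Rightarrow> complex)) set \<Rightarrow> bool" where
  "maximal_quasitorus_in S A H \<longleftrightarrow>
     quasitorus S H \<and> H \<subseteq> A \<and>
     (\<forall>H'. quasitorus S H' \<and> H' \<subseteq> A \<and> H \<subseteq> H' \<longrightarrow> H' = H)"

text \<open>The image of the dual group of \<open>G\<close>, acting by \<open>\<sigma> \<cdot> u\<^sub>a = \<sigma>(a) u\<^sub>a\<close>.\<close>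

definition dual_group_action ::
  "('a, 'm) monoid_scheme \<Rightarrow> 'a set \<Rightarrow> (('a \<Rightarrow> complex) \<Rightarrow> ('a \<Rightarrow> complex)) set" where
  "dual_group_action G R = (\<lambda>\<sigma>. \<lambda>x\<in>coord_space R. \<lambda>a. \<sigma> a * x a) ` hom G Cstar"

definition good_inner_standard_grading ::
  "('a, 'm) monoid_scheme \<Rightarrow> ('a \<Rightarrow> 'a \<Rightarrow> complex) \<Rightarrow> 'a set \<Rightarrow> bool" where
  "good_inner_standard_grading G \<xi> R \<longleftrightarrow>
     finite (dual_group_action G R) \<and>
     maximal_quasitorus_in R (inner_automorphisms R (root_bracket G \<xi> R)) (dual_group_action G R)"


section \<open>The models of the types\<close>

subsection \<open>Type I\<close>

definition I_group :: "nat list \<Rightarrow> (nat \<Rightarrow> int \<times> int) monoid" where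
  "I_group ns = product_group {..<length ns}
     (\<lambda>t. integer_mod_group (ns ! t) \<times>\<times> integer_mod_group (ns ! t))"

definition I_bichar ::
  "nat list \<Rightarrow> (nat \<Rightarrow> complex) \<Rightarrow> (nat \<Rightarrow> int \<times> int) \<Rightarrow> (nat \<Rightarrow> int \<times> int) \<Rightarrow> complex" where
  "I_bichar ns \<epsilon> a b =
     (\<Prod>t<length ns. \<epsilon> t powi (snd (a t) * fst (b t) - fst (a t) * snd (b t)))"

definition primitive_root_of_unity :: "nat \<Rightarrow> complex \<Rightarrow> bool" where
  "primitive_root_of_unity n z \<longleftrightarrow> n > 0 \<and> z ^ n = 1 \<and> (\<forall>m. 0 < m \<and> m < n \<longrightarrow> z ^ m \<noteq> 1)"

definition divisor_chain :: "nat list \<Rightarrow> bool" where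
  "divisor_chain ns \<longleftrightarrow>
     ns \<noteq> [] \<and> (\<forall>n\<in>set ns. n > 1) \<and> (\<forall>i. Suc i < length ns \<longrightarrow> ns ! i dvd ns ! Suc i)"

subsection \<open>Types II and IV\<close>

text \<open>\<open>\<int>\<^sub>2\<^sup>n\<close>, with coordinates indexed by \<open>1, \<dots>, n\<close> and represented by the integers 0 and 1.\<close>

definition Z2n :: "nat \<Rightarrow> (nat \<Rightarrow> int) monoid" where
  "Z2n n = product_group {1..n} (\<lambda>_. integer_mod_group 2)"

definition Z2n_gen :: "nat \<Rightarrow> nat \<Rightarrow> nat \<Rightarrow> int" where
  "Z2n_gen n i = (\<lambda>j\<in>{1..n}. if j = i then 1 else 0)"

definition II_bichar :: "nat \<Rightarrow> (nat \<Rightarrow> int) \<Rightarrow> (nat \<Rightarrow> int) \<Rightarrow> complex" where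
  "II_bichar n a b = (-1) powi ((\<Sum>i=1..n. a i) * (\<Sum>i=1..n. b i) - (\<Sum>i=1..n. a i * b i))"

definition II_roots :: "nat \<Rightarrow> (nat \<Rightarrow> int) set" where
  "II_roots n = {Z2n_gen n i \<otimes>\<^bsub>Z2n n\<^esub> Z2n_gen n j | i j. 1 \<le> i \<and> i < j \<and> j \<le> n}"

definition II_group :: "nat \<Rightarrow> (nat \<Rightarrow> int) monoid" where
  "II_group n = subgroup_generated (Z2n n) (II_roots n)"

definition IV_group :: "nat \<Rightarrow> (nat \<Rightarrow> int) set monoid" where
  "IV_group n = II_group n Mod Rad (II_group n) (II_bichar n)"

text \<open>The value on a pair of cosets; it does not depend on the representatives.\<close>

definition IV_bichar :: "nat \<Rightarrow> (nat \<Rightarrow> int) set \<Rightarrow> (nat \<Rightarrow> int) set \<Rightarrow> complex" where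
  "IV_bichar n A B = the_elem ((\<lambda>(a, b). II_bichar n a b) ` (A \<times> B))"

definition IV_roots :: "nat \<Rightarrow> (nat \<Rightarrow> int) set set" where
  "IV_roots n = (\<lambda>a. Rad (II_group n) (II_bichar n) #>\<^bsub>II_group n\<^esub> a) ` II_roots n"

subsection \<open>Types III and V\<close>

definition symplectic_bichar :: "nat \<Rightarrow> (nat \<Rightarrow> int) \<Rightarrow> (nat \<Rightarrow> int) \<Rightarrow> complex" where
  "symplectic_bichar k a b =
     (-1) powi (\<Sum>i=1..k. a (2*i) * b (2*i - 1) - a (2*i - 1) * b (2*i))"

definition III_roots :: "nat \<Rightarrow> (nat \<Rightarrow> int) set" where
  "III_roots k = {a \<in> carrier (Z2n (2*k)).
     ((a 1)\<^sup>2 + (a 2)\<^sup>2 + (\<Sum>i=1..k. a (2*i - 1) * a (2*i))) mod 2 = 1}"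

definition V_roots :: "nat \<Rightarrow> (nat \<Rightarrow> int) set" where
  "V_roots k = {a \<in> carrier (Z2n (2*k)). (\<Sum>i=1..k. a (2*i - 1) * a (2*i)) mod 2 = 1}"

subsection \<open>The type of a finite root system\<close>

datatype frs_type = TypeI "nat list" | TypeII nat | TypeIII nat | TypeIV nat | TypeV nat

text \<open>
  For type I the root system does not depend, up to isomorphism, on the choice of the
  primitive roots of unity.
\<close>

fun of_type ::
  "frs_type \<Rightarrow> ('a, 'm) monoid_scheme \<Rightarrow> ('a \<Rightarrow> 'a \<Rightarrow> complex) \<Rightarrow> 'a set \<Rightarrow> bool" where
  "of_type (TypeI ns) G \<beta> R \<longleftrightarrow>
     divisor_chain ns \<and>
     (\<exists>\<epsilon>. (\<forall>t<length ns. primitive_root_of_unity (ns ! t) (\<epsilon> t)) \<and>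
        frs_isomorphic G \<beta> R
          (I_group ns) (I_bichar ns \<epsilon>) (carrier (I_group ns) - {\<one>\<^bsub>I_group ns\<^esub>}))"
| "of_type (TypeII k) G \<beta> R \<longleftrightarrow>
     k \<ge> 1 \<and>
     frs_isomorphic G \<beta> R (II_group (2*k + 1)) (II_bichar (2*k + 1)) (II_roots (2*k + 1))"
| "of_type (TypeIII k) G \<beta> R \<longleftrightarrow>
     k \<ge> 1 \<and> frs_isomorphic G \<beta> R (Z2n (2*k)) (symplectic_bichar k) (III_roots k)"
| "of_type (TypeIV k) G \<beta> R \<longleftrightarrow>
     k \<ge> 3 \<and> frs_isomorphic G \<beta> R (IV_group (2*k)) (IV_bichar (2*k)) (IV_roots (2*k))"
| "of_type (TypeV k) G \<beta> R \<longleftrightarrow>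
     k \<ge> 3 \<and> frs_isomorphic G \<beta> R (Z2n (2*k)) (symplectic_bichar k) (V_roots k)"

text \<open>
  Different members of the following list are never isomorphic, with one exception: types
  \<open>IV(4)\<close> and \<open>V(3)\<close> are the same isomorphism class.  Indeed \<open>IV(4)\<close> lives on the even-weight
  vectors of \<open>\<int>\<^sub>2\<^sup>8\<close> modulo the all-ones vector, on which \<open>q(v) = |v|/2 mod 2\<close> is a well-defined
  quadratic form with polarization \<open>\<beta>\<close>; its root set is \<open>{v. q(v) = 1}\<close>, because a vector of
  weight 6 is congruent to one of weight 2.  Since \<open>q\<close> takes the value 1 exactly 28 times, it
  has Arf invariant 0, like the form \<open>g\<close> defining \<open>V(3)\<close>.  An explicit isomorphism sends \<open>v\<close> to
  \<open>(v\<cdot>y\<^sub>1, v\<cdot>x\<^sub>1, v\<cdot>y\<^sub>2, v\<cdot>x\<^sub>2, v\<cdot>y\<^sub>3, v\<cdot>x\<^sub>3)\<close> with \<open>x\<^sub>1 = 00001111\<close>, \<open>y\<^sub>1 = 00010111\<close>,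
  \<open>x\<^sub>2 = 00111001\<close>, \<open>y\<^sub>2 = 00111010\<close>, \<open>x\<^sub>3 = 01011100\<close>, \<open>y\<^sub>3 = 01100011\<close>.
  The Lie algebra of both is \<open>so(8)\<close>.  A statement about the uniqueness of the type
  therefore has to treat \<open>TypeIV 4\<close> and \<open>TypeV 3\<close> as two names of one type.
\<close>

definition listed_types :: "frs_type set" where
  "listed_types =
     {TypeI ns | ns. divisor_chain ns} \<union> {TypeII k | k. k \<ge> 2} \<union>
     {TypeIII k | k. k \<ge> 3} \<union> {TypeIV k | k. k \<ge> 4} \<union> {TypeV k | k. k \<ge> 3}"

end

theory Submission
  imports Defs
begin

text \<open>
  The Lie algebra \<open>L(R)\<close> sits inside the twisted group algebra with basis \<open>u\<^sub>a\<close>, and inner automorphisms of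
  \<open>L(R)\<close> extend to automorphisms of this algebra fixing its center. Hence a character of \<open>G\<close> that acts on
  \<open>L(R)\<close> by an inner automorphism is trivial on the radical of \<open>\<beta>\<close>. If all of them do, then \<open>\<beta>\<close> is
  nonsingular. Connected components of the graph \<open>\<beta>(a,b) \<noteq> 1\<close> on \<open>R\<close> span ideals of \<open>L(R)\<close>, so the graph is
  connected for simple \<open>L(R)\<close>; any two roots then have distance at most 2.

  If some root does not have order 2, then \<open>R\<close> consists of all nonzero elements (type I). Otherwise \<open>G\<close> is
  a symplectic space over the field with two elements, and \<open>R\<close> is closed under its own transvections. If two
  orthogonal roots sum to a root, then \<open>R\<close> again consists of all nonzero elements. If no root is adjacent to
  three distinct mutually orthogonal roots (a claw), then \<open>R\<close> is the set of transpositions of a symmetric group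
  (types II and IV). If there is a claw, then all orthogonal triples of roots sum to roots, and \<open>R\<close> is the
  set of nonsingular vectors of a quadratic form (types III and V). The types are told apart by
  \<open>|G|\<close>, \<open>|R|\<close>, the torsion of \<open>G\<close>, and whether sums of roots, or of orthogonal triples of roots, are roots.
\<close>

section \<open>Alternating bicharacters and connected root systems\<close>

text \<open>The elements \<open>u\<^sub>c\<close> with c in the radical do not occur in L(R), so
  L(R) itself cannot show how a character acts on them. In the associative twisted group algebra,
  bracketing with an element of L(R) is a derivation that kills every such \<open>u\<^sub>c\<close>.
  Its exponential is therefore multiplicative and fixes \<open>u\<^sub>c\<close>, while
  multiplicativity determines it on \<open>u\<^sub>c\<close> from its values on the roots.

  In exponent 2 the obstacle is that FRS2 speaks only of nonorthogonal pairs. Sums of orthogonal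
  roots are controlled by telescoping: one member of an orthogonal configuration is moved along
  nonorthogonal roots that stay orthogonal to the other members, and connectedness then spreads one
  configuration over all of R.

  The bounds on the parameters remove coincidences. Three, four or six points of a symmetric group
  give all nonzero vectors, which is type I, and III(2) has the same ten roots as II(2); hence the
  excluded clique sizes 2, 3, 5 and the bound 16 on the order of G. The coincidence that remains is
  28 = 8 choose 2 = (64 - 8) / 2, shared by IV(4) and V(3).\<close>

locale alternating_group = comm_group G for G :: "('a, 'm) monoid_scheme" (structure) +
  fixes \<beta> :: "'a \<Rightarrow> 'a \<Rightarrow> complex"
  assumes alternating_bichar: "alternating_bicharacter G \<beta>"
begin

lemma bichar_hom_right: "a \<in> carrier G \<Longrightarrow> (\<lambda>b. \<beta> a b) \<in> hom G Cstar"
  and bichar_hom_left: "a \<in> carrier G \<Longrightarrow> (\<lambda>b. \<beta> b a) \<in> hom G Cstar"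
  and bichar_self [simp]: "a \<in> carrier G \<Longrightarrow> \<beta> a a = 1"
  using alternating_bichar by (auto simp: alternating_bicharacter_def bicharacter_def)

lemma bichar_nonzero [simp]: "a \<in> carrier G \<Longrightarrow> b \<in> carrier G \<Longrightarrow> \<beta> a b \<noteq> 0"
  using bichar_hom_right[of a] by (auto simp: hom_def Cstar_def Pi_def)

lemma bichar_mult_right [simp]:
  "a \<in> carrier G \<Longrightarrow> b \<in> carrier G \<Longrightarrow> c \<in> carrier G \<Longrightarrow> \<beta> a (b \<otimes> c) = \<beta> a b * \<beta> a c"
  using bichar_hom_right[of a] by (auto simp: hom_def Cstar_def)

lemma bichar_mult_left [simp]:
  "a \<in> carrier G \<Longrightarrow> b \<in> carrier G \<Longrightarrow> c \<in> carrier G \<Longrightarrow> \<beta> (a \<otimes> b) c = \<beta> a c * \<beta> b c"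
  using bichar_hom_left[of c] by (auto simp: hom_def Cstar_def)

lemma bichar_one_right [simp]: "a \<in> carrier G \<Longrightarrow> \<beta> a \<one> = 1"
  using bichar_mult_right[of a \<one> \<one>] bichar_nonzero[of a \<one>] by (simp del: bichar_mult_right bichar_nonzero)

lemma bichar_one_left [simp]: "a \<in> carrier G \<Longrightarrow> \<beta> \<one> a = 1"
  using bichar_mult_left[of \<one> \<one> a] bichar_nonzero[of \<one> a] by (simp del: bichar_mult_left bichar_nonzero)

lemma bichar_swap:
  assumes "a \<in> carrier G" "b \<in> carrier G" shows "\<beta> b a = inverse (\<beta> a b)"
proof -
  have "1 = \<beta> (a \<otimes> b) (a \<otimes> b)"
    using assms by simp
  also have "\<dots> = \<beta> a b * \<beta> b a"
    using assms by (simp del: bichar_self add: bichar_self[of a] bichar_self[of b])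
  finally have "\<beta> a b * \<beta> b a = 1" ..
  thus ?thesis
    using inverse_unique by metis
qed

lemma bichar_eq_1_sym: "a \<in> carrier G \<Longrightarrow> b \<in> carrier G \<Longrightarrow> \<beta> b a = 1 \<longleftrightarrow> \<beta> a b = 1"
  using bichar_swap[of a b] by simp

lemma bichar_inv_right [simp]:
  assumes "a \<in> carrier G" "b \<in> carrier G" shows "\<beta> a (inv b) = inverse (\<beta> a b)"
proof -
  have "\<beta> a (inv b) * \<beta> a b = \<beta> a (inv b \<otimes> b)"
    using assms by (subst bichar_mult_right) auto
  hence "\<beta> a (inv b) * \<beta> a b = 1"
    using assms by simp
  thus ?thesis
    using inverse_unique[of "\<beta> a b" "\<beta> a (inv b)"] by (simp add: mult.commute)
qed

lemma bichar_inv_left [simp]: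
  assumes "a \<in> carrier G" "b \<in> carrier G" shows "\<beta> (inv a) b = inverse (\<beta> a b)"
  using assms bichar_swap[of b "inv a"] bichar_swap[of b a] by simp

lemma bichar_pow_right [simp]:
  assumes "a \<in> carrier G" "b \<in> carrier G" shows "\<beta> a (b [^] (n::nat)) = \<beta> a b ^ n"
  by (induction n) (use assms in auto)

lemma bichar_pow_left [simp]:
  assumes "a \<in> carrier G" "b \<in> carrier G" shows "\<beta> (a [^] (n::nat)) b = \<beta> a b ^ n"
  by (induction n) (use assms in auto)

lemma Rad_subgroup: "subgroup (Rad G \<beta>) G"
  by (rule subgroupI) (auto simp: Rad_def)

lemma bichar_right_eq_1_on_generate:
  assumes "S \<subseteq> carrier G" "a \<in> carrier G" "\<And>s. s \<in> S \<Longrightarrow> \<beta> a s = 1" "x \<in> generate G S"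
  shows "\<beta> a x = 1"
  using assms(4)
proof (induction rule: generate.induct)
  case (eng h1 h2)
  thus ?case
    using assms(1,2) generate_incl[OF assms(1)] by (subst bichar_mult_right) auto
qed (use assms in auto)

end

context finite_root_system
begin

sublocale alternating_group G \<beta>
  by unfold_locales (rule alternating)

lemma root_carrier [simp, intro]: "a \<in> R \<Longrightarrow> a \<in> carrier G"
  using FRS0_subset by auto

lemma one_not_root [simp]: "\<one> \<notin> R"
  using FRS0_subset by (auto simp: Rad_def)

lemma in_Rad_if_orthogonal_roots:
  assumes "a \<in> carrier G" "\<And>r. r \<in> R \<Longrightarrow> \<beta> a r = 1" shows "a \<in> Rad G \<beta>"
  using bichar_right_eq_1_on_generate[of R a] assms FRS0_generates by (auto simp: Rad_def)

end

text \<open>Connectedness is stated as an induction principle: a property of some root that passes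
  along nonorthogonal pairs belongs to every root.\<close>

locale connected_root_system = finite_root_system +
  assumes nonsingular: "nonsingular G \<beta>"
    and connected:
      "\<lbrakk>S \<subseteq> R; S \<noteq> {}; \<And>a b. a \<in> S \<Longrightarrow> b \<in> R \<Longrightarrow> \<beta> a b \<noteq> 1 \<Longrightarrow> b \<in> S\<rbrakk> \<Longrightarrow> S = R"
begin

lemma eq_one_if_orthogonal_roots:
  assumes "a \<in> carrier G" "\<And>r. r \<in> R \<Longrightarrow> \<beta> a r = 1" shows "a = \<one>"
  using in_Rad_if_orthogonal_roots[OF assms] nonsingular by (auto simp: nonsingular_def)

text \<open>In an orthogonal splitting a root of \<open>R1\<close> is nonorthogonal only to roots of
  \<open>R1\<close>, so connectedness leaves nothing for \<open>R2\<close>.\<close>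

lemma not_reducible: "\<not> frs_reducible G \<beta> R"
proof
  assume "frs_reducible G \<beta> R"
  then obtain R1 R2 where R: "R1 \<union> R2 = R" "R1 \<inter> R2 = {}" "R1 \<noteq> {}" "R2 \<noteq> {}"
    "\<forall>a\<in>R1. \<forall>b\<in>R2. \<beta> a b = 1"
    unfolding frs_reducible_def by blast
  have "R1 = R"
    by (rule connected) (use R in blast)+
  thus False
    using R by blast
qed

text \<open>A path \<open>x - w - a - b\<close> in the graph of nonorthogonal pairs is shortened by \<open>x - (w + a) - b\<close>.\<close>

lemma adjacent_or_common_neighbour:
  assumes "x \<in> R" "y \<in> R" "x \<noteq> y" "\<beta> x y = 1"
  obtains w where "w \<in> R" "\<beta> x w \<noteq> 1" "\<beta> w y \<noteq> 1"
proof -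
  define S where "S = {y \<in> R. y = x \<or> \<beta> x y \<noteq> 1 \<or> (\<exists>w\<in>R. \<beta> x w \<noteq> 1 \<and> \<beta> w y \<noteq> 1)}"
  have "S = R"
  proof (rule connected)
    fix a b assume a: "a \<in> S" and b: "b \<in> R" "\<beta> a b \<noteq> 1"
    have aR: "a \<in> R" using a by (auto simp: S_def)
    consider "a = x" | "\<beta> x a \<noteq> 1" | w where "\<beta> x a = 1" "w \<in> R" "\<beta> x w \<noteq> 1" "\<beta> w a \<noteq> 1"
      using a by (auto simp: S_def)
    thus "b \<in> S"
    proof cases
      case 3
      show ?thesis
      proof (cases "\<beta> w b = 1")
        case True
        have "w \<otimes> a \<in> R" using 3 aR by (intro FRS2) auto
        moreover have "\<beta> x (w \<otimes> a) \<noteq> 1" "\<beta> (w \<otimes> a) b \<noteq> 1"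
          using 3 True b assms(1) aR by auto
        ultimately show ?thesis using b by (auto simp: S_def)
      qed (use b 3 in \<open>auto simp: S_def\<close>)
    qed (use b aR in \<open>auto simp: S_def\<close>)
  qed (use assms(1) in \<open>auto simp: S_def\<close>)
  thus thesis
    using that assms by (auto simp: S_def)
qed

text \<open>Since \<open>\<beta> z z = 1\<close>, adding z does not change the pairing with z, and
  FRS2 can be repeated.\<close>

lemma root_pow_mult:
  assumes "z \<in> R" "w \<in> R" "\<beta> w z \<noteq> 1" shows "w \<otimes> z [^] (k::nat) \<in> R"
proof (induction k)
  case (Suc k)
  have "(w \<otimes> z [^] k) \<otimes> z \<in> R"
    by (rule FRS2) (use Suc assms in auto)
  thus ?case using assms by (simp add: m_assoc)
qed (use assms in auto)

text \<open>x + y = (x + z) + (y - z), and the two summands pair to the inverse of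
  \<open>\<beta> x z * \<beta> y z\<close>. Mostly used backwards: if x + y is no root, each root is
  orthogonal to x or to y, or its values at x and y are inverse to each other.\<close>

lemma mult_root_if_prod_neq_1:
  assumes "x \<in> R" "y \<in> R" "\<beta> x y = 1" "z \<in> R" "\<beta> x z \<noteq> 1" "\<beta> y z \<noteq> 1" "\<beta> x z * \<beta> y z \<noteq> 1"
  shows "x \<otimes> y \<in> R"
proof -
  have c: "x \<in> carrier G" "y \<in> carrier G" "z \<in> carrier G" using assms by auto
  have "x \<otimes> z \<in> R" "y \<otimes> inv z \<in> R"
    using assms by (auto intro!: FRS2 FRS1)
  moreover have "\<beta> (x \<otimes> z) (y \<otimes> inv z) \<noteq> 1"
    using assms(3,7) c bichar_swap[of y z] bichar_nonzero[of x z] bichar_nonzero[of y z]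
    by (auto simp: field_simps)
  ultimately have "(x \<otimes> z) \<otimes> (y \<otimes> inv z) \<in> R"
    by (rule FRS2)
  also have "(x \<otimes> z) \<otimes> (y \<otimes> inv z) = x \<otimes> y"
    using c by (metis inv_closed m_assoc m_comm m_closed r_inv r_one)
  finally show ?thesis .
qed

text \<open>Along the roots w + kz' the value at x stays \<open>\<theta>\<close>, while the value at
  y gains a factor \<open>\<eta>\<close> each time. By \<open>mult_root_if_prod_neq_1\<close> only
  two values at y are possible, so all powers of \<open>\<eta>\<close> lie in {1,
  \<open>\<theta>\<close>}, which forces the square of \<open>\<eta>\<close> to be 1.\<close>

lemma bichar_minus_one_if_sum_not_root:
  assumes x: "x \<in> R" and y: "y \<in> R" and nR: "x \<otimes> y \<notin> R"
    and z: "z \<in> R" "\<beta> x z = 1" "\<beta> y z \<noteq> 1"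
  shows "\<beta> y z = -1"
proof -
  have c: "x \<in> carrier G" "y \<in> carrier G" "z \<in> carrier G" using x y z by auto
  have xy: "\<beta> x y = 1" using FRS2[OF x y] nR by blast
  have ne: "x \<noteq> y" using z by auto
  obtain w where w: "w \<in> R" "\<beta> x w \<noteq> 1" "\<beta> w y \<noteq> 1"
    using adjacent_or_common_neighbour[OF x y ne xy] .
  \<comment> \<open>Moving along z' requires that z' is not orthogonal to w. If z fails, y + z has
    the same values at x and y and pairs with w as y does.\<close>
  obtain z' where z': "z' \<in> R" "\<beta> x z' = 1" "\<beta> y z' = \<beta> y z" "\<beta> w z' \<noteq> 1"
  proof (cases "\<beta> w z = 1")
    case True
    have "y \<otimes> z \<in> R" using y z by (intro FRS2) auto
    thus thesis using that[of "y \<otimes> z"] w z xy True c by auto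
  qed (use z that in auto)
  define \<eta> where "\<eta> = \<beta> y z"
  define \<theta> where "\<theta> = \<beta> x w"
  have \<eta>: "\<eta> \<noteq> 1" "\<eta> \<noteq> 0" and \<theta>: "\<theta> \<noteq> 1" "\<theta> \<noteq> 0"
    using z w c by (auto simp: \<eta>_def \<theta>_def)
  have key: "\<beta> y w * \<eta> ^ k = 1 \<or> \<theta> * (\<beta> y w * \<eta> ^ k) = 1" for k
  proof -
    have "w \<otimes> z' [^] k \<in> R" using w z' by (intro root_pow_mult) auto
    moreover have "\<beta> x (w \<otimes> z' [^] k) = \<theta>" "\<beta> y (w \<otimes> z' [^] k) = \<beta> y w * \<eta> ^ k"
      using w z' c by (auto simp: \<eta>_def \<theta>_def)
    ultimately show ?thesis
      using mult_root_if_prod_neq_1[OF x y xy, of "w \<otimes> z' [^] k"] nR \<theta> by auto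
  qed
  have "\<beta> y w \<noteq> 1" using w c bichar_eq_1_sym by auto
  hence 0: "\<theta> * \<beta> y w = 1" using key[of 0] by simp
  have pow: "\<eta> ^ k = \<theta> \<or> \<eta> ^ k = 1" for k
    using key[of k]
  proof
    assume "\<beta> y w * \<eta> ^ k = 1"
    hence "\<theta> * (\<beta> y w * \<eta> ^ k) = \<theta>" by simp
    thus ?thesis using 0 by (simp flip: mult.assoc)
  qed (use 0 in \<open>simp flip: mult.assoc\<close>)
  have "\<eta> ^ 2 = 1" using pow[of 1] pow[of 2] \<eta> by (auto simp: power2_eq_square)
  thus ?thesis using \<eta> by (auto simp: \<eta>_def power2_eq_1_iff)
qed

text \<open>By nonsingularity it suffices that every root has values 1 or -1 at x and y. For a root
  orthogonal to one of them this is the preceding lemma. A root z orthogonal to neither is compared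
  with z + s, where s separates x + y from 0: the values of z + s at x and y are not inverse to each
  other, so one of them is 1, and a value of z is inverse to a sign.\<close>

lemma sq_eq_one_if_sum_not_root:
  assumes x: "x \<in> R" and y: "y \<in> R" and nR: "x \<otimes> y \<notin> R" and n1: "x \<otimes> y \<noteq> \<one>"
  shows "x \<otimes> x = \<one> \<and> y \<otimes> y = \<one>"
proof -
  have c: "x \<in> carrier G" "y \<in> carrier G" using x y by auto
  have xy: "\<beta> x y = 1" using FRS2[OF x y] nR by blast
  have yx: "y \<otimes> x \<notin> R" using nR c by (simp add: m_comm)
  have types: "\<beta> x z = 1 \<or> \<beta> y z = 1 \<or> \<beta> x z * \<beta> y z = 1" if "z \<in> R" for z
    using mult_root_if_prod_neq_1[OF x y xy that] nR by auto
  \<comment> \<open>The set equation treats both orders of x and y at once.\<close>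
  have ex: "\<beta> v z * \<beta> v z = 1" if zR: "z \<in> R" and uv: "{u, v} = {x, y}" for u v z
  proof -
    have u: "u \<in> R" and v: "v \<in> R" and nuv: "u \<otimes> v \<notin> R"
      using uv x y nR yx by (auto simp: doubleton_eq_iff)
    have neg: "\<beta> v z' * \<beta> v z' = 1" if "z' \<in> R" "\<beta> u z' = 1" for z'
      using bichar_minus_one_if_sum_not_root[OF u v nuv that] by (cases "\<beta> v z' = 1") auto
    have neg': "\<beta> u z' * \<beta> u z' = 1" if "z' \<in> R" "\<beta> v z' = 1" for z'
      using bichar_minus_one_if_sum_not_root[OF v u, of z'] nuv that u v m_comm[of u v] by (cases "\<beta> u z' = 1") auto
    show ?thesis
    proof (cases "\<beta> u z = 1 \<or> \<beta> v z = 1")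
      case False
      hence prod: "\<beta> u z * \<beta> v z = 1"
        using types[OF zR] uv by (auto simp: doubleton_eq_iff mult.commute)
      obtain t where t: "t \<in> R" "\<beta> (x \<otimes> y) t \<noteq> 1"
        using eq_one_if_orthogonal_roots[of "x \<otimes> y"] n1 c by auto
      hence t1: "\<beta> u t * \<beta> v t \<noteq> 1"
        using uv c by (auto simp: doubleton_eq_iff mult.commute)
      hence t2: "\<beta> u t = 1 \<or> \<beta> v t = 1"
        using types[OF t(1)] uv by (auto simp: doubleton_eq_iff mult.commute)
      \<comment> \<open>z + s has to be a root. If t is orthogonal to z, the one of u and v that is
        not orthogonal to t is added to t; both values of t are kept.\<close>
      obtain s where s: "s \<in> R" "\<beta> u s = \<beta> u t" "\<beta> v s = \<beta> v t" "\<beta> z s \<noteq> 1"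
      proof (cases "\<beta> z t = 1")
        case True
        have uv1: "\<beta> u v = 1" "\<beta> v u = 1"
          using uv xy bichar_eq_1_sym[OF c] by (auto simp: doubleton_eq_iff)
        define p where "p = (if \<beta> u t = 1 then v else u)"
        have p: "p \<in> R" "\<beta> p t \<noteq> 1" "\<beta> u p = 1" "\<beta> v p = 1"
          using t1 t2 u v uv1 by (auto simp: p_def)
        have "\<beta> z p \<noteq> 1"
          using False zR u v bichar_eq_1_sym[of z u] bichar_eq_1_sym[of z v] by (auto simp: p_def)
        moreover have "p \<otimes> t \<in> R" using p t by (intro FRS2) auto
        ultimately show thesis
          using that[of "p \<otimes> t"] p t u v zR True by auto
      qed (use t that in auto)
      have zs: "z \<otimes> s \<in> R" using zR s by (intro FRS2) auto
      have m: "\<beta> u (z \<otimes> s) = \<beta> u z * \<beta> u t" "\<beta> v (z \<otimes> s) = \<beta> v z * \<beta> v t"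
        using u v zR s by auto
      have "\<beta> u z * \<beta> u t = 1 \<or> \<beta> v z * \<beta> v t = 1 \<or> \<beta> u z * \<beta> u t * (\<beta> v z * \<beta> v t) = 1"
        using types[OF zs] uv m by (auto simp: doubleton_eq_iff mult.commute)
      moreover have "\<beta> u z * \<beta> u t * (\<beta> v z * \<beta> v t) \<noteq> 1"
      proof -
        have "\<beta> u z * \<beta> u t * (\<beta> v z * \<beta> v t) = (\<beta> u z * \<beta> v z) * (\<beta> u t * \<beta> v t)"
          by (simp only: ac_simps)
        also have "\<dots> = \<beta> u t * \<beta> v t"
          by (simp only: prod mult_1)
        finally show ?thesis using t1 by metis
      qed
      ultimately have 1: "\<beta> u z * \<beta> u t = 1 \<or> \<beta> v z * \<beta> v t = 1" by blast
      have sq: "\<beta> u t * \<beta> u t = 1" "\<beta> v t * \<beta> v t = 1"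
        using t2 neg[OF t(1)] neg'[OF t(1)] by auto
      have "\<beta> u z * \<beta> u z = 1 \<or> \<beta> v z * \<beta> v z = 1"
        using 1
      proof
        assume "\<beta> u z * \<beta> u t = 1"
        hence "(\<beta> u z * \<beta> u z) * (\<beta> u t * \<beta> u t) = 1"
          by (metis mult.assoc mult.left_commute mult_1)
        thus ?thesis using sq by simp
      next
        assume "\<beta> v z * \<beta> v t = 1"
        hence "(\<beta> v z * \<beta> v z) * (\<beta> v t * \<beta> v t) = 1"
          by (metis mult.assoc mult.left_commute mult_1)
        thus ?thesis using sq by simp
      qed
      moreover have "(\<beta> u z * \<beta> u z) * (\<beta> v z * \<beta> v z) = 1"
        using prod by (metis mult.assoc mult.left_commute mult_1)
      ultimately show ?thesis by auto
    qed (use neg[OF zR] in auto)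
  qed
  have "v \<otimes> v = \<one>" if "{u, v} = {x, y}" for u v
  proof (rule eq_one_if_orthogonal_roots)
    show "v \<otimes> v \<in> carrier G" using that c by (auto simp: doubleton_eq_iff)
    fix r assume "r \<in> R"
    thus "\<beta> (v \<otimes> v) r = 1"
      using ex[OF _ that, of r] that c by (auto simp: doubleton_eq_iff)
  qed
  from this[of y x] this[of x y] show ?thesis by auto
qed

text \<open>If \<open>a\<close> is a root with \<open>2a \<noteq> 0\<close> and \<open>x\<close>, \<open>y\<close> are roots of order 2, then \<open>x + y\<close> is reached through
  the roots \<open>a + x\<close> and \<open>a + x + y\<close>, none of which has order 2.\<close>

lemma elementary_or_all_roots: "(\<forall>x\<in>carrier G. x \<otimes> x = \<one>) \<or> R = carrier G - {\<one>}"
proof (cases "\<exists>a\<in>R. a \<otimes> a \<noteq> \<one>")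
  case True
  then obtain a where a: "a \<in> R" "a \<otimes> a \<noteq> \<one>" by blast
  define A where "A = {a \<in> R. a \<otimes> a \<noteq> \<one>}"
  have A: "x \<otimes> b \<in> insert \<one> R" if "b \<in> A" "x \<in> R" for x b
    using sq_eq_one_if_sum_not_root[of x b] that by (auto simp: A_def)
  have sum: "x \<otimes> y \<in> insert \<one> R" if xy: "x \<in> R" "y \<in> R" for x y
  proof (cases "x \<in> A \<or> y \<in> A")
    case True
    thus ?thesis using A[of y x] A[of x y] xy m_comm[of x y] by auto
  next
    case False
    hence sq: "x \<otimes> x = \<one>" "y \<otimes> y = \<one>" using xy by (auto simp: A_def)
    have c: "x \<in> carrier G" "y \<in> carrier G" "a \<in> carrier G" using xy a by auto
    have "inv a \<otimes> inv a \<noteq> \<one>"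
      using a c inv_mult_group[of a a] by (metis inv_inv inv_one m_closed)
    hence aA: "a \<in> A" "inv a \<in> A"
      using a FRS1[of a] by (auto simp: A_def)
    have pres: "z \<otimes> t \<in> A" if z: "z \<in> A" and t: "t \<in> R" "t \<otimes> t = \<one>" for z t
    proof -
      have zc: "z \<in> carrier G" "t \<in> carrier G" using z t by (auto simp: A_def)
      have "(z \<otimes> t) \<otimes> (z \<otimes> t) = (z \<otimes> z) \<otimes> (t \<otimes> t)"
        using zc by (simp add: m_ac)
      also have "\<dots> = z \<otimes> z" using t zc by simp
      finally have "(z \<otimes> t) \<otimes> (z \<otimes> t) \<noteq> \<one>" using z by (auto simp: A_def)
      moreover have "z \<otimes> t \<in> insert \<one> R"
        using A[OF z t(1)] zc by (simp add: m_comm)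
      ultimately show ?thesis by (auto simp: A_def)
    qed
    have "a \<otimes> x \<otimes> y \<in> A"
      using pres[OF pres[OF aA(1) xy(1) sq(1)] xy(2) sq(2)] .
    hence "a \<otimes> x \<otimes> y \<otimes> inv a \<in> insert \<one> R"
      using A[OF aA(2), of "a \<otimes> x \<otimes> y"] by (auto simp: A_def)
    moreover have "a \<otimes> x \<otimes> y \<otimes> inv a = x \<otimes> y"
      using c by (metis inv_solve_right' m_assoc m_closed m_comm)
    ultimately show ?thesis by simp
  qed
  have "subgroup (insert \<one> R) G"
    by (rule subgroupI) (use sum FRS1 in auto)
  hence "generate G R \<subseteq> insert \<one> R"
    by (rule generate_subgroup_incl[rotated]) auto
  thus ?thesis using FRS0_generates FRS0_subset one_not_root by auto
next
  case False
  have "x \<otimes> x = \<one>" if "x \<in> generate G R" for x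
    using that
  proof (induction rule: generate.induct)
    case (inv h)
    thus ?case using False by (metis inv_mult_group inv_one root_carrier)
  next
    case (eng h1 h2)
    hence "h1 \<in> carrier G" "h2 \<in> carrier G" using FRS0_generates by auto
    hence "(h1 \<otimes> h2) \<otimes> (h1 \<otimes> h2) = (h1 \<otimes> h1) \<otimes> (h2 \<otimes> h2)"
      by (simp add: m_ac)
    thus ?case using eng by simp
  qed (use False in auto)
  thus ?thesis using FRS0_generates by auto
qed

end

section \<open>Root systems in elementary abelian 2-groups\<close>

locale elementary_root_system = connected_root_system +
  assumes sq [simp]: "x \<in> carrier G \<Longrightarrow> x \<otimes> x = \<one>"
begin

text \<open>In exponent 2 the values of \<open>\<beta>\<close> are 1 and -1, so this relation
  carries all of \<open>\<beta>\<close>. Pairing with a sum becomes exclusive or, written below as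
  inequality of truth values.\<close>

definition adj :: "'a \<Rightarrow> 'a \<Rightarrow> bool" where "adj a b \<longleftrightarrow> \<beta> a b \<noteq> 1"

lemma bichar_cases: 
  assumes "a \<in> carrier G" "b \<in> carrier G" shows "\<beta> a b = 1 \<or> \<beta> a b = -1"
  using bichar_mult_left[of a a b] assms sq[of a]
  by (simp del: bichar_mult_left add: square_eq_1_iff)

lemma bichar_adj: 
  assumes "a \<in> carrier G" "b \<in> carrier G" shows "\<beta> a b = (if adj a b then -1 else 1)"
  using bichar_cases[OF assms] by (auto simp: adj_def)

lemma adj_mult_left [simp]:
  assumes "a \<in> carrier G" "b \<in> carrier G" "c \<in> carrier G"
  shows "adj (a \<otimes> b) c \<longleftrightarrow> adj a c \<noteq> adj b c"
  using bichar_cases[of a c] bichar_cases[of b c] assms by (auto simp: adj_def)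

lemma adj_mult_right [simp]:
  assumes "a \<in> carrier G" "b \<in> carrier G" "c \<in> carrier G"
  shows "adj a (b \<otimes> c) \<longleftrightarrow> adj a b \<noteq> adj a c"
  using bichar_cases[of a c] bichar_cases[of a b] assms by (auto simp: adj_def)

lemma adj_self [simp]: "a \<in> carrier G \<Longrightarrow> \<not> adj a a"
  by (simp add: adj_def)

lemma adj_one [simp]: "a \<in> carrier G \<Longrightarrow> \<not> adj a \<one>" "a \<in> carrier G \<Longrightarrow> \<not> adj \<one> a"
  by (simp_all add: adj_def)

lemma adj_sym: "a \<in> carrier G \<Longrightarrow> b \<in> carrier G \<Longrightarrow> adj a b \<longleftrightarrow> adj b a"
  using bichar_eq_1_sym[of a b] by (auto simp: adj_def)

lemma adj_closed: "a \<in> R \<Longrightarrow> b \<in> R \<Longrightarrow> adj a b \<Longrightarrow> a \<otimes> b \<in> R"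
  using FRS2 by (simp add: adj_def)

lemma mult_left_cancel_self [simp]: "a \<in> carrier G \<Longrightarrow> b \<in> carrier G \<Longrightarrow> a \<otimes> (a \<otimes> b) = b"
  by (simp flip: m_assoc)

lemma inv_self [simp]: "a \<in> carrier G \<Longrightarrow> inv a = a"
  by (simp add: inv_equality)

lemma mult_eq_one_iff: "a \<in> carrier G \<Longrightarrow> b \<in> carrier G \<Longrightarrow> a \<otimes> b = \<one> \<longleftrightarrow> a = b"
  using inv_equality[of a b] by auto

lemma separating_root:
  assumes "a \<in> carrier G" "a \<noteq> \<one>"
  obtains r where "r \<in> R" "adj r a"
  using eq_one_if_orthogonal_roots[OF assms(1)] assms adj_sym[of a] by (auto simp: adj_def)

lemma common_neighbour:
  assumes "x \<in> R" "y \<in> R" "x \<noteq> y" "\<not> adj x y"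
  obtains w where "w \<in> R" "adj w x" "adj w y"
proof -
  obtain w where "w \<in> R" "\<beta> x w \<noteq> 1" "\<beta> w y \<noteq> 1"
    using adjacent_or_common_neighbour[of x y] assms unfolding adj_def by blast
  thus thesis
    using that[of w] adj_sym[of x w] assms(1) by (auto simp: adj_def)
qed

text \<open>A root realizing the sum of two adjacency patterns on the orthogonal complement of \<open>p\<close>: if \<open>w\<close> and
  \<open>w'\<close> are not adjacent, then \<open>w\<close> is first replaced by \<open>w + p\<close>, which has the same pattern.\<close>

lemma combine:
  assumes w: "w \<in> R" "w' \<in> R" and p: "p \<in> R" "adj w p" "adj w' p"
  obtains w'' where "w'' \<in> R"
    "\<And>r. r \<in> carrier G \<Longrightarrow> \<not> adj p r \<Longrightarrow> adj w'' r \<longleftrightarrow> adj w r \<noteq> adj w' r"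
proof (cases "adj w w'")
  case True
  show thesis by (rule that[of "w \<otimes> w'"]) (use w True in \<open>auto intro: adj_closed\<close>)
next
  case False
  have "w \<otimes> p \<in> R" using w p by (intro adj_closed)
  hence "(w \<otimes> p) \<otimes> w' \<in> R"
    using w p False adj_sym[of p w'] by (intro adj_closed) auto
  thus thesis by (rule that) (use w p in auto)
qed

lemma all_roots_if_closed:
  assumes "\<And>x y. x \<in> R \<Longrightarrow> y \<in> R \<Longrightarrow> x \<noteq> y \<Longrightarrow> x \<otimes> y \<in> R"
  shows "R = carrier G - {\<one>}"
proof -
  have "x \<otimes> y \<in> insert \<one> R" if "x \<in> insert \<one> R" "y \<in> insert \<one> R" for x y
    using assms[of x y] that by (cases "x = y") auto
  hence "subgroup (insert \<one> R) G"
    by (intro subgroupI) (use FRS1 in auto)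
  hence "generate G R \<subseteq> insert \<one> R"
    by (rule generate_subgroup_incl[rotated]) auto
  thus ?thesis using FRS0_generates FRS0_subset one_not_root by auto
qed

subsection \<open>Orthogonal roots whose sum is a root\<close>

text \<open>A projective line of pairwise orthogonal roots. The degenerate case x = y is excluded by
  \<open>x \<otimes> y \<in> R\<close>, since 0 is no root.\<close>

definition collinear :: "'a \<Rightarrow> 'a \<Rightarrow> bool" where
  "collinear x y \<longleftrightarrow> x \<in> R \<and> y \<in> R \<and> \<not> adj x y \<and> x \<otimes> y \<in> R"

lemma collinear_sym: "collinear x y \<Longrightarrow> collinear y x"
  by (auto simp: collinear_def m_comm adj_sym)

text \<open>x + y' = (x + y) + (y + y'), a sum of two nonorthogonal roots.\<close>

lemma collinear_step:
  assumes "collinear x y" "y' \<in> R" "adj y y'" "\<not> adj x y'"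
  shows "collinear x y'"
proof -
  have c: "x \<in> R" "y \<in> R" "x \<otimes> y \<in> R" "\<not> adj x y" using assms by (auto simp: collinear_def)
  have "(x \<otimes> y) \<otimes> (y \<otimes> y') \<in> R"
    by (rule adj_closed) (use c assms adj_sym[of y x] in \<open>auto intro: adj_closed\<close>)
  also have "(x \<otimes> y) \<otimes> (y \<otimes> y') = x \<otimes> y'"
    using c assms by (simp add: m_assoc)
  finally show ?thesis using assms c by (simp add: collinear_def)
qed

text \<open>Two applications of \<open>collinear_step\<close>: y moves to w and then to y', inside
  the complement of x.\<close>

lemma collinear_link:
  assumes "collinear x y" "w \<in> R" "y' \<in> R" "adj w y" "adj w y'" "\<not> adj w x" "\<not> adj x y'"
  shows "collinear x y'"
proof -
  have c: "x \<in> R" "y \<in> R" using assms by (auto simp: collinear_def)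
  have "collinear x w"
    using assms c adj_sym[of w x] adj_sym[of w y] by (intro collinear_step[OF assms(1)]) auto
  thus ?thesis
    by (rule collinear_step) (use assms in auto)
qed

text \<open>If x + y' is no root, then y' is also orthogonal to y and to s = x + y, and
  \<open>collinear_link\<close> restricts all other roots: y and s turn out to be collinear with y',
  so no root is adjacent to x but not to y'. Such a root arises, however, from a root separating x
  from y' and a common neighbour of y and y'.\<close>

lemma collinear_local:
  assumes xy: "collinear x y" and y': "y' \<in> R" "\<not> adj x y'" "y' \<noteq> x"
  shows "collinear x y'"
proof (rule ccontr)
  assume no: "\<not> collinear x y'"
  define s where "s = x \<otimes> y"
  have c: "x \<in> R" "y \<in> R" "s \<in> R" "\<not> adj x y" "\<not> adj x s" "\<not> adj y s" "s = x \<otimes> y"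
    using xy adj_sym[of y x] by (auto simp: collinear_def s_def)
  have col: "collinear x y" "collinear y x" "collinear x s" "collinear s x" "collinear y s" "collinear s y"
    using c adj_sym[of s x] adj_sym[of s y] adj_sym[of y x] m_comm[of x y] m_comm[of s x] m_comm[of s y]
    by (auto simp: collinear_def s_def m_assoc)
  have ad: "adj w s \<longleftrightarrow> adj w x \<noteq> adj w y" if "w \<in> R" for w
    using that c by simp
  have ns: "y' \<noteq> s" "y' \<noteq> y"
    using no col by auto
  have o: "\<not> adj y y'" "\<not> adj s y'"
    using no collinear_step[OF col(1) y'(1)] collinear_step[OF col(3) y'(1)] y' by auto
  have n: "\<not> collinear s y'" if "w \<in> R" "adj w x" "\<not> adj w y" "\<not> adj w y'" for w
    using that no o y' c ad[of w] collinear_link[of y' s w x] collinear_sym adj_sym[of x y'] by auto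
  obtain w2 where w2: "w2 \<in> R" "adj w2 y" "adj w2 y'"
    using common_neighbour[of y y'] c y' o ns by blast
  have w2x: "adj w2 x"
    using collinear_link[OF col(1) w2(1) y'(1) w2(2,3)] y' no by blast
  have sy': "collinear s y'"
    using collinear_link[of s x w2 y'] w2 w2x col o y' ad[of w2] by blast
  obtain w3 where w3: "w3 \<in> R" "adj w3 s" "adj w3 y'"
    using common_neighbour[of s y'] c y' o ns by blast
  have w3': "adj w3 x" "\<not> adj w3 y"
    using collinear_link[OF col(1) w3(1) y'(1)] y' no w3 ad[of w3] by blast+
  have yy': "collinear y y'"
    using collinear_link[of y x w3 y'] w3 w3' col o y' by blast
  \<comment> \<open>Such a w is adjacent to exactly one of y and s, and a link through w would carry
    the collinearity of that one with y' over to x.\<close>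
  have not110: "\<not> (adj w x \<and> \<not> adj w y')" if "w \<in> R" for w
  proof
    assume w: "adj w x \<and> \<not> adj w y'"
    have "collinear y' x" if "collinear t y'" "adj w t" for t
      using collinear_link[of y' t w x] that collinear_sym \<open>w \<in> R\<close> w y' c adj_sym[of x y'] by auto
    thus False using no sy' yy' w ad[OF that] collinear_sym by metis
  qed
  obtain z where z: "z \<in> R" "adj z (x \<otimes> y')"
    using separating_root[of "x \<otimes> y'"] y' c by (auto simp: mult_eq_one_iff)
  have z': "\<not> adj z x" "adj z y'"
    using z not110[of z] y' c by auto
  obtain w where w: "w \<in> R" "\<And>r. r \<in> carrier G \<Longrightarrow> \<not> adj y' r \<Longrightarrow> adj w r \<longleftrightarrow> adj z r \<noteq> adj w2 r"
    using combine[of z w2 y'] z z' w2 y' by blast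
  show False
    using not110[OF w(1)] w(2)[of x] w(2)[of y'] y' c w2 w2x z z' adj_sym[of x y'] by auto
qed

text \<open>Having a collinear partner passes from a to an adjacent root b: the partner y of a
  serves b if y and b are orthogonal, and otherwise y + a + b does, because b + (y + a + b) = a + y.
  Then \<open>collinear_local\<close> turns every sum of distinct orthogonal roots into a
  root.\<close>

lemma all_roots_if_collinear:
  assumes "collinear x y" shows "R = carrier G - {\<one>}"
proof -
  define P where "P = {x. \<exists>y. collinear x y}"
  have xor_neq: "x \<noteq> y" if "collinear x y" for x y
    using that by (auto simp: collinear_def)
  have "P = R"
  proof (rule connected)
    fix a b assume a: "a \<in> P" and b: "b \<in> R" "\<beta> a b \<noteq> 1"
    then obtain y where y: "collinear a y" by (auto simp: P_def)
    have ab: "adj a b" "a \<in> R" "y \<in> R" "\<not> adj a y" using b y by (auto simp: adj_def collinear_def)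
    show "b \<in> P"
    proof (cases "adj y b")
      case False
      hence "collinear y b"
        using collinear_step[of y a b] collinear_sym[OF y] ab b by blast
      thus ?thesis using collinear_sym by (auto simp: P_def)
    next
      case True
      have u: "a \<otimes> b \<in> R" using ab b by (intro adj_closed)
      have "y \<otimes> (a \<otimes> b) \<in> R"
        using ab b u True adj_sym[of y a] by (intro adj_closed) auto
      moreover have "b \<otimes> (y \<otimes> (a \<otimes> b)) = a \<otimes> y"
        using ab b by (metis m_assoc m_closed m_comm mult_left_cancel_self root_carrier)
      moreover have "\<not> adj b (y \<otimes> (a \<otimes> b))"
        using ab b True adj_sym[of b a] adj_sym[of b y] by auto
      ultimately have "collinear b (y \<otimes> (a \<otimes> b))"
        using b y by (auto simp: collinear_def)
      thus ?thesis by (auto simp: P_def)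
    qed
  qed (use assms in \<open>auto simp: P_def collinear_def\<close>)
  show ?thesis
  proof (rule all_roots_if_closed)
    fix a b assume ab: "a \<in> R" "b \<in> R" "a \<noteq> b"
    show "a \<otimes> b \<in> R"
    proof (cases "adj a b")
      case False
      obtain y where "collinear a y" using ab \<open>P = R\<close> by (auto simp: P_def)
      hence "collinear a b" using collinear_local ab False by blast
      thus ?thesis by (simp add: collinear_def)
    qed (use ab adj_closed in auto)
  qed
qed

subsection \<open>Orthogonal triples of roots\<close>

text \<open>For distinct entries, \<open>p\<close>, \<open>q\<close>, \<open>r\<close> and their sum
  form an affine plane of pairwise orthogonal roots. With a repeated entry the last condition is
  trivial, which is why distinctness appears separately below.\<close>

definition coplanar :: "'a \<Rightarrow> 'a \<Rightarrow> 'a \<Rightarrow> bool" where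
  "coplanar p q r \<longleftrightarrow> p \<in> R \<and> q \<in> R \<and> r \<in> R \<and> \<not> adj p q \<and> \<not> adj p r \<and> \<not> adj q r \<and>
     p \<otimes> q \<otimes> r \<in> R"

lemma coplanar_perm: "coplanar p q r \<Longrightarrow> coplanar q p r" "coplanar p q r \<Longrightarrow> coplanar p r q"
  using adj_sym[of p q] adj_sym[of q r] by (auto simp: coplanar_def m_ac)

text \<open>p + q + r' = (p + q + r) + (r + r'), again a sum of two nonorthogonal roots.\<close>

lemma coplanar_step:
  assumes "coplanar p q r" "r' \<in> R" "adj r r'" "\<not> adj p r'" "\<not> adj q r'"
  shows "coplanar p q r'"
proof -
  have c: "p \<in> R" "q \<in> R" "r \<in> R" "p \<otimes> q \<otimes> r \<in> R" "\<not> adj p q" "\<not> adj p r" "\<not> adj q r"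
    using assms by (auto simp: coplanar_def)
  have "(p \<otimes> q \<otimes> r) \<otimes> (r \<otimes> r') \<in> R"
    by (rule adj_closed) (use c assms in \<open>auto intro: adj_closed\<close>)
  also have "(p \<otimes> q \<otimes> r) \<otimes> (r \<otimes> r') = p \<otimes> q \<otimes> r'"
    using c assms by (simp add: m_assoc)
  finally show ?thesis using assms c by (simp add: coplanar_def)
qed

lemma coplanar_link:
  assumes "coplanar p q r" "w \<in> R" "r' \<in> R" "adj w r" "adj w r'"
    "\<not> adj w p" "\<not> adj w q" "\<not> adj p r'" "\<not> adj q r'"
  shows "coplanar p q r'"
proof -
  have c: "p \<in> R" "q \<in> R" "r \<in> R" using assms by (auto simp: coplanar_def)
  have "coplanar p q w"
    using assms c adj_sym[of w p] adj_sym[of w q] adj_sym[of w r]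
    by (intro coplanar_step[OF assms(1)]) auto
  thus ?thesis
    by (rule coplanar_step) (use assms in auto)
qed

context
  assumes not_collinear: "\<not> collinear a b"
begin

lemma orthogonal_sum: "a \<in> R \<Longrightarrow> b \<in> R \<Longrightarrow> \<not> adj a b \<Longrightarrow> a \<otimes> b \<notin> R"
  using not_collinear[of a b] by (auto simp: collinear_def)

text \<open>The analogue of \<open>collinear_local\<close> with two fixed roots. The quadruple x, y,
  z, s now splits into pairs in three ways, and each splitting may or may not be coplanar with z',
  so the roots are classified by their adjacency to x, y, z, z' until no consistent set of patterns
  remains.\<close>

lemma coplanar_local:
  assumes g: "coplanar x y z" and xyz: "x \<noteq> y" "x \<noteq> z" "y \<noteq> z"
    and z': "z' \<in> R" "\<not> adj x z'" "\<not> adj y z'" "z' \<noteq> x" "z' \<noteq> y"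
  shows "coplanar x y z'"
proof (rule ccontr)
  assume no: "\<not> coplanar x y z'"
  define s where "s = x \<otimes> y \<otimes> z"
  have c: "x \<in> R" "y \<in> R" "z \<in> R" "s \<in> R" "\<not> adj x y" "\<not> adj x z" "\<not> adj y z"
    using g by (auto simp: coplanar_def s_def)
  have c': "\<not> adj y x" "\<not> adj z x" "\<not> adj z y"
    using c adj_sym[of x y] adj_sym[of x z] adj_sym[of y z] by auto
  have c'': "\<not> adj x s" "\<not> adj y s" "\<not> adj z s" "\<not> adj s x" "\<not> adj s y" "\<not> adj s z"
    using c c' by (simp_all add: s_def)
  have ad: "adj w s \<longleftrightarrow> (adj w x \<noteq> adj w y) \<noteq> adj w z" if "w \<in> R" for w
    using that c unfolding s_def by simp
  have e: "z \<otimes> s = x \<otimes> y" "y \<otimes> s = x \<otimes> z" "x \<otimes> s = y \<otimes> z"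
    unfolding s_def using c by (simp_all add: m_ac)
  have prods: "x \<otimes> y \<otimes> s = z" "z \<otimes> s \<otimes> x = y" "y \<otimes> s \<otimes> x = z" "x \<otimes> z \<otimes> y = s" "x \<otimes> s \<otimes> y = z" "y \<otimes> z \<otimes> x = s"
    unfolding s_def using c by (simp_all add: m_ac)
  have cop: "coplanar x y s" "coplanar z s x" "coplanar y s x" "coplanar x z y" "coplanar x s y"
    "coplanar y z x"
    using c c' c'' by (simp_all add: coplanar_def prods)
  have oz: "\<not> adj z z'" "\<not> adj s z'"
    using no coplanar_step[OF g z'(1)] coplanar_step[OF cop(1) z'(1)] z' by blast+
  have oz': "\<not> adj z' x" "\<not> adj z' y" "\<not> adj z' z" "\<not> adj z' s"
    using oz z' c adj_sym[of z'] by auto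
  have nz: "z' \<noteq> z" "z' \<noteq> s"
    using no g cop by auto
  have ns: "s \<noteq> x" "s \<noteq> y" "s \<noteq> z"
    using e xyz c mult_eq_one_iff[of y z] mult_eq_one_iff[of x z] mult_eq_one_iff[of x y]
    by (metis sq root_carrier)+
  \<comment> \<open>Two members of the quadruple have the same sum as the other two, so coplanarity
    with z' depends only on the splitting into pairs.\<close>
  have M1: "\<not> coplanar z s z'"
    using no c c' c'' oz z' by (simp add: coplanar_def e)
  have M2: "coplanar y s z' \<longleftrightarrow> coplanar x z z'" and M3: "coplanar x s z' \<longleftrightarrow> coplanar y z z'"
    using c c' c'' oz z' by (simp_all add: coplanar_def e)
  have F1: "\<not> (adj w x = adj w y \<and> adj w x \<noteq> adj w z)" if "w \<in> R" "adj w z'" for w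
    using coplanar_link[OF cop(2) that(1) z'(1)] coplanar_link[OF g that(1) z'(1)] M1 no that ad[of w] oz z'
    by blast
  have F2: "coplanar x z z'" if "w \<in> R" "adj w z'" "adj w x = adj w z" "adj w x \<noteq> adj w y" for w
    using coplanar_link[OF cop(3) that(1) z'(1)] coplanar_link[OF cop(4) that(1) z'(1)] M2 that ad[of w] oz z'
    by blast
  have F3: "coplanar y z z'" if "w \<in> R" "adj w z'" "adj w y = adj w z" "adj w x \<noteq> adj w y" for w
    using coplanar_link[OF cop(5) that(1) z'(1)] coplanar_link[OF cop(6) that(1) z'(1)] M3 that ad[of w] oz z'
    by blast
  have F4: "adj w z'" if "w \<in> R" "coplanar x z z'" "adj w y = adj w z" "adj w x \<noteq> adj w y" for w
  proof (rule ccontr)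
    assume "\<not> adj w z'"
    moreover have "coplanar x z' z" "coplanar y z' s"
      using that(2) M2 coplanar_perm by blast+
    ultimately have "coplanar x z' y \<or> coplanar y z' x"
      using coplanar_link[of x z' z w y] coplanar_link[of y z' s w x] that ad[of w] c c' oz' by blast
    thus False using no coplanar_perm by blast
  qed
  have F5: "adj w z'" if "w \<in> R" "coplanar y z z'" "adj w x = adj w z" "adj w x \<noteq> adj w y" for w
  proof (rule ccontr)
    assume "\<not> adj w z'"
    moreover have "coplanar y z' z" "coplanar x z' s"
      using that(2) M3 coplanar_perm by blast+
    ultimately have "coplanar x z' y \<or> coplanar y z' x"
      using coplanar_link[of y z' z w x] coplanar_link[of x z' s w y] that ad[of w] c c' oz' by blast
    thus False using no coplanar_perm by blast
  qed
  text \<open>\<open>T\<close> lists the adjacency patterns of roots on \<open>x\<close>, \<open>y\<close>, \<open>z\<close>, \<open>z'\<close>. The patterns \<open>m1\<close>, \<open>m2\<close>, \<open>m3\<close>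
    split the quadruple \<open>x\<close>, \<open>y\<close>, \<open>z\<close>, \<open>s\<close> (with sum 0) into the pairs \<open>xy|zs\<close>, \<open>xz|ys\<close>, \<open>xs|yz\<close>. By
    assumption the first partition is not coplanar with \<open>z'\<close>, and roots of pattern \<open>mi\<close> either make
    the \<open>i\<close>-th partition coplanar with \<open>z'\<close> or link the two others.\<close>
  define T where "T a b d e \<longleftrightarrow> (\<exists>w\<in>R. adj w x = a \<and> adj w y = b \<and> adj w z = d \<and> adj w z' = e)"
    for a b d e
  have comb: "T (a \<noteq> a') (b \<noteq> b') (d \<noteq> d') (e \<noteq> e')"
    if "T a b d e" "T a' b' d' e'" "a \<and> a' \<or> b \<and> b' \<or> d \<and> d' \<or> e \<and> e' \<or>
      ((a \<noteq> b) \<noteq> d) \<and> ((a' \<noteq> b') \<noteq> d')" for a b d e a' b' d' e'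
  proof -
    obtain w w' where w: "w \<in> R" "adj w x = a" "adj w y = b" "adj w z = d" "adj w z' = e"
      "w' \<in> R" "adj w' x = a'" "adj w' y = b'" "adj w' z = d'" "adj w' z' = e'"
      using \<open>T a b d e\<close> \<open>T a' b' d' e'\<close> by (auto simp: T_def)
    have "\<exists>p\<in>{x, y, z, s, z'}. adj w p \<and> adj w' p"
      using that(3) w by (auto simp: ad)
    then obtain p where p: "p \<in> {x, y, z, s, z'}" "adj w p" "adj w' p" by blast
    obtain w'' where w'': "w'' \<in> R" "\<And>r. r \<in> carrier G \<Longrightarrow> \<not> adj p r \<Longrightarrow> adj w'' r \<longleftrightarrow> adj w r \<noteq> adj w' r"
      using combine[of w w' p] w p c z' by blast
    have "\<not> adj p x" "\<not> adj p y" "\<not> adj p z" "\<not> adj p z'"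
      using p c c' c'' oz oz' z' by auto
    hence "adj w'' x = (a \<noteq> a')" "adj w'' y = (b \<noteq> b')" "adj w'' z = (d \<noteq> d')" "adj w'' z' = (e \<noteq> e')"
      using w''(2) w c z' by auto
    thus ?thesis using w''(1) unfolding T_def by blast
  qed
  define m1 m2 m3 where "m1 e \<longleftrightarrow> T True True False e \<or> T False False True e"
    and "m2 e \<longleftrightarrow> T True False True e \<or> T False True False e"
    and "m3 e \<longleftrightarrow> T True False False e \<or> T False True True e" for e
  have n11: "\<not> m1 True"
    using F1 unfolding m1_def T_def by blast
  have i2: "coplanar x z z'" if "m2 True"
    using that F2 unfolding m2_def T_def by blast
  have i3: "coplanar y z z'" if "m3 True"
    using that F3 unfolding m3_def T_def by blast
  have n30: "\<not> m3 False" if "coplanar x z z'"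
    using that F4 unfolding m3_def T_def by blast
  have n20: "\<not> m2 False" if "coplanar y z z'"
    using that F5 unfolding m2_def T_def by blast
  \<comment> \<open>From here on patterns are shown to exist: by common neighbours with z', and by
    nonsingularity, which separates distinct elements.\<close>
  have cov: "\<exists>w\<in>R. adj w p \<and> adj w z'" if "p \<in> {x, y, z, s}" for p
    using common_neighbour[of p z'] that c z' oz nz by (metis insertE singletonD)
  have covx: "T True True False True \<or> T True False True True \<or> T True False False True \<or> T True True True True"
    using cov[of x] unfolding T_def by blast
  have covy: "T True True False True \<or> T False True True True \<or> T False True False True \<or> T True True True True"
    using cov[of y] unfolding T_def by blast
  have covz: "T False False True True \<or> T True False True True \<or> T False True True True \<or> T True True True True"
    using cov[of z] unfolding T_def by blast
  have covs: "T False False True True \<or> T True False False True \<or> T False True False True \<or> T True True True True"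
    using cov[of s] ad unfolding T_def by blast
  have sep: "\<exists>w\<in>R. adj w p" if "p \<in> carrier G" "p \<noteq> \<one>" for p
    using separating_root[OF that] by blast
  have TI: "T (adj w x) (adj w y) (adj w z) (adj w z')" if "w \<in> R" for w
    using that unfolding T_def by blast
  have sepx: "(\<exists>e. m1 e) \<or> (\<exists>e. m3 e)"
  proof -
    obtain w where "w \<in> R" "adj w x \<noteq> adj w z"
      using sep[of "x \<otimes> z"] c xyz mult_eq_one_iff[of x z] by auto
    thus ?thesis unfolding m1_def m3_def using TI[of w]
      by (cases "adj w x"; cases "adj w y"; cases "adj w z"; cases "adj w z'") auto
  qed
  have sepy: "(\<exists>e. m1 e) \<or> (\<exists>e. m2 e)"
  proof -
    obtain w where "w \<in> R" "adj w y \<noteq> adj w z"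
      using sep[of "y \<otimes> z"] c xyz mult_eq_one_iff[of y z] by auto
    thus ?thesis unfolding m1_def m2_def using TI[of w]
      by (cases "adj w x"; cases "adj w y"; cases "adj w z"; cases "adj w z'") auto
  qed
  \<comment> \<open>A root separating z' from x + y. These differ because x + y, a sum of orthogonal
    roots, is no root.\<close>
  have sepz: "m2 False \<or> m3 False \<or> m1 True \<or> T False False False True \<or> T True True True True"
  proof -
    have "x \<otimes> y \<noteq> z'"
      using orthogonal_sum[of x y] c z' by auto
    then obtain w where w: "w \<in> R" "(adj w x \<noteq> adj w y) \<noteq> adj w z'"
      using sep[of "x \<otimes> y \<otimes> z'"] c z' mult_eq_one_iff[of "x \<otimes> y" z'] by auto
    thus ?thesis unfolding m1_def m2_def m3_def using TI[of w]
      by (cases "adj w x"; cases "adj w y"; cases "adj w z"; cases "adj w z'") auto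
  qed
  show False
  proof (cases "T True True True True")
    case True
    \<comment> \<open>Adding the pattern of a root adjacent to all four complements a pattern, which
      preserves the classes \<open>m1\<close>, \<open>m2\<close>, \<open>m3\<close> and flips the
      entry at z'.\<close>
    have F: "T (\<not> a) (\<not> b) (\<not> d) (\<not> e)" if "T a b d e" "a \<or> b \<or> d" for a b d e
      using comb[OF that(1) True] that(2) by auto
    have "m1 (\<not> e)" if "m1 e" for e
      using that F[of True True False e] F[of False False True e] unfolding m1_def by auto
    hence no1: "\<not> m1 e" for e
      using n11 by (metis (full_types))
    have 2: "m2 (\<not> e)" if "m2 e" for e
      using that F[of True False True e] F[of False True False e] unfolding m2_def by auto
    have 3: "m3 (\<not> e)" if "m3 e" for e
      using that F[of True False False e] F[of False True True e] unfolding m3_def by auto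
    have "m2 True" "m3 False"
      using sepx sepy no1 2 3 by (metis (full_types))+
    thus False using i2 n30 by blast
  next
    case False
    have c23: "m2 True \<or> m3 True"
      using covz False n11 unfolding m1_def m2_def m3_def by blast
    have m3T: "m3 True"
    proof (rule ccontr)
      assume n: "\<not> m3 True"
      have t: "T True False True True"
        using covz False n n11 unfolding m1_def m3_def by blast
      have "\<not> m1 False"
        using comb[OF _ t, of True True False False] comb[OF _ t, of False False True False] n
        unfolding m1_def m3_def by auto
      moreover have "\<not> m3 False"
        using i2 n30 c23 n by blast
      ultimately show False
        using sepx n n11 by (metis (full_types))
    qed
    have m2T: "m2 True"
    proof (rule ccontr)
      assume n: "\<not> m2 True"
      have t: "T False True True True"
        using covz False n n11 unfolding m1_def m2_def by blast
      have "\<not> m1 False"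
        using comb[OF _ t, of True True False False] comb[OF _ t, of False False True False] n
        unfolding m1_def m2_def by auto
      moreover have "\<not> m2 False"
        using i3 n20 c23 n by blast
      ultimately show False
        using sepy n n11 by (metis (full_types))
    qed
    \<comment> \<open>\<open>m2 True\<close> and \<open>m3 True\<close> exclude the other
      alternatives of \<open>sepz\<close>. The pattern that meets only z' then turns
      \<open>m2 True\<close> into \<open>m2 False\<close>.\<close>
    have "T False False False True"
      using sepz False n11 n20 n30 i2 i3 m2T m3T by blast
    hence "m2 False"
      using m2T comb[of False False False True True False True True]
        comb[of False False False True False True False True]
      unfolding m2_def by auto
    thus False using n20 i3 m3T by blast
  qed
qed

text \<open>The claw yields one coplanar triple of distinct roots. Transvections carry membership in
  such a triple along adjacency, so every root lies in one. Then \<open>pair\<close> extends any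
  orthogonal pair to a triple, and \<open>coplanar_local\<close> exchanges the third root.\<close>

lemma coplanar_if_claw:
  assumes claw: "x \<in> R" "w1 \<in> R" "w2 \<in> R" "w3 \<in> R" "adj x w1" "adj x w2" "adj x w3"
      "\<not> adj w1 w2" "\<not> adj w1 w3" "\<not> adj w2 w3" "w1 \<noteq> w2" "w1 \<noteq> w3" "w2 \<noteq> w3"
    and pqr: "p \<in> R" "q \<in> R" "r \<in> R" "\<not> adj p q" "\<not> adj p r" "\<not> adj q r" "p \<noteq> q" "p \<noteq> r" "q \<noteq> r"
  shows "coplanar p q r"
proof -
  define cop where "cop a b c \<longleftrightarrow> coplanar a b c \<and> a \<noteq> b \<and> a \<noteq> c \<and> b \<noteq> c" for a b c
  have cop_perm: "cop b a c" "cop a c b" if "cop a b c" for a b c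
    using that coplanar_perm[of a b c] by (auto simp: cop_def)
  have cop_R: "a \<in> R \<and> b \<in> R \<and> c \<in> R \<and> \<not> adj a b \<and> \<not> adj a c \<and> \<not> adj b c" if "cop a b c" for a b c
    using that by (auto simp: cop_def coplanar_def)
  have loc: "cop a b d" if "cop a b c" "d \<in> R" "\<not> adj a d" "\<not> adj b d" "d \<noteq> a" "d \<noteq> b" for a b c d
    using coplanar_local[of a b c d] that by (auto simp: cop_def)
  define P where "P = {a. \<exists>b c. cop a b c}"
  have pair: "\<exists>c. cop a b c" if a: "a \<in> P" and b: "b \<in> R" "\<not> adj a b" "b \<noteq> a" for a b
  proof -
    obtain d c where dc: "cop a d c" using a by (auto simp: P_def)
    show ?thesis
    proof (cases "b = d")
      case bd: False
      show ?thesis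
      proof (cases "adj d b")
        case False
        thus ?thesis using loc[OF dc b(1,2)] b bd cop_perm by blast
      next
        case True
        show ?thesis
        proof (cases "adj c b")
          case False
          show ?thesis
          proof (cases "c = b")
            case nc: False
            have "cop a c b" using loc[of a c d b] cop_perm[OF dc] b False nc by blast
            thus ?thesis using cop_perm by blast
          qed (use dc cop_perm in blast)
        next
          case cb: True
          have R: "a \<in> R" "d \<in> R" "c \<in> R" "\<not> adj a d" "\<not> adj a c" "\<not> adj d c"
            using cop_R[OF dc] by auto
          \<comment> \<open>When b is adjacent to both d and c, this choice gives b + e = d + c and
            so keeps the sum of the triple.\<close>
          define e where "e = d \<otimes> b \<otimes> c"
          have db: "d \<otimes> b \<in> R" using True R b by (intro adj_closed)
          have e: "e \<in> R" unfolding e_def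
            by (rule adj_closed) (use db R b cb adj_sym[of c b] in auto)
          have "\<not> adj b e" "\<not> adj a e"
            using R b True cb adj_sym[of b d] adj_sym[of b c] by (auto simp: e_def)
          moreover have "b \<otimes> e = d \<otimes> c" 
            using R b by (simp add: e_def m_ac)
          hence "a \<otimes> b \<otimes> e = a \<otimes> d \<otimes> c" using R b e by (simp add: m_assoc)
          moreover have "a \<otimes> d \<otimes> c \<in> R" using dc by (simp add: cop_def coplanar_def)
          moreover have "e \<noteq> b"
            using \<open>b \<otimes> e = d \<otimes> c\<close> dc mult_eq_one_iff[of d c] R b by (auto simp: cop_def)
          moreover have "e \<noteq> a"
          proof
            assume "e = a"
            hence "a \<otimes> b = d \<otimes> c" using \<open>b \<otimes> e = d \<otimes> c\<close> R b by (simp add: m_comm)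
            hence "adj (a \<otimes> b) d \<longleftrightarrow> adj (d \<otimes> c) d" by simp
            thus False using R b True adj_sym[of b d] adj_sym[of c d] by simp
          qed
          ultimately have "cop a b e"
            using R b e by (auto simp: cop_def coplanar_def)
          thus ?thesis by blast
        qed
      qed
    qed (use dc in blast)
  qed
  have "P = R"
  proof (rule connected)
    have c: "x \<in> carrier G" "w1 \<in> carrier G" "w2 \<in> carrier G" "w3 \<in> carrier G" using claw by auto
    \<comment> \<open>x is a bridge: it is added after w1 and removed at the end. The removal works
      because x is adjacent to three of the summands, an odd number.\<close>
    have "w1 \<otimes> x \<in> R" 
      by (rule adj_closed) (use claw c adj_sym[of x w1] in auto)
    hence "w1 \<otimes> x \<otimes> w2 \<in> R"
      by (rule adj_closed) (use claw c in auto)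
    hence "w1 \<otimes> x \<otimes> w2 \<otimes> w3 \<in> R"
      by (rule adj_closed) (use claw c in auto)
    hence "w1 \<otimes> x \<otimes> w2 \<otimes> w3 \<otimes> x \<in> R"
      by (rule adj_closed) (use claw c adj_sym[of x w1] adj_sym[of x w2] adj_sym[of x w3] in auto)
    also have "w1 \<otimes> x \<otimes> w2 \<otimes> w3 \<otimes> x = w1 \<otimes> w2 \<otimes> w3"
      using c by (simp add: m_ac)
    finally have "cop w1 w2 w3"
      using claw by (auto simp: cop_def coplanar_def)
    thus "P \<noteq> {}" by (auto simp: P_def)
  next
    show "P \<subseteq> R" using cop_R by (auto simp: P_def)
  next
    fix a b assume a: "a \<in> P" and b: "b \<in> R" "\<beta> a b \<noteq> 1"
    have ab: "adj a b" using b by (simp add: adj_def)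
    obtain c d where cd: "cop a c d" using a by (auto simp: P_def)
    have R: "a \<in> R" "c \<in> R" "d \<in> R" "\<not> adj a c" "\<not> adj a d" "\<not> adj c d"
      using cop_R[OF cd] by auto
    define u where "u = a \<otimes> b"
    have u: "u \<in> R" using ab R b unfolding u_def by (intro adj_closed)
    \<comment> \<open>The transvection along u: an additive isometry that preserves R and takes a to
      b.\<close>
    define t where "t y = (if adj y u then y \<otimes> u else y)" for y
    have tR: "t y \<in> R" if "y \<in> R" for y using that u by (auto simp: t_def intro: adj_closed)
    have tadj: "adj (t y) (t z) \<longleftrightarrow> adj y z" if "y \<in> R" "z \<in> R" for y z
      using that u adj_sym[of u z] by (auto simp: t_def)
    have tadju: "adj (t y) u \<longleftrightarrow> adj y u" if "y \<in> R" for y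
      using that u by (auto simp: t_def)
    have tt: "t (t y) = y" if "y \<in> R" for y
      using that u tadju[OF that] by (auto simp: t_def m_assoc)
    have "t a = b"
      using R b ab u by (auto simp: t_def u_def)
    have "t (a \<otimes> c \<otimes> d) = t a \<otimes> t c \<otimes> t d"
      using R u by (auto simp: t_def m_ac)
    moreover have "a \<otimes> c \<otimes> d \<in> R" using cd by (simp add: cop_def coplanar_def)
    ultimately have "cop (t a) (t c) (t d)"
      using cd R tR tadj tt by (auto simp: cop_def coplanar_def) (metis tR)+
    thus "b \<in> P" using \<open>t a = b\<close> by (auto simp: P_def)
  qed
  then obtain c where "cop p q c"
    using pair[of p q] pqr by auto
  hence "cop p q r"
    using loc pqr by blast
  thus ?thesis by (simp add: cop_def)
qed

text \<open>The indicator of R is thus a quadratic form over the field with two elements, with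
  polarization \<open>\<beta>\<close>. The rule is proved first for a root v, where
  \<open>coplanar_if_claw\<close> settles the case of an orthogonal nonroot, and then passes to sums
  of roots by additivity of \<open>adj\<close>.\<close>

lemma quadratic_if_claw:
  assumes claw: "x \<in> R" "w1 \<in> R" "w2 \<in> R" "w3 \<in> R" "adj x w1" "adj x w2" "adj x w3"
      "\<not> adj w1 w2" "\<not> adj w1 w3" "\<not> adj w2 w3" "w1 \<noteq> w2" "w1 \<noteq> w3" "w2 \<noteq> w3"
    and vw: "v \<in> carrier G" "w \<in> carrier G"
  shows "v \<otimes> w \<in> R \<longleftrightarrow> ((v \<in> R) \<noteq> (w \<in> R)) \<noteq> adj v w"
proof -
  text \<open>Since all orthogonal triples are coplanar, every element is a sum of at most two roots.\<close>
  define len2 where "len2 z \<longleftrightarrow> z = \<one> \<or> z \<in> R \<or> (\<exists>a\<in>R. \<exists>b\<in>R. \<not> adj a b \<and> a \<noteq> b \<and> z = a \<otimes> b)" for z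
  have add_R: "r \<otimes> z \<in> R" if r: "r \<in> R" and z: "z \<in> carrier G" "z \<notin> R" "\<not> adj r z" "len2 z" for r z
  proof -
    consider "z = \<one>" | a b where "a \<in> R" "b \<in> R" "\<not> adj a b" "a \<noteq> b" "z = a \<otimes> b"
      using z by (auto simp: len2_def)
    thus ?thesis
    proof cases
      case 2
      show ?thesis
      proof (cases "adj r a")
        case False
        hence rb: "\<not> adj r b" using z 2 r by auto
        show ?thesis
        proof (cases "r = a \<or> r = b")
          case True
          thus ?thesis using 2 m_lcomm[of b a b] by auto
        next
          case nab: False
          have "coplanar r a b"
            by (rule coplanar_if_claw[OF claw]) (use 2 False rb r nab in auto)
          thus ?thesis using 2 r by (simp add: coplanar_def m_assoc)
        qed
      next
        case True
        hence "adj r b" using z 2 r by auto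
        have "r \<otimes> a \<in> R" using r 2 True by (intro adj_closed)
        hence "r \<otimes> a \<otimes> b \<in> R"
          by (rule adj_closed) (use 2 r \<open>adj r b\<close> in auto)
        thus ?thesis using 2 r by (simp add: m_assoc)
      qed
    qed (use r in auto)
  qed
  have step: "r \<otimes> z \<in> R \<longleftrightarrow> (z \<notin> R) \<noteq> adj r z" if r: "r \<in> R" and z: "z \<in> carrier G" "len2 z" for r z
  proof (cases "adj r z")
    case True
    have "r \<otimes> z \<notin> R" if "z \<notin> R"
    proof
      assume "r \<otimes> z \<in> R"
      hence "r \<otimes> (r \<otimes> z) \<in> R"
        by (rule adj_closed[OF r]) (use r z True in auto)
      thus False using that r z by simp
    qed
    thus ?thesis using True adj_closed r by auto
  next
    case False
    thus ?thesis using add_R[OF r z(1) _ _ z(2)] orthogonal_sum[OF r] by auto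
  qed
  \<comment> \<open>If h is adjacent to y = a + b, it is adjacent to one summand and absorbs it. If
    h is orthogonal to the nonroot y, then \<open>add_R\<close> makes the sum a root.\<close>
  have incl_case: "len2 (h \<otimes> y)" if incl: "h \<in> R" and y: "y \<in> carrier G" "len2 y" for h y
      proof (cases "y \<in> R")
        case True
        thus ?thesis using incl adj_closed[OF incl True] by (cases "h = y") (auto simp: len2_def)
      next
        case False
        show ?thesis
        proof (cases "adj h y")
          case nadj: False
          show ?thesis using add_R[OF incl y(1) False nadj y(2)] by (simp add: len2_def)
        next
          case True
          then obtain a b where ab: "a \<in> R" "b \<in> R" "y = a \<otimes> b" "\<not> adj a b"
            using y False incl by (auto simp: len2_def)
          have sw: "len2 (h \<otimes> y)" if "a \<in> R" "b \<in> R" "y = a \<otimes> b" "adj h a" for a b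
          proof -
            have "h \<otimes> a \<in> R" using incl that by (intro adj_closed)
            moreover have "h \<otimes> y = (h \<otimes> a) \<otimes> b" using that incl by (simp add: m_assoc)
            ultimately show ?thesis
              using that adj_closed[of "h \<otimes> a" b] by (cases "h \<otimes> a = b") (auto simp: len2_def)
          qed
          have "adj h a \<or> adj h b" using True ab incl by auto
          thus ?thesis using sw[of a b] sw[of b a] ab m_comm[of a b] by auto
        qed
      qed
  have len2: "len2 z" if "z \<in> carrier G" for z
  proof -
    have "z \<in> generate G R" using that FRS0_generates by simp
    hence "z \<in> carrier G \<and> (\<forall>y. y \<in> carrier G \<and> len2 y \<longrightarrow> len2 (z \<otimes> y))"
    proof (induction rule: generate.induct)
      case (incl h)
      thus ?case using incl_case by auto
    next
      case (eng h1 h2)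
      thus ?case by (auto simp: m_assoc)
    next
      case (inv h)
      thus ?case using incl_case by simp
    qed auto
    moreover have "len2 \<one>" by (simp add: len2_def)
    ultimately have "len2 (z \<otimes> \<one>)" by blast
    thus ?thesis using that by simp
  qed
  have "v \<in> generate G R" using vw FRS0_generates by simp
  hence "v \<in> carrier G \<and> (\<forall>w\<in>carrier G. v \<otimes> w \<in> R \<longleftrightarrow> ((v \<in> R) \<noteq> (w \<in> R)) \<noteq> adj v w)"
  proof (induction rule: generate.induct)
    case (eng h1 h2)
    have c: "h1 \<in> carrier G" "h2 \<in> carrier G" using eng by auto
    have "h1 \<otimes> h2 \<otimes> w \<in> R \<longleftrightarrow> ((h1 \<otimes> h2 \<in> R) \<noteq> (w \<in> R)) \<noteq> adj (h1 \<otimes> h2) w" if w: "w \<in> carrier G" for w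
    proof -
      have "h1 \<otimes> h2 \<otimes> w \<in> R \<longleftrightarrow> ((h1 \<in> R) \<noteq> (h2 \<otimes> w \<in> R)) \<noteq> adj h1 (h2 \<otimes> w)"
        using eng c w by (simp add: m_assoc)
      moreover have "h2 \<otimes> w \<in> R \<longleftrightarrow> ((h2 \<in> R) \<noteq> (w \<in> R)) \<noteq> adj h2 w"
        using eng w by blast
      moreover have "h1 \<otimes> h2 \<in> R \<longleftrightarrow> ((h1 \<in> R) \<noteq> (h2 \<in> R)) \<noteq> adj h1 h2"
        using eng c by blast
      ultimately show ?thesis using c w by auto
    qed
    thus ?case using c by auto
  qed (use step len2 in auto)
  thus ?thesis using vw by blast
qed

end

subsection \<open>Claws and cliques\<close>

lemma roots_nonempty: "R \<noteq> {}"
proof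
  assume "R = {}"
  hence "carrier G = {\<one>}" using FRS0_generates generate_empty by simp
  thus False using nontrivial by (auto simp: Rad_def)
qed

text \<open>The neighbours of \<open>x\<close> come in pairs \<open>{w, w + x}\<close>. Without claws, the members of the pairs that are
  adjacent to a fixed neighbour \<open>w0\<close> form a clique \<open>C\<close>.\<close>

lemma clique_if_no_claw:
  assumes no_claw: "\<And>x w1 w2 w3. \<lbrakk>x \<in> R; w1 \<in> R; w2 \<in> R; w3 \<in> R; adj x w1; adj x w2; adj x w3;
      \<not> adj w1 w2; \<not> adj w1 w3; \<not> adj w2 w3; w1 \<noteq> w2; w1 \<noteq> w3; w2 \<noteq> w3\<rbrakk> \<Longrightarrow> False"
  obtains K where "K \<subseteq> R" "\<And>a b. a \<in> K \<Longrightarrow> b \<in> K \<Longrightarrow> a \<noteq> b \<Longrightarrow> adj a b"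
    "R = K \<union> {a \<otimes> b | a b. a \<in> K \<and> b \<in> K \<and> a \<noteq> b}" "2 \<le> card K"
proof -
  obtain x where x: "x \<in> R" using roots_nonempty by blast
  hence "x \<noteq> \<one>" by auto
  then obtain w0 where w0: "w0 \<in> R" "adj w0 x"
    using separating_root[of x] x by auto
  define C where "C = {w \<in> R. adj w x \<and> (w = w0 \<or> (adj w w0 \<and> w \<noteq> w0 \<otimes> x))}"
  have C: "w \<in> C \<or> w \<otimes> x \<in> C" if w: "w \<in> R" "adj w x" for w
  proof -
    consider "w = w0" | "w = w0 \<otimes> x" | "w \<noteq> w0" "w \<noteq> w0 \<otimes> x" by blast
    thus ?thesis
    proof cases
      case 2
      thus ?thesis using w0 x by (auto simp: C_def m_assoc)
    next
      case 3
      have "w \<otimes> x \<in> R" using w x by (intro adj_closed)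
      moreover have "w \<otimes> x \<noteq> w0 \<otimes> x" using 3 w0 w x by simp
      ultimately show ?thesis
        using w w0 x 3 adj_sym[of x w0] by (cases "adj w w0") (auto simp: C_def)
    qed (use w0 in \<open>auto simp: C_def\<close>)
  qed
  have clC: "adj a b" if ab: "a \<in> C" "b \<in> C" "a \<noteq> b" for a b
  proof (cases "a = w0 \<or> b = w0")
    case True
    thus ?thesis using ab w0 adj_sym[of a b] by (auto simp: C_def)
  next
    case False
    have R: "a \<in> R" "b \<in> R" "adj a x" "adj b x" "adj a w0" "adj b w0" "a \<noteq> w0 \<otimes> x" "b \<noteq> w0 \<otimes> x"
      using ab False by (auto simp: C_def)
    have wx: "w0 \<otimes> x \<in> R" using w0 x by (intro adj_closed)
    show ?thesis
    proof (rule ccontr)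
      \<comment> \<open>Both a and b are adjacent to x and to w0, hence orthogonal to w0 + x, and
        the three would form a claw at x.\<close>
      assume n: "\<not> adj a b"
      show False
        by (rule no_claw[of x a b "w0 \<otimes> x"])
          (use n R wx w0 x ab(3) adj_sym[of a x] adj_sym[of b x] adj_sym[of w0 x] in auto)
    qed
  qed
  define K where "K = insert x C"
  have clK: "adj a b" if "a \<in> K" "b \<in> K" "a \<noteq> b" for a b
  proof -
    have "adj x c \<and> adj c x" if "c \<in> C" for c
      using that adj_sym[of c x] x by (auto simp: C_def)
    thus ?thesis using that clC by (auto simp: K_def)
  qed
  have KR: "K \<subseteq> R" using x by (auto simp: K_def C_def)
  define T where "T = K \<union> {a \<otimes> b | a b. a \<in> K \<and> b \<in> K \<and> a \<noteq> b}"
  have TI: "a \<otimes> b \<in> T" if "a \<in> K" "b \<in> K" "a \<noteq> b" for a b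
    using that by (auto simp: T_def)
  have nbr: "y \<in> T" if y: "y \<in> R" "adj y x" for y
  proof (cases "y \<in> C")
    case False
    hence "y \<otimes> x \<in> C" using C[OF y] by blast
    moreover have "y \<otimes> x \<noteq> x" using y x by auto
    ultimately have "(y \<otimes> x) \<otimes> x \<in> T"
      by (intro TI) (auto simp: K_def)
    thus ?thesis using y x by (simp add: m_assoc)
  qed (auto simp: T_def K_def)
  have "R = T"
  proof
    show "T \<subseteq> R" using KR clK by (auto simp: T_def intro!: adj_closed)
    show "R \<subseteq> T"
    proof
      fix y assume y: "y \<in> R"
      consider "y = x" | "adj y x" | "y \<noteq> x" "\<not> adj x y" using adj_sym[of x y] x y by auto
      thus "y \<in> T"
      proof cases
        case 3
        obtain u where u: "u \<in> R" "adj u x" "adj u y"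
          using common_neighbour[of x y] x y 3 by auto
        obtain w where w: "w \<in> C" "adj w y"
        proof (cases "u \<in> C")
          case False
          hence "u \<otimes> x \<in> C" using C u by blast
          thus thesis using that[of "u \<otimes> x"] u x y 3 by auto
        qed (use u that in auto)
        have wR: "w \<in> R" "adj w x" using w by (auto simp: C_def)
        have "w \<otimes> y \<in> R" using w wR y by (intro adj_closed)
        hence wy: "w \<otimes> y \<in> C \<or> w \<otimes> y \<otimes> x \<in> C"
          by (rule C) (use wR x y 3 adj_sym[of x y] in auto)
        have ne: "w \<otimes> y \<noteq> w" using wR y by auto
        \<comment> \<open>The other member of the pair, w + y + x, is orthogonal to w because y and
          x are both adjacent to w; so it cannot lie in the clique. Hence y is the sum of the clique
          members w and w + y.\<close>
        have "w \<otimes> y \<in> C"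
        proof (rule ccontr)
          assume "w \<otimes> y \<notin> C"
          hence m: "w \<otimes> y \<otimes> x \<in> C" using wy by blast
          have "w \<otimes> y \<otimes> x \<noteq> w"
          proof
            assume "w \<otimes> y \<otimes> x = w"
            hence "y \<otimes> x = \<one>" using wR y x by (simp add: m_assoc)
            thus False using 3 y x mult_eq_one_iff[of y x] by simp
          qed
          hence "adj (w \<otimes> y \<otimes> x) w" using clC[OF m w(1)] by simp
          thus False using wR w y x adj_sym[of x w] adj_sym[of y w] by auto
        qed
        hence "w \<otimes> (w \<otimes> y) \<in> T" using w ne by (intro TI) (auto simp: K_def)
        thus ?thesis using wR y by simp
      qed (use nbr y in \<open>auto simp: T_def K_def\<close>)
    qed
  qed
  moreover have "2 \<le> card K"
  proof -
    have "finite K" using KR finite_carrier FRS0_subset finite_subset by (metis Diff_subset order.trans)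
    moreover have "{x, w0} \<subseteq> K" using w0 by (auto simp: K_def C_def)
    ultimately have "card {x, w0} \<le> card K" by (rule card_mono)
    moreover have "x \<noteq> w0" using w0 x by auto
    ultimately show ?thesis by simp
  qed
  ultimately show thesis using that[OF KR clK] unfolding T_def by blast
qed

lemma eq_one_if_orthogonal_clique:
  assumes "K \<subseteq> R" "R = K \<union> {a \<otimes> b | a b. a \<in> K \<and> b \<in> K \<and> a \<noteq> b}"
    and "y \<in> carrier G" "\<And>a. a \<in> K \<Longrightarrow> \<not> adj y a"
  shows "y = \<one>"
proof (rule eq_one_if_orthogonal_roots[OF assms(3)])
  fix r assume "r \<in> R"
  moreover have "a \<in> carrier G" if "a \<in> K" for a using that assms(1) by auto
  ultimately have "\<not> adj y r"
    by (subst (asm) assms(2)) (use assms(3,4) in auto)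
  thus "\<beta> y r = 1" by (simp add: adj_def)
qed

lemma all_roots_if_three:
  assumes "a \<in> R" "b \<in> R" "R = {a, b, a \<otimes> b}" shows "R = carrier G - {\<one>}"
proof (rule all_roots_if_closed)
  define c where "c = a \<otimes> b"
  have *: "a \<in> carrier G" "b \<in> carrier G" using assms(1,2) by auto
  hence prods: "a \<otimes> b = c" "b \<otimes> a = c" "a \<otimes> c = b" "c \<otimes> a = b" "b \<otimes> c = a" "c \<otimes> b = a"
    unfolding c_def by (simp_all add: m_ac)
  have R: "r \<in> R \<longleftrightarrow> r = a \<or> r = b \<or> r = c" for r
    using assms(3) unfolding c_def by blast
  fix x y assume "x \<in> R" "y \<in> R" "x \<noteq> y"
  thus "x \<otimes> y \<in> R"
    unfolding R by (elim disjE) (simp_all add: prods)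
qed

text \<open>These sizes belong to 3, 4 and 6 points, where the transpositions give all nonzero
  vectors modulo the radical. In a clique of odd size each member is adjacent to an even number of
  others, so the sum of the clique is orthogonal to everything and vanishes: for size 3 this says a
  + b = c, for size 5 it exhibits a collinear pair.\<close>

lemma clique_card:
  assumes not_collinear: "\<And>a b. \<not> collinear a b" and not_all: "R \<noteq> carrier G - {\<one>}"
    and K: "K \<subseteq> R" "\<And>a b. a \<in> K \<Longrightarrow> b \<in> K \<Longrightarrow> a \<noteq> b \<Longrightarrow> adj a b"
      "R = K \<union> {a \<otimes> b | a b. a \<in> K \<and> b \<in> K \<and> a \<noteq> b}" "2 \<le> card K"
  shows "card K \<noteq> 2 \<and> card K \<noteq> 3 \<and> card K \<noteq> 5"
proof (intro conjI notI)
  assume "card K = 2"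
  then obtain a b where ab: "K = {a, b}" "a \<noteq> b" by (auto simp: card_2_iff)
  hence R: "a \<in> R" "b \<in> R" using K by auto
  have "b \<otimes> a = a \<otimes> b" using R by (simp add: m_comm)
  hence "R = {a, b, a \<otimes> b}"
    by (subst K(3)) (use ab in auto)
  hence "R = carrier G - {\<one>}"
    by (rule all_roots_if_three[OF R])
  thus False using not_all by blast
next
  assume "card K = 3"
  then obtain a b c where abc: "K = {a, b, c}" "a \<noteq> b" "a \<noteq> c" "b \<noteq> c" by (auto simp: card_3_iff)
  hence R: "a \<in> R" "b \<in> R" "c \<in> R" using K by auto
  have ad: "adj a b" "adj b a" "adj a c" "adj c a" "adj b c" "adj c b"
    using K(2) abc by auto
  have "a \<otimes> b \<otimes> c = \<one>"
    by (rule eq_one_if_orthogonal_clique[OF K(1,3)]) (use abc R ad in auto)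
  hence c: "a \<otimes> b = c" using mult_eq_one_iff[of "a \<otimes> b" c] R by simp
  have "b \<otimes> a = c" "a \<otimes> c = b" "c \<otimes> a = b" "b \<otimes> c = a" "c \<otimes> b = a"
    unfolding c[symmetric] using R by (simp_all add: m_ac)
  hence "R = {a, b, a \<otimes> b}"
    by (subst K(3)) (use abc c in auto)
  hence "R = carrier G - {\<one>}"
    by (rule all_roots_if_three[OF R(1,2)])
  thus False using not_all by blast
next
  assume "card K = 5"
  then obtain k where k: "bij_betw k {..<5::nat} K" 
    using bij_betw_from_nat_into_finite[of K] card_ge_0_finite[of K] by (auto simp: lessThan_atLeast0)
  have kK: "k i \<in> K" if "i < 5" for i using k that by (auto simp: bij_betw_def)
  have kc: "k i \<in> R" if "i < 5" for i using kK that K by auto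
  have ne: "k i \<noteq> k j" if "i < 5" "j < 5" "i \<noteq> j" for i j
    using k that by (auto simp: bij_betw_def inj_on_def)
  have ad: "adj (k i) (k j) \<longleftrightarrow> i \<noteq> j" if "i < 5" "j < 5" for i j
    using K(2) kK kc ne that by (cases "i = j") auto
  have "K = {k 0, k 1, k 2, k 3, k 4}"
    using k by (auto simp: bij_betw_def lessThan_Suc numeral_eq_Suc)
  hence "k 0 \<otimes> k 1 \<otimes> k 2 \<otimes> k 3 \<otimes> k 4 = \<one>"
    by (intro eq_one_if_orthogonal_clique[OF K(1,3)]) (auto simp: kc ad)
  hence "k 0 \<otimes> k 1 \<otimes> (k 2 \<otimes> k 3) \<otimes> k 4 = \<one>"
    by (simp add: kc m_assoc)
  hence "(k 0 \<otimes> k 1) \<otimes> (k 2 \<otimes> k 3) = k 4"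
    by (subst (asm) mult_eq_one_iff) (simp_all add: kc)
  moreover have "k 0 \<otimes> k 1 \<in> R" "k 2 \<otimes> k 3 \<in> R"
    by (auto intro!: adj_closed simp: kc ad)
  ultimately have "collinear (k 0 \<otimes> k 1) (k 2 \<otimes> k 3)"
    by (simp add: collinear_def kc ad)
  thus False using not_collinear by blast
qed

text \<open>The five elements of \<open>U\<close> are orthogonal to w1 and p, whereas the four
  combinations of g1 and g2 are told apart by their pairings with w1 and p. This makes 5 * 4 = 20
  elements, enough because the order will be a power of 4.\<close>

lemma card_gt_16_if_claw:
  assumes not_collinear: "\<And>a b. \<not> collinear a b"
    and w: "w1 \<in> R" "w2 \<in> R" "w3 \<in> R" "\<not> adj w1 w2" "\<not> adj w1 w3" "\<not> adj w2 w3"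
      "w1 \<noteq> w2" "w1 \<noteq> w3" "w2 \<noteq> w3"
  shows "16 < card (carrier G)"
proof -
  have c: "w1 \<in> carrier G" "w2 \<in> carrier G" "w3 \<in> carrier G" using w by auto
  have w12: "w1 \<otimes> w2 \<notin> R" using not_collinear[of w1 w2] w by (simp add: collinear_def)
  have w12': "w1 \<otimes> w2 \<noteq> \<one>" using c w mult_eq_one_iff by simp
  have s: "\<not> adj w2 w1" "\<not> adj w3 w1" "\<not> adj w3 w2" using w c adj_sym by blast+
  have "w1 \<noteq> \<one>" using w by auto
  then obtain g1 where g1: "g1 \<in> R" "adj g1 w1" using separating_root c by blast
  \<comment> \<open>A nonzero element of the span of w1 and w2 that is orthogonal to g1, so pairing
    with it detects g2 alone.\<close>
  define p where "p = (if adj g1 w2 then w1 \<otimes> w2 else w2)"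
  have p: "p \<in> carrier G" "p \<noteq> \<one>" "\<not> adj g1 p" "\<not> adj w1 p" "\<not> adj w2 p" "\<not> adj w3 p"
    using c g1 w w12' s by (auto simp: p_def)
  obtain g2 where g2: "g2 \<in> R" "adj g2 p" using separating_root p by blast
  have gc: "g1 \<in> carrier G" "g2 \<in> carrier G" using g1 g2 by auto
  define U where "U = {\<one>, w1, w2, w3, w1 \<otimes> w2}"
  have U: "u \<in> carrier G" "\<not> adj u w1" "\<not> adj u p" if "u \<in> U" for u
    using that c w s p by (auto simp: U_def)
  have cU: "card U = 5"
    using w w12 w12' by (auto simp: U_def card_insert_if)
  define F where "F = (\<lambda>(u, i, j). u \<otimes> (if i then g1 else \<one>) \<otimes> (if j then g2 else \<one>))"
  have adjF: "adj (F (u, i, j)) p \<longleftrightarrow> j" "adj (F (u, i, j)) w1 \<longleftrightarrow> i \<noteq> (j \<and> adj g2 w1)" if "u \<in> U" for u i j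
    using U[OF that] gc g1 g2 p c by (auto simp: F_def)
  have "inj_on F (U \<times> UNIV)"
  proof (rule inj_onI, clarsimp)
    fix u i j u' i' j' assume u: "u \<in> U" "u' \<in> U" and eq: "F (u, i, j) = F (u', i', j')"
    have "j = j'" using adjF(1)[OF u(1), of i j] adjF(1)[OF u(2), of i' j'] eq by simp
    moreover have "i = i'" using adjF(2)[OF u(1), of i j] adjF(2)[OF u(2), of i' j'] eq \<open>j = j'\<close> by auto
    ultimately show "u = u' \<and> i = i' \<and> j = j'"
      using eq U[OF u(1)] U[OF u(2)] gc by (auto simp: F_def split: if_splits)
  qed
  moreover have "F ` (U \<times> UNIV) \<subseteq> carrier G"
    using U gc by (auto simp: F_def)
  ultimately have "card (U \<times> (UNIV :: (bool \<times> bool) set)) \<le> card (carrier G)"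
    using finite_carrier by (intro card_inj_on_le[of F]) auto
  thus ?thesis using cU by (simp add: card_cartesian_product card_UNIV_bool flip: UNIV_Times_UNIV)
qed

end

section \<open>Symplectic bases\<close>

lemma (in group) order_pos_least:
  assumes "finite (carrier G)" "a \<in> carrier G" shows "ord a > 0"
  using ord_ge_1[OF assms] by simp

lemma (in group) subgroup_pow_closed:
  assumes "subgroup K G" "x \<in> K" shows "x [^] (n::nat) \<in> K"
  by (induction n) (use assms in \<open>auto intro: subgroup.one_closed subgroup.m_closed\<close>)

lemma (in comm_group) subgroup_imp_comm:
  assumes "subgroup K G" shows "comm_group (G\<lparr>carrier := K\<rparr>)"
proof -
  interpret H: group "G\<lparr>carrier := K\<rparr>"
    using assms by (rule subgroup_imp_group)
  show ?thesis
    by unfold_locales (use subgroup.mem_carrier[OF assms] m_comm in auto)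
qed

text \<open>A multiple of \<open>ord y\<close> kills y, so \<open>ord x\<close> divides
  \<open>N * ord y\<close> for the order N of the product; coprimality removes the second
  factor.\<close>

lemma (in comm_group) ord_mult_coprime:
  assumes a: "a \<in> carrier G" and b: "b \<in> carrier G" and co: "coprime (ord a) (ord b)"
  shows "ord a * ord b dvd ord (a \<otimes> b)"
proof -
  have half: "ord x dvd ord (x \<otimes> y)"
    if x: "x \<in> carrier G" and y: "y \<in> carrier G" and co: "coprime (ord x) (ord y)" for x y
  proof -
    define N where "N = ord (x \<otimes> y)"
    have "(x \<otimes> y) [^] (N * ord y) = \<one>"
      using x y unfolding N_def by (simp flip: nat_pow_pow)
    moreover have "y [^] (N * ord y) = \<one>"
      using y by (simp add: mult.commute[of N] flip: nat_pow_pow)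
    ultimately have "x [^] (N * ord y) = \<one>"
      using x y by (simp add: pow_mult_distrib m_comm)
    hence "ord x dvd N * ord y"
      using x pow_eq_id by blast
    thus ?thesis using co by (simp add: N_def coprime_dvd_mult_left_iff)
  qed
  have "ord a dvd ord (a \<otimes> b)" "ord b dvd ord (a \<otimes> b)"
    using half[OF a b co] half[OF b a] co a b by (simp_all add: m_comm coprime_commute)
  thus ?thesis using co by (rule divides_mult)
qed

text \<open>An element a of maximal order works: if some \<open>ord x\<close> contained a higher
  power of a prime p, then exchanging the p-part of a for that of x would give a larger
  order.\<close>

lemma (in comm_group) exponent_attained:
  assumes fin: "finite (carrier G)"
  obtains a where "a \<in> carrier G" "\<And>x. x \<in> carrier G \<Longrightarrow> x [^] ord a = \<one>"
proof -
  define m where "m = Max (ord ` carrier G)"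
  have "m \<in> ord ` carrier G"
    unfolding m_def using fin by (intro Max_in) auto
  then obtain a where a: "a \<in> carrier G" "ord a = m" by auto
  have max: "ord x \<le> m" if "x \<in> carrier G" for x
    unfolding m_def using fin that by (intro Max_ge) auto
  have pos: "ord x > 0" if "x \<in> carrier G" for x
    using order_pos_least[OF fin that] .
  have "ord x dvd m" if x: "x \<in> carrier G" for x
  proof (rule ccontr)
    assume "\<not> ord x dvd m"
    then obtain p where p: "Factorial_Ring.prime p" "multiplicity p (ord x) > multiplicity p m"
      using multiplicity_le_imp_dvd[of "ord x" m] pos[OF x] by (metis not_le less_numeral_extra(3))
    define i j where "i = multiplicity p m" and "j = multiplicity p (ord x)"
    have m0: "m > 0" using pos a by auto
    obtain r where r: "m = p ^ i * r" "\<not> p dvd r"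
      using multiplicity_decompose'[of m p] m0 p by (metis i_def not_prime_unit gr_implies_not0 mult.commute)
    obtain s where s: "ord x = p ^ j * s"
      using multiplicity_dvd[of p "ord x"] unfolding j_def by (auto simp: dvd_def)
    have ppos: "p > 0" using p(1) prime_gt_0_nat by blast
    have oa: "ord (a [^] (p ^ i)) = r"
      using ord_pow[of a "p ^ i"] a r ppos by simp
    have ox: "ord (x [^] s) = p ^ j"
      using ord_pow[of x s] x s pos[OF x] by (cases "s = 0") auto
    have "coprime r (p ^ j)"
      using p(1) r(2) by (simp add: coprime_commute prime_imp_coprime)
    hence "r * p ^ j dvd ord (a [^] (p ^ i) \<otimes> x [^] s)"
      using ord_mult_coprime[of "a [^] (p ^ i)" "x [^] s"] a x oa ox by simp
    hence "r * p ^ j \<le> ord (a [^] (p ^ i) \<otimes> x [^] s)"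
      using a x by (intro dvd_imp_le pos) auto
    also have "\<dots> \<le> m" using a x by (intro max) auto
    finally have "r * p ^ j \<le> r * p ^ i" using r by (simp add: mult.commute)
    hence "p ^ j \<le> p ^ i" using r m0 by simp
    moreover have "i < j" using p by (simp add: i_def j_def)
    ultimately show False
      using prime_gt_1_nat[OF p(1)] by (metis not_le power_strict_increasing_iff)
  qed
  thus thesis using that[of a] a pow_eq_id by blast
qed

section \<open>Powers of primitive roots of unity\<close>

lemma primitive_root_power_eq_1_iff:
  assumes "primitive_root_of_unity n z" shows "z ^ m = 1 \<longleftrightarrow> n dvd m"
proof
  assume z: "z ^ m = 1"
  have "z ^ (m mod n) = z ^ (m mod n) * (z ^ n) ^ (m div n)"
    using assms by (simp add: primitive_root_of_unity_def)
  also have "\<dots> = z ^ m"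
    by (simp flip: power_mult power_add)
  finally have "z ^ (m mod n) = 1" using z by simp
  moreover have "m mod n < n" using assms by (simp add: primitive_root_of_unity_def)
  ultimately show "n dvd m"
    using assms unfolding primitive_root_of_unity_def by (metis bot_nat_0.not_eq_extremum mod_eq_0_iff_dvd)
next
  assume "n dvd m"
  thus "z ^ m = 1"
    using assms by (auto simp: primitive_root_of_unity_def power_mult dvd_def)
qed

lemma primitive_root_nonzero: "primitive_root_of_unity n z \<Longrightarrow> z \<noteq> 0"
  by (auto simp: primitive_root_of_unity_def power_0_left)

lemma primitive_root_inj:
  assumes "primitive_root_of_unity n z" shows "inj_on (\<lambda>i. z ^ i) {..<n}"
proof -
  have *: "i = j" if "i < n" "j < n" "i \<le> j" "z ^ i = z ^ j" for i j
  proof -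
    have "z ^ i * z ^ (j - i) = z ^ i * 1"
      using that(3,4) power_add[of z i "j - i"] by simp
    hence "z ^ (j - i) = 1" using primitive_root_nonzero[OF assms] by simp
    hence "n dvd j - i" using primitive_root_power_eq_1_iff[OF assms] by blast
    thus ?thesis using that dvd_imp_le[of n "j - i"] by (cases "j - i = 0") auto
  qed
  show ?thesis
  proof (rule inj_onI)
    fix i j assume "i \<in> {..<n}" "j \<in> {..<n}" "z ^ i = z ^ j"
    thus "i = j" using *[of i j] *[of j i] by (cases "i \<le> j") simp_all
  qed
qed

text \<open>The powers of z are n distinct solutions of an equation with exactly n
  solutions.\<close>

lemma root_of_unity_is_power:
  assumes "primitive_root_of_unity n z" "w ^ n = 1"
  obtains i where "i < n" "w = z ^ i"
proof -
  have n: "n > 0" "z ^ n = 1" using assms by (auto simp: primitive_root_of_unity_def)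
  have "(\<lambda>i. z ^ i) ` {..<n} = {w. w ^ n = 1}"
  proof (rule card_subset_eq)
    show "finite {w::complex. w ^ n = 1}"
      using card_roots_unity_eq[OF n(1)] n by (metis card_ge_0_finite)
    show "(\<lambda>i. z ^ i) ` {..<n} \<subseteq> {w. w ^ n = 1}"
    proof clarify
      fix i show "(z ^ i) ^ n = 1"
        using n by (metis power_mult mult.commute power_one)
    qed
    show "card ((\<lambda>i. z ^ i) ` {..<n}) = card {w::complex. w ^ n = 1}"
      using card_image[OF primitive_root_inj[OF assms(1)]] card_roots_unity_eq[OF n(1)] by simp
  qed
  thus thesis using that assms(2) by blast
qed

lemma comm_group_Cstar: "comm_group Cstar"
proof (rule comm_groupI)
  fix x assume "x \<in> carrier Cstar"
  thus "\<exists>y\<in>carrier Cstar. y \<otimes>\<^bsub>Cstar\<^esub> x = \<one>\<^bsub>Cstar\<^esub>"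
    by (intro bexI[of _ "inverse x"]) (simp_all add: Cstar_def)
qed (simp_all add: Cstar_def)

lemma Cstar_pow: "x [^]\<^bsub>Cstar\<^esub> (n::nat) = x ^ n"
  by (induction n) (simp_all add: Cstar_def)

section \<open>Splitting off hyperbolic planes\<close>

context alternating_group
begin

definition nonsingular_on :: "'a set \<Rightarrow> bool" where
  "nonsingular_on K \<longleftrightarrow> (\<forall>x\<in>K. (\<forall>y\<in>K. \<beta> x y = 1) \<longrightarrow> x = \<one>)"

definition perp :: "'a set \<Rightarrow> 'a \<Rightarrow> 'a \<Rightarrow> 'a set" where
  "perp K a b = {x \<in> K. \<beta> x a = 1 \<and> \<beta> x b = 1}"

context
  fixes K a b and n :: nat
  assumes K: "subgroup K G" and fin: "finite K" and ns: "nonsingular_on K"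
    and a: "a \<in> K" "a [^] n = \<one>" and b: "b \<in> K" "b [^] n = \<one>"
    and prim: "primitive_root_of_unity n (\<beta> a b)"
begin

lemma hyperbolic_carrier: "x \<in> K \<Longrightarrow> x \<in> carrier G" "a \<in> carrier G" "b \<in> carrier G"
  using subgroup.mem_carrier[OF K] a(1) b(1) by auto

lemma perp_subgroup: "subgroup (perp K a b) G"
proof (rule subgroupI)
  have "\<one> \<in> perp K a b"
    using subgroup.one_closed[OF K] hyperbolic_carrier by (auto simp: perp_def)
  thus "perp K a b \<noteq> {}" by blast
next
  fix x assume "x \<in> perp K a b"
  thus "inv x \<in> perp K a b"
    using hyperbolic_carrier subgroup.m_inv_closed[OF K, of x] by (auto simp: perp_def)
  fix y assume "y \<in> perp K a b"
  thus "x \<otimes> y \<in> perp K a b"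
    using \<open>x \<in> perp K a b\<close> hyperbolic_carrier subgroup.m_closed[OF K, of x y] by (auto simp: perp_def)
qed (use hyperbolic_carrier(1) in \<open>auto simp: perp_def\<close>)

text \<open>\<open>\<beta> x b\<close> and \<open>\<beta> a x\<close> are n-th roots of unity, hence
  powers of \<open>\<beta> a b\<close>; their exponents are the coordinates of the part of x in the
  plane.\<close>

lemma split_off_plane:
  assumes x: "x \<in> K"
  obtains i j y where "i < n" "j < n" "y \<in> perp K a b" "x = a [^] i \<otimes> b [^] j \<otimes> y"
proof -
  have c: "x \<in> carrier G" "a \<in> carrier G" "b \<in> carrier G" using hyperbolic_carrier x by auto
  have "\<beta> x b ^ n = 1" using bichar_pow_right[of x b n] c b by simp
  then obtain i where i: "i < n" "\<beta> x b = \<beta> a b ^ i"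
    using root_of_unity_is_power[OF prim] by blast
  have "\<beta> a x ^ n = 1" using bichar_pow_left[of a x n] c a by simp
  then obtain j where j: "j < n" "\<beta> a x = \<beta> a b ^ j"
    using root_of_unity_is_power[OF prim] by blast
  define h where "h = a [^] i \<otimes> b [^] j"
  have hK: "h \<in> K"
    unfolding h_def by (intro subgroup.m_closed[OF K] subgroup_pow_closed[OF K] a b)
  have hc: "h \<in> carrier G" using hK hyperbolic_carrier by blast
  define y where "y = x \<otimes> inv h"
  have yK: "y \<in> K" unfolding y_def
    by (intro subgroup.m_closed[OF K] subgroup.m_inv_closed[OF K] x hK)
  have "\<beta> h b = \<beta> a b ^ i" "\<beta> a h = \<beta> a b ^ j"
    unfolding h_def using c by simp_all
  moreover from this have "\<beta> h a = \<beta> x a"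
    using bichar_swap[of a h] bichar_swap[of a x] c hc j by simp
  ultimately have "y \<in> perp K a b"
    unfolding y_def perp_def using yK[unfolded y_def] c hc i by simp
  moreover have "x = h \<otimes> y" unfolding y_def using c hc by (simp add: m_lcomm[of h x "inv h"])
  ultimately show thesis using that i j unfolding h_def by blast
qed

lemma perp_nonsingular: "nonsingular_on (perp K a b)"
  unfolding nonsingular_on_def
proof (intro ballI impI)
  fix x assume x: "x \<in> perp K a b" and orth: "\<forall>y\<in>perp K a b. \<beta> x y = 1"
  have xK: "x \<in> K" "\<beta> x a = 1" "\<beta> x b = 1" using x by (auto simp: perp_def)
  have "\<beta> x y = 1" if "y \<in> K" for y
  proof -
    obtain i j z where "z \<in> perp K a b" "y = a [^] (i::nat) \<otimes> b [^] (j::nat) \<otimes> z"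
      using split_off_plane[OF \<open>y \<in> K\<close>] by blast
    thus ?thesis
      using orth xK hyperbolic_carrier by (auto simp: perp_def)
  qed
  thus "x = \<one>" using ns xK by (auto simp: nonsingular_on_def)
qed

text \<open>Pairing with b and a reads off i and j, so the decomposition of
  \<open>split_off_plane\<close> is unique.\<close>

lemma card_perp: "card K = n * n * card (perp K a b)"
proof -
  define F where "F = (\<lambda>(i, j, y). a [^] (i::nat) \<otimes> b [^] (j::nat) \<otimes> y)"
  have F: "\<beta> (F (i, j, y)) b = \<beta> a b ^ i" "\<beta> a (F (i, j, y)) = \<beta> a b ^ j" if "y \<in> perp K a b" for i j y
    using that hyperbolic_carrier bichar_swap[of y a] by (auto simp: F_def perp_def)
  have inj: "inj_on F ({..<n} \<times> {..<n} \<times> perp K a b)"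
  proof (rule inj_onI, clarsimp)
    fix i j y i' j' y'
    assume *: "i < n" "j < n" "y \<in> perp K a b" "i' < n" "j' < n" "y' \<in> perp K a b"
      and eq: "F (i, j, y) = F (i', j', y')"
    have "\<beta> a b ^ i = \<beta> a b ^ i'" "\<beta> a b ^ j = \<beta> a b ^ j'"
      using F(1)[OF *(3), of i j] F(1)[OF *(6), of i' j'] F(2)[OF *(3), of i j] F(2)[OF *(6), of i' j'] eq
      by simp_all
    hence "i = i'" "j = j'"
      using primitive_root_inj[OF prim] * by (auto simp: inj_on_def)
    thus "i = i' \<and> j = j' \<and> y = y'"
      using eq * hyperbolic_carrier by (auto simp: F_def perp_def)
  qed
  have img: "F ` ({..<n} \<times> {..<n} \<times> perp K a b) = K"
  proof
    show "F ` ({..<n} \<times> {..<n} \<times> perp K a b) \<subseteq> K"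
    proof clarsimp
      fix i j y assume "y \<in> perp K a b"
      moreover have "a [^] (i::nat) \<in> K" "b [^] (j::nat) \<in> K"
        using subgroup_pow_closed[OF K] a b by blast+
      ultimately show "F (i, j, y) \<in> K"
        using subgroup.m_closed[OF K] by (auto simp: F_def perp_def)
    qed
    show "K \<subseteq> F ` ({..<n} \<times> {..<n} \<times> perp K a b)"
    proof
      fix x assume "x \<in> K"
      then obtain i j y where "i < n" "j < n" "y \<in> perp K a b" "x = F (i, j, y)"
        using split_off_plane unfolding F_def by (metis case_prod_conv)
      thus "x \<in> F ` ({..<n} \<times> {..<n} \<times> perp K a b)" by blast
    qed
  qed
  show ?thesis
    using card_image[OF inj] img by (simp add: card_cartesian_product)
qed

end

text \<open>Spanning is encoded by the last condition: the pairings make the coordinates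
  independent, so a set of the right cardinality is exhausted. The order in
  \<open>\<beta> (f t) (e t)\<close> matches the sign of the exponent in
  \<open>I_bichar\<close>.\<close>

definition symplectic_basis :: "'a set \<Rightarrow> nat list \<Rightarrow> (nat \<Rightarrow> 'a) \<Rightarrow> (nat \<Rightarrow> 'a) \<Rightarrow> bool" where
  "symplectic_basis K ns e f \<longleftrightarrow>
     (\<forall>t<length ns. e t \<in> K \<and> f t \<in> K \<and> e t [^] (ns ! t) = \<one> \<and> f t [^] (ns ! t) = \<one> \<and>
        primitive_root_of_unity (ns ! t) (\<beta> (f t) (e t))) \<and>
     (\<forall>s<length ns. \<forall>t<length ns. s \<noteq> t \<longrightarrow>
        \<beta> (e s) (e t) = 1 \<and> \<beta> (e s) (f t) = 1 \<and> \<beta> (f s) (e t) = 1 \<and> \<beta> (f s) (f t) = 1) \<and>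
     card K = (\<Prod>t<length ns. ns ! t * ns ! t)"

text \<open>The new plane is put last because \<open>symplectic_basis_exists\<close> splits off the
  largest order first, while divisor chains ascend.\<close>

lemma symplectic_basis_snoc:
  assumes K: "subgroup K G" "finite K" "nonsingular_on K"
    and f: "f \<in> K" "f [^] n = \<one>" and e: "e \<in> K" "e [^] n = \<one>"
    and prim: "primitive_root_of_unity n (\<beta> f e)"
    and basis: "symplectic_basis (perp K f e) ns es fs"
  shows "symplectic_basis K (ns @ [n]) (es(length ns := e)) (fs(length ns := f))"
proof -
  have c: "x \<in> carrier G" if "x \<in> K" for x using subgroup.mem_carrier[OF K(1) that] .
  have P: "x \<in> K" "\<beta> x f = 1" "\<beta> x e = 1" "\<beta> f x = 1" "\<beta> e x = 1" if "x \<in> perp K f e" for x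
    using that c[of x] c[OF f(1)] c[OF e(1)] bichar_eq_1_sym by (auto simp: perp_def)
  have card: "card K = n * n * card (perp K f e)"
    by (rule card_perp) (use assms in auto)
  have B: "es t \<in> perp K f e" "fs t \<in> perp K f e" "es t [^] (ns ! t) = \<one>" "fs t [^] (ns ! t) = \<one>"
      "primitive_root_of_unity (ns ! t) (\<beta> (fs t) (es t))" if "t < length ns" for t
    using basis that by (auto simp: symplectic_basis_def)
  have B': "\<beta> (es s) (es t) = 1" "\<beta> (es s) (fs t) = 1" "\<beta> (fs s) (es t) = 1" "\<beta> (fs s) (fs t) = 1"
    if "s < length ns" "t < length ns" "s \<noteq> t" for s t
    using basis that by (auto simp: symplectic_basis_def)
  let ?e = "es(length ns := e)" and ?f = "fs(length ns := f)"
  have 1: "?e t \<in> K \<and> ?f t \<in> K \<and> ?e t [^] ((ns @ [n]) ! t) = \<one> \<and> ?f t [^] ((ns @ [n]) ! t) = \<one> \<and>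
      primitive_root_of_unity ((ns @ [n]) ! t) (\<beta> (?f t) (?e t))" if "t < length (ns @ [n])" for t
  proof (cases "t = length ns")
    case False
    hence t: "t < length ns" using that by simp
    show ?thesis using B[OF t] P(1) t by (simp add: nth_append)
  qed (use f e prim in simp)
  have 2: "\<beta> (?e s) (?e t) = 1 \<and> \<beta> (?e s) (?f t) = 1 \<and> \<beta> (?f s) (?e t) = 1 \<and> \<beta> (?f s) (?f t) = 1"
    if st: "s < length (ns @ [n])" "t < length (ns @ [n])" "s \<noteq> t" for s t
  proof -
    consider "s < length ns" "t < length ns" | "s < length ns" "t = length ns" | "s = length ns" "t < length ns"
      using st by (auto simp: less_Suc_eq)
    thus ?thesis
      by cases (use B' st P(2-5) B(1,2) in simp_all)
  qed
  have 3: "card K = (\<Prod>t<length (ns @ [n]). (ns @ [n]) ! t * (ns @ [n]) ! t)"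
    using card basis by (simp add: symplectic_basis_def nth_append)
  show ?thesis
    unfolding symplectic_basis_def using 1 2 3 by blast
qed

lemma symplectic_basis_empty: "symplectic_basis {\<one>} [] e f"
  by (simp add: symplectic_basis_def)

text \<open>b has as order n the exponent of K, and \<open>v = \<beta> b a\<close> has as order d
  the exponent of the group of all values of b. Then db is orthogonal to K, hence 0, so d = n and a,
  b span a hyperbolic plane. As n annihilates the complement too, it is divisible by the orders that
  occur there.\<close>

lemma symplectic_basis_exists:
  assumes "subgroup K G" "finite K" "nonsingular_on K"
  obtains ns e f where "symplectic_basis K ns e f" "\<And>n. n \<in> set ns \<Longrightarrow> n > 1"
    "\<And>i. Suc i < length ns \<Longrightarrow> ns ! i dvd ns ! Suc i"
proof -
  have "\<exists>ns e f. symplectic_basis K ns e f \<and> (\<forall>n\<in>set ns. n > 1) \<and>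
      (\<forall>i. Suc i < length ns \<longrightarrow> ns ! i dvd ns ! Suc i)"
    using assms
  proof (induction "card K" arbitrary: K rule: less_induct)
    case less
    note K = less.prems
    have c: "x \<in> carrier G" if "x \<in> K" for x using subgroup.mem_carrier[OF K(1) that] .
    show ?case
    proof (cases "K = {\<one>}")
      case True
      thus ?thesis using symplectic_basis_empty by (intro exI[of _ "[]"]) auto
    next
      case False
      interpret H: comm_group "G\<lparr>carrier := K\<rparr>"
        using K(1) by (rule subgroup_imp_comm)
      obtain b where b: "b \<in> K" "\<And>x. x \<in> K \<Longrightarrow> x [^] H.ord b = \<one>"
        using H.exponent_attained K(2) by (auto simp flip: nat_pow_consistent)
      define n where "n = H.ord b"
      have bn: "b [^] m = \<one> \<longleftrightarrow> n dvd m" for m :: nat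
        using H.pow_eq_id[of b m] b by (simp add: n_def flip: nat_pow_consistent)
      have n0: "n > 0"
        unfolding n_def using H.order_pos_least b K(2) by simp
      define V where "V = \<beta> b ` K"
      interpret C: comm_group Cstar by (rule comm_group_Cstar)
      have "subgroup V Cstar"
      proof (rule C.subgroupI)
        show "V \<subseteq> carrier Cstar" using c b by (auto simp: V_def Cstar_def)
        show "V \<noteq> {}" using b by (auto simp: V_def)
        fix v w assume "v \<in> V" "w \<in> V"
        then obtain x y where xy: "v = \<beta> b x" "w = \<beta> b y" "x \<in> K" "y \<in> K" by (auto simp: V_def)
        have "v \<otimes>\<^bsub>Cstar\<^esub> w = \<beta> b (x \<otimes> y)"
          using xy c b by (simp add: Cstar_def)
        thus "v \<otimes>\<^bsub>Cstar\<^esub> w \<in> V" using subgroup.m_closed[OF K(1)] xy by (auto simp: V_def)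
        have "inv\<^bsub>Cstar\<^esub> v = \<beta> b (inv x)"
          using xy c b by (intro C.inv_equality) (auto simp: Cstar_def)
        thus "inv\<^bsub>Cstar\<^esub> v \<in> V" using subgroup.m_inv_closed[OF K(1)] xy by (auto simp: V_def)
      qed
      then interpret V: comm_group "Cstar\<lparr>carrier := V\<rparr>"
        by (rule C.subgroup_imp_comm)
      have pw: "v [^]\<^bsub>Cstar\<lparr>carrier := V\<rparr>\<^esub> m = v ^ m" for v and m :: nat
        using C.nat_pow_consistent[of v m V] by (simp add: Cstar_pow)
      obtain v where v: "v \<in> V" "\<And>x. x \<in> V \<Longrightarrow> x ^ V.ord v = 1"
        using V.exponent_attained K(2) pw by (auto simp: V_def Cstar_def)
      obtain a where a: "a \<in> K" "v = \<beta> b a" using v by (auto simp: V_def)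
      define d where "d = V.ord v"
      have vd: "v ^ m = 1 \<longleftrightarrow> d dvd m" for m :: nat
        using V.pow_eq_id[of v m] v pw by (simp add: d_def Cstar_def)
      have "b [^] d = \<one>"
      proof -
        have "b [^] d \<in> K" using subgroup_pow_closed[OF K(1)] b by blast
        moreover have "\<beta> (b [^] d) y = 1" if "y \<in> K" for y
          using v(2)[of "\<beta> b y"] that b c by (simp add: d_def V_def)
        ultimately show ?thesis using K(3) by (simp add: nonsingular_on_def)
      qed
      hence "n dvd d" using bn by blast
      moreover have "v ^ n = \<beta> (b [^] n) a"
        using a b c by simp
      hence "v ^ n = 1"
        using a c bn[of n] by simp
      hence "d dvd n" using vd by blast
      ultimately have "d = n" by (rule dvd_antisym[rotated])
      hence prim: "primitive_root_of_unity n (\<beta> b a)"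
        unfolding primitive_root_of_unity_def using vd n0 a dvd_imp_le by (metis dvd_refl not_le)
      have bn1: "b [^] n = \<one>" and an1: "a [^] n = \<one>" using b a n_def by auto
      have n1: "n > 1"
      proof (rule ccontr)
        assume "\<not> n > 1"
        hence "n = 1" using n0 by simp
        hence "x = \<one>" if "x \<in> K" for x using b(2)[OF that] c[OF that] by (simp add: n_def)
        thus False using False subgroup.one_closed[OF K(1)] by blast
      qed
      have sub: "subgroup (perp K b a) G" "nonsingular_on (perp K b a)"
        and card: "card K = n * n * card (perp K b a)"
        using perp_subgroup[OF K b(1) bn1 a(1) an1 prim] perp_nonsingular[OF K b(1) bn1 a(1) an1 prim]
          card_perp[OF K b(1) bn1 a(1) an1 prim] by auto
      have fin: "finite (perp K b a)" using K(2) by (auto simp: perp_def)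
      have "card (perp K b a) > 0"
        using fin subgroup.one_closed[OF sub(1)] card_gt_0_iff by blast
      hence "card (perp K b a) < card K"
        unfolding card using n1 by (simp add: one_less_mult)
      then obtain ns es fs where IH: "symplectic_basis (perp K b a) ns es fs" "\<forall>n\<in>set ns. n > 1"
        "\<And>i. Suc i < length ns \<Longrightarrow> ns ! i dvd ns ! Suc i"
        using less.hyps[of "perp K b a"] sub fin by blast
      have "symplectic_basis K (ns @ [n]) (es(length ns := a)) (fs(length ns := b))"
        by (rule symplectic_basis_snoc) (use K a b an1 bn1 prim IH in auto)
      moreover have "(ns @ [n]) ! i dvd (ns @ [n]) ! Suc i" if "Suc i < length (ns @ [n])" for i
      proof (cases "Suc i < length ns")
        case True
        thus ?thesis using IH(3)[OF True] by (simp add: nth_append)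
      next
        case False
        hence i: "Suc i = length ns" using that by simp
        hence *: "primitive_root_of_unity (ns ! i) (\<beta> (fs i) (es i))" "fs i \<in> K" "es i \<in> K"
          using IH(1) by (auto simp: symplectic_basis_def perp_def)
        have "\<beta> (fs i) (es i) ^ n = 1"
          using bichar_pow_left[of "fs i" "es i" n] b(2)[of "fs i"] * c by (simp add: n_def)
        hence "ns ! i dvd n" using primitive_root_power_eq_1_iff[OF *(1)] by blast
        thus ?thesis using i by (simp add: nth_append)
      qed
      moreover have "\<forall>m\<in>set (ns @ [n]). m > 1"
        using IH(2) n1 by simp
      ultimately show ?thesis by blast
    qed
  qed
  thus thesis using that by blast
qed

end

section \<open>Coordinates for the types I, III and V\<close>

text \<open>Coordinates are maps from the model to G, whereas \<open>frs_isomorphic\<close> asks for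
  the opposite direction.\<close>

lemma frs_isomorphicI:
  assumes "group M" "h \<in> iso M G"
    and "\<And>a b. a \<in> carrier M \<Longrightarrow> b \<in> carrier M \<Longrightarrow> \<beta> (h a) (h b) = \<beta>' a b"
    and "h ` R' = R" "R' \<subseteq> carrier M"
  shows "frs_isomorphic G \<beta> R M \<beta>' R'"
proof -
  interpret M: group M by fact
  define g where "g = inv_into (carrier M) h"
  have g: "g \<in> iso G M"
    unfolding g_def by (rule M.iso_set_sym) fact
  have bij: "bij_betw h (carrier M) (carrier G)" using assms(2) by (simp add: iso_def)
  have hg: "g x \<in> carrier M" "h (g x) = x" if "x \<in> carrier G" for x
    using that bij unfolding g_def by (auto simp: bij_betw_def inv_into_into f_inv_into_f)
  have gh: "g (h a) = a" if "a \<in> carrier M" for a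
    using that bij unfolding g_def by (auto simp: bij_betw_def)
  have "g ` R = (\<lambda>a. g (h a)) ` R'"
    unfolding assms(4)[symmetric] by (simp add: image_image)
  also have "\<dots> = R'"
  proof -
    have "(\<lambda>a. g (h a)) ` R' = id ` R'"
      by (rule image_cong) (use gh assms(5) in auto)
    thus ?thesis by simp
  qed
  finally have "g ` R = R'" .
  moreover have "\<beta>' (g a) (g b) = \<beta> a b" if "a \<in> carrier G" "b \<in> carrier G" for a b
    using assms(3)[of "g a" "g b"] hg that by simp
  ultimately show ?thesis
    unfolding frs_isomorphic_def using g by blast
qed

lemma (in comm_group) finprod_hom:
  assumes "group M" "finite I" "\<And>i. i \<in> I \<Longrightarrow> \<phi> i \<in> hom M G"
  shows "(\<lambda>a. finprod G (\<lambda>i. \<phi> i a) I) \<in> hom M G"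
  using assms(2,3)
proof (induction I rule: finite_induct)
  case (insert j I)
  have IH: "(\<lambda>a. finprod G (\<lambda>i. \<phi> i a) I) \<in> hom M G" using insert by simp
  have "finprod G (\<lambda>i. \<phi> i a) (insert j I) = \<phi> j a \<otimes> finprod G (\<lambda>i. \<phi> i a) I" if "a \<in> carrier M" for a
    using insert that by (intro finprod_insert) (auto simp: hom_def Pi_iff)
  moreover have "(\<lambda>a. \<phi> j a \<otimes> finprod G (\<lambda>i. \<phi> i a) I) \<in> hom M G"
    using IH insert.prems[of j] by (auto simp: hom_def Pi_iff m_ac)
  moreover have "x \<otimes>\<^bsub>M\<^esub> y \<in> carrier M" if "x \<in> carrier M" "y \<in> carrier M" for x y
    using that assms(1) by (simp add: group.is_monoid monoid.m_closed)
  ultimately show ?case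
    by (simp add: hom_def Pi_iff)
qed (auto simp: hom_def)

lemma (in group) int_pow_mod:
  assumes "e \<in> carrier G" "e [^] n = \<one>" shows "e [^] (i mod int n) = e [^] i"
proof -
  have "e [^] i = e [^] (int n * (i div int n) + i mod int n)" by simp
  also have "\<dots> = (e [^] int n) [^] (i div int n) \<otimes> e [^] (i mod int n)"
    using assms(1) by (simp only: int_pow_mult int_pow_pow)
  also have "e [^] int n = \<one>" using assms(2) by (simp add: int_pow_int)
  finally show ?thesis using assms(1) by simp
qed

lemma (in group) int_pow_hom_mod:
  assumes "e \<in> carrier G" "e [^] n = \<one>" "x \<in> hom M (integer_mod_group n)"
  shows "(\<lambda>a. e [^] (x a :: int)) \<in> hom M G"
  using assms by (auto simp: hom_def int_pow_mod int_pow_mult)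

context alternating_group
begin

lemma bichar_int_pow_right [simp]:
  assumes "a \<in> carrier G" "b \<in> carrier G" shows "\<beta> a (b [^] (i::int)) = \<beta> a b powi i"
  using assms by (cases i rule: int_cases2)
    (auto simp: int_pow_int int_pow_neg power_int_minus)

lemma bichar_int_pow_left [simp]:
  assumes "a \<in> carrier G" "b \<in> carrier G" shows "\<beta> (a [^] (i::int)) b = \<beta> a b powi i"
  using assms by (cases i rule: int_cases2)
    (auto simp: int_pow_int int_pow_neg power_int_minus)

lemma bichar_finprod_right:
  assumes "finite I" "a \<in> carrier G" "\<And>i. i \<in> I \<Longrightarrow> g i \<in> carrier G"
  shows "\<beta> a (finprod G g I) = (\<Prod>i\<in>I. \<beta> a (g i))"
  using assms
proof (induction I rule: finite_induct)
  case (insert j I)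
  have "finprod G g (insert j I) = g j \<otimes> finprod G g I"
    using insert by (intro finprod_insert) auto
  thus ?case using insert by simp
qed simp

lemma bichar_finprod_left:
  assumes "finite I" "a \<in> carrier G" "\<And>i. i \<in> I \<Longrightarrow> g i \<in> carrier G"
  shows "\<beta> (finprod G g I) a = (\<Prod>i\<in>I. \<beta> (g i) a)"
  using assms
proof (induction I rule: finite_induct)
  case (insert j I)
  have "finprod G g (insert j I) = g j \<otimes> finprod G g I"
    using insert by (intro finprod_insert) auto
  thus ?case using insert by simp
qed simp

text \<open>The coordinate functions are parameters, so that type I (pairs of residues) and types
  III and V (consecutive entries of a binary vector) share one construction.\<close>

definition coord_map ::
  "nat list \<Rightarrow> (nat \<Rightarrow> 'a) \<Rightarrow> (nat \<Rightarrow> 'a) \<Rightarrow> (nat \<Rightarrow> 'b \<Rightarrow> int) \<Rightarrow> (nat \<Rightarrow> 'b \<Rightarrow> int) \<Rightarrow> 'b \<Rightarrow> 'a" where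
  "coord_map ns e f x y a = finprod G (\<lambda>t. e t [^] x t a \<otimes> f t [^] y t a) {..<length ns}"

context
  fixes ns e f and M :: "('b, 'c) monoid_scheme" and x y
  assumes basis: "symplectic_basis (carrier G) ns e f" and fin: "finite (carrier G)"
    and M: "group M" "finite (carrier M)" "card (carrier M) = (\<Prod>t<length ns. ns ! t * ns ! t)"
    and x: "\<And>t. t < length ns \<Longrightarrow> x t \<in> hom M (integer_mod_group (ns ! t))"
    and y: "\<And>t. t < length ns \<Longrightarrow> y t \<in> hom M (integer_mod_group (ns ! t))"
    and xy_inj: "\<And>a b. \<lbrakk>a \<in> carrier M; b \<in> carrier M;
      \<And>t. t < length ns \<Longrightarrow> x t a = x t b \<and> y t a = y t b\<rbrakk> \<Longrightarrow> a = b"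
begin

lemma coord_basis:
  assumes "t < length ns"
  shows "e t \<in> carrier G" "f t \<in> carrier G" "e t [^] (ns ! t) = \<one>" "f t [^] (ns ! t) = \<one>"
    "primitive_root_of_unity (ns ! t) (\<beta> (f t) (e t))"
  using basis assms by (auto simp: symplectic_basis_def)

lemma coord_orthogonal:
  assumes "s < length ns" "t < length ns" "s \<noteq> t"
  shows "\<beta> (e s) (e t) = 1" "\<beta> (e s) (f t) = 1" "\<beta> (f s) (e t) = 1" "\<beta> (f s) (f t) = 1"
  using basis assms by (auto simp: symplectic_basis_def)

lemma coord_map_hom: "coord_map ns e f x y \<in> hom M G"
  unfolding coord_map_def
proof (intro finprod_hom M(1))
  fix t assume "t \<in> {..<length ns}"
  hence t: "t < length ns" by simp
  show "(\<lambda>a. e t [^] x t a \<otimes> f t [^] y t a) \<in> hom M G"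
    using int_pow_hom_mod[OF coord_basis(1,3)[OF t] x[OF t]] int_pow_hom_mod[OF coord_basis(2,4)[OF t] y[OF t]]
    by (auto simp: hom_def Pi_iff m_ac)
qed simp

text \<open>Pairing with a basis element isolates one coordinate; this yields both the formula for
  the bicharacter and injectivity.\<close>

lemma bichar_coord_map_e:
  assumes s: "s < length ns"
  shows "\<beta> (f s) (coord_map ns e f x y a) = \<beta> (f s) (e s) powi x s a"
    and "\<beta> (e s) (coord_map ns e f x y a) = \<beta> (f s) (e s) powi (- y s a)"
proof -
  have "\<beta> (f s) (coord_map ns e f x y a) = (\<Prod>t<length ns. \<beta> (f s) (e t) powi x t a * \<beta> (f s) (f t) powi y t a)"
    unfolding coord_map_def using coord_basis s by (subst bichar_finprod_right) auto
  also have "\<dots> = (\<Prod>t<length ns. if t = s then \<beta> (f s) (e s) powi x s a else 1)"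
    using coord_orthogonal coord_basis s by (intro prod.cong) auto
  also have "\<dots> = \<beta> (f s) (e s) powi x s a"
    using s by simp
  finally show "\<beta> (f s) (coord_map ns e f x y a) = \<beta> (f s) (e s) powi x s a" .
  have "\<beta> (e s) (coord_map ns e f x y a) = (\<Prod>t<length ns. \<beta> (e s) (e t) powi x t a * \<beta> (e s) (f t) powi y t a)"
    unfolding coord_map_def using coord_basis s by (subst bichar_finprod_right) auto
  also have "\<dots> = (\<Prod>t<length ns. if t = s then \<beta> (e s) (f s) powi y s a else 1)"
    using coord_orthogonal coord_basis s by (intro prod.cong) auto
  also have "\<dots> = \<beta> (e s) (f s) powi y s a"
    using s by simp
  also have "\<dots> = \<beta> (f s) (e s) powi (- y s a)"
    using bichar_swap[of "f s" "e s"] coord_basis s by (simp add: power_int_minus power_int_inverse)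
  finally show "\<beta> (e s) (coord_map ns e f x y a) = \<beta> (f s) (e s) powi (- y s a)" .
qed

lemma coord_map_closed: "a \<in> carrier M \<Longrightarrow> coord_map ns e f x y a \<in> carrier G"
  using coord_map_hom by (auto simp: hom_def)

lemma bichar_coord_map:
  assumes "a \<in> carrier M" "b \<in> carrier M"
  shows "\<beta> (coord_map ns e f x y a) (coord_map ns e f x y b) =
    (\<Prod>t<length ns. \<beta> (f t) (e t) powi (y t a * x t b - x t a * y t b))"
proof -
  let ?c = "coord_map ns e f x y"
  have bc: "?c b \<in> carrier G" using assms by (intro coord_map_closed)
  have "\<beta> (?c a) (?c b) = (\<Prod>t<length ns. \<beta> (e t) (?c b) powi x t a * \<beta> (f t) (?c b) powi y t a)"
    unfolding coord_map_def[of _ _ _ _ _ a] using coord_basis bc by (subst bichar_finprod_left) auto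
  also have "\<dots> = (\<Prod>t<length ns. \<beta> (f t) (e t) powi (y t a * x t b - x t a * y t b))"
  proof (intro prod.cong refl)
    fix t assume "t \<in> {..<length ns}"
    hence t: "t < length ns" by simp
    have "\<beta> (f t) (e t) \<noteq> 0" using coord_basis[OF t] by simp
    thus "\<beta> (e t) (?c b) powi x t a * \<beta> (f t) (?c b) powi y t a = \<beta> (f t) (e t) powi (y t a * x t b - x t a * y t b)"
      by (simp add: bichar_coord_map_e[OF t] power_int_mult[symmetric] power_int_add[symmetric] algebra_simps)
  qed
  finally show ?thesis .
qed

lemma primitive_root_powi_inj:
  assumes "primitive_root_of_unity n z" "z powi i = z powi j" "0 \<le> i" "i < int n" "0 \<le> j" "j < int n"
  shows "i = j"
proof -
  have "z ^ nat i = z ^ nat j"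
    using assms by (simp add: power_int_def)
  hence "nat i = nat j"
    using primitive_root_inj[OF assms(1)] assms by (auto simp: inj_on_def)
  thus ?thesis using assms by simp
qed

text \<open>Coordinates are residues from 0 to n - 1, so a power of a primitive root determines
  them; surjectivity follows by counting.\<close>

lemma coord_map_iso: "coord_map ns e f x y \<in> iso M G"
proof -
  let ?c = "coord_map ns e f x y"
  have rng: "0 \<le> x t a \<and> x t a < int (ns ! t)" "0 \<le> y t a \<and> y t a < int (ns ! t)"
    if "t < length ns" "a \<in> carrier M" for t a
  proof -
    have n: "ns ! t > 0" using coord_basis(5)[OF that(1)] by (simp add: primitive_root_of_unity_def)
    show "0 \<le> x t a \<and> x t a < int (ns ! t)"
      using hom_in_carrier[OF x[OF that(1)] that(2)] n by (simp add: carrier_integer_mod_group)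
    show "0 \<le> y t a \<and> y t a < int (ns ! t)"
      using hom_in_carrier[OF y[OF that(1)] that(2)] n by (simp add: carrier_integer_mod_group)
  qed
  have inj: "inj_on ?c (carrier M)"
  proof (rule inj_onI)
    fix a b assume ab: "a \<in> carrier M" "b \<in> carrier M" and eq: "?c a = ?c b"
    show "a = b"
    proof (rule xy_inj[OF ab])
      fix t assume t: "t < length ns"
      have nz: "\<beta> (f t) (e t) \<noteq> 0" using coord_basis[OF t] by simp
      have "\<beta> (f t) (e t) powi x t a = \<beta> (f t) (e t) powi x t b"
        using bichar_coord_map_e(1)[OF t, of a] bichar_coord_map_e(1)[OF t, of b] eq by simp
      moreover have "\<beta> (f t) (e t) powi y t a = \<beta> (f t) (e t) powi y t b"
        using bichar_coord_map_e(2)[OF t, of a] bichar_coord_map_e(2)[OF t, of b] eq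
        by (simp add: power_int_minus)
      ultimately show "x t a = x t b \<and> y t a = y t b"
        using primitive_root_powi_inj[OF coord_basis(5)[OF t]] rng[OF t] ab by blast
    qed
  qed
  have "?c ` carrier M = carrier G"
  proof (rule card_subset_eq[OF fin])
    show "?c ` carrier M \<subseteq> carrier G" using coord_map_closed by blast
    show "card (?c ` carrier M) = card (carrier G)"
      using card_image[OF inj] M(3) basis by (simp add: symplectic_basis_def)
  qed
  thus ?thesis using coord_map_hom inj by (simp add: iso_def bij_betw_def)
qed

end

end

lemma (in alternating_group) type_I_if_all_roots:
  assumes fin: "finite (carrier G)" and ns: "nonsingular G \<beta>" and nt: "carrier G \<noteq> {\<one>}"
    and R: "R = carrier G - {\<one>}"
  obtains ns where "divisor_chain ns" "of_type (TypeI ns) G \<beta> R"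
proof -
  have "nonsingular_on (carrier G)"
    using ns unfolding nonsingular_on_def nonsingular_def Rad_def by blast
  then obtain ns e f where basis: "symplectic_basis (carrier G) ns e f" and n1: "\<And>n. n \<in> set ns \<Longrightarrow> n > 1"
    and chain: "\<And>i. Suc i < length ns \<Longrightarrow> ns ! i dvd ns ! Suc i"
    using symplectic_basis_exists[OF subgroup_self fin] by blast
  have "ns \<noteq> []"
  proof
    assume "ns = []"
    hence "card (carrier G) = 1" using basis by (simp add: symplectic_basis_def)
    then obtain z where "carrier G = {z}" by (auto simp: card_1_singleton_iff)
    thus False using nt one_closed by (metis singletonD)
  qed
  hence dc: "divisor_chain ns"
    unfolding divisor_chain_def using n1 chain by blast
  define x y :: "nat \<Rightarrow> (nat \<Rightarrow> int \<times> int) \<Rightarrow> int" where "x t a = fst (a t)" and "y t a = snd (a t)" for t a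
  have pos: "ns ! t > 0" if "t < length ns" for t using n1[of "ns ! t"] that by simp
  have M: "group (I_group ns)" "finite (carrier (I_group ns))"
  proof -
    show "group (I_group ns)"
      unfolding I_group_def by (intro product_group DirProd_group group_integer_mod_group)
    show "finite (carrier (I_group ns))"
      unfolding I_group_def using pos
      by (auto simp: carrier_integer_mod_group DirProd_def intro!: finite_PiE)
  qed
  have cM: "card (carrier (I_group ns)) = (\<Prod>t<length ns. ns ! t * ns ! t)"
    unfolding I_group_def using pos
    by (auto simp: card_PiE DirProd_def carrier_integer_mod_group card_cartesian_product intro!: prod.cong)
  have mult_t: "(a \<otimes>\<^bsub>I_group ns\<^esub> b) t =
      ((fst (a t) + fst (b t)) mod int (ns ! t), (snd (a t) + snd (b t)) mod int (ns ! t))"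
    if "t < length ns" for a b t
    using that by (simp add: I_group_def DirProd_def case_prod_beta)
  have carr_t: "a t \<in> carrier (integer_mod_group (ns ! t)) \<times> carrier (integer_mod_group (ns ! t))"
    if "t < length ns" "a \<in> carrier (I_group ns)" for a t
    using PiE_mem[of a "{..<length ns}"] that by (simp add: I_group_def DirProd_def)
  have hx: "x t \<in> hom (I_group ns) (integer_mod_group (ns ! t))"
    and hy: "y t \<in> hom (I_group ns) (integer_mod_group (ns ! t))" if t: "t < length ns" for t
    using carr_t[OF t] mult_t[OF t] by (simp_all add: hom_def x_def y_def mem_Times_iff)
  have inj: "a = b" if "a \<in> carrier (I_group ns)" "b \<in> carrier (I_group ns)"
      and eq: "\<And>t. t < length ns \<Longrightarrow> x t a = x t b \<and> y t a = y t b" for a b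
  proof (rule PiE_ext)
    show "a \<in> PiE {..<length ns} (\<lambda>t. carrier (integer_mod_group (ns ! t) \<times>\<times> integer_mod_group (ns ! t)))"
      "b \<in> PiE {..<length ns} (\<lambda>t. carrier (integer_mod_group (ns ! t) \<times>\<times> integer_mod_group (ns ! t)))"
      using that(1,2) by (simp_all add: I_group_def)
    show "a t = b t" if "t \<in> {..<length ns}" for t
      using eq[of t] that by (simp add: x_def y_def prod_eq_iff)
  qed
  note ctx = basis fin M cM hx hy inj
  define c where "c = coord_map ns e f x y"
  have iso: "c \<in> iso (I_group ns) G"
    unfolding c_def by (rule coord_map_iso[OF ctx])
  interpret M: group "I_group ns" by (rule M)
  have "frs_isomorphic G \<beta> R (I_group ns) (I_bichar ns (\<lambda>t. \<beta> (f t) (e t)))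
      (carrier (I_group ns) - {\<one>\<^bsub>I_group ns\<^esub>})"
  proof (rule frs_isomorphicI[OF M(1) iso])
    show "\<beta> (c a) (c b) = I_bichar ns (\<lambda>t. \<beta> (f t) (e t)) a b"
      if "a \<in> carrier (I_group ns)" "b \<in> carrier (I_group ns)" for a b
      using bichar_coord_map[OF ctx that] by (simp add: c_def I_bichar_def x_def y_def)
    have "c \<one>\<^bsub>I_group ns\<^esub> = \<one>"
      using iso hom_one[OF _ M(1) is_group] by (simp add: iso_def)
    thus "c ` (carrier (I_group ns) - {\<one>\<^bsub>I_group ns\<^esub>}) = R"
      using iso M.one_closed unfolding R iso_def bij_betw_def inj_on_def by (auto simp: image_iff)
  qed auto
  moreover have "\<forall>t<length ns. primitive_root_of_unity (ns ! t) (\<beta> (f t) (e t))"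
    using basis by (auto simp: symplectic_basis_def)
  ultimately have "of_type (TypeI ns) G \<beta> R" using dc by auto
  thus thesis using that dc by blast
qed

section \<open>Binary vectors and quadratic forms on them\<close>

lemma group_Z2n: "group (Z2n n)"
  unfolding Z2n_def by (intro product_group group_integer_mod_group)

lemma carrier_Z2n: "carrier (Z2n n) = PiE {1..n} (\<lambda>_. {0..<2})"
  by (simp add: Z2n_def carrier_integer_mod_group)

lemma Z2n_entry: "a \<in> carrier (Z2n n) \<Longrightarrow> 1 \<le> i \<Longrightarrow> i \<le> n \<Longrightarrow> a i = 0 \<or> a i = 1"
  using PiE_mem[of a "{1..n}" "\<lambda>_. {0..<2}" i] by (force simp: carrier_Z2n)

lemma Z2n_ext: "a \<in> carrier (Z2n n) \<Longrightarrow> b \<in> carrier (Z2n n) \<Longrightarrow>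
    (\<And>i. 1 \<le> i \<Longrightarrow> i \<le> n \<Longrightarrow> a i = b i) \<Longrightarrow> a = b"
  unfolding carrier_Z2n by (rule PiE_ext) auto

lemma mult_Z2n: "1 \<le> i \<Longrightarrow> i \<le> n \<Longrightarrow> (a \<otimes>\<^bsub>Z2n n\<^esub> b) i = (a i + b i) mod 2"
  by (simp add: Z2n_def)

lemma one_Z2n: "1 \<le> i \<Longrightarrow> i \<le> n \<Longrightarrow> \<one>\<^bsub>Z2n n\<^esub> i = 0"
  by (simp add: Z2n_def)

lemma inv_Z2n: "a \<in> carrier (Z2n n) \<Longrightarrow> inv\<^bsub>Z2n n\<^esub> a = a"
proof (rule group.inv_equality[OF group_Z2n])
  assume a: "a \<in> carrier (Z2n n)"
  interpret group "Z2n n" by (rule group_Z2n)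
  show "a \<otimes>\<^bsub>Z2n n\<^esub> a = \<one>\<^bsub>Z2n n\<^esub>"
  proof (rule Z2n_ext)
    fix i assume "1 \<le> i" "i \<le> n"
    thus "(a \<otimes>\<^bsub>Z2n n\<^esub> a) i = \<one>\<^bsub>Z2n n\<^esub> i"
      using Z2n_entry[OF a, of i] by (auto simp: mult_Z2n one_Z2n)
  qed (use a in auto)
qed

lemma finite_Z2n: "finite (carrier (Z2n n))"
  by (auto simp: carrier_Z2n intro!: finite_PiE)

lemma card_Z2n: "card (carrier (Z2n n)) = 2 ^ n"
  by (simp add: carrier_Z2n card_PiE)

lemma Z2n_entry_hom: "1 \<le> i \<Longrightarrow> i \<le> n \<Longrightarrow> (\<lambda>a. a i) \<in> hom (Z2n n) (integer_mod_group 2)"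
  by (auto simp: hom_def carrier_Z2n carrier_integer_mod_group mult_Z2n PiE_iff)

lemma minus_one_powi: "(-1::complex) powi n = (if even n then 1 else -1)"
  by (cases n rule: int_cases2) (auto simp: power_int_minus)

lemma minus_one_powi_sum: "finite I \<Longrightarrow> (\<Prod>i\<in>I. (-1::complex) powi g i) = (-1) powi (\<Sum>i\<in>I. g i)"
  by (induction I rule: finite_induct) (auto simp: minus_one_powi)

lemma primitive_root_2: "primitive_root_of_unity 2 z \<longleftrightarrow> z = -1"
proof
  assume "primitive_root_of_unity 2 z"
  hence "z ^ 2 = 1" "z ^ 1 \<noteq> 1" unfolding primitive_root_of_unity_def by (metis, force)
  thus "z = -1" by (auto simp: power2_eq_1_iff)
next
  assume "z = -1"
  thus "primitive_root_of_unity 2 z"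
    unfolding primitive_root_of_unity_def by (auto simp: less_2_cases_iff)
qed

text \<open>Planes are renumbered from 0 as in \<open>symplectic_basis\<close>: plane t has the
  coordinates 2t + 1 and 2t + 2.\<close>

lemma symplectic_bichar_alt:
  "symplectic_bichar k a b =
     (-1) powi (\<Sum>t<k. a (2*t+2) * b (2*t+1) - a (2*t+1) * b (2*t+2))"
proof -
  have "(\<Sum>i=1..k. a (2*i) * b (2*i - 1) - a (2*i - 1) * b (2*i)) =
      (\<Sum>t<k. a (2*t+2) * b (2*t+1) - a (2*t+1) * b (2*t+2))"
    by (simp only: One_nat_def sum.atLeast1_atMost_eq) simp
  thus ?thesis by (simp only: symplectic_bichar_def)
qed

text \<open>For k at least 1 the flag \<open>c\<close> is the Arf invariant: if set, the first plane
  carries the anisotropic form x^2 + xy + y^2. Types III and V are thus handled together.\<close>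

definition quadratic_value :: "bool \<Rightarrow> nat \<Rightarrow> (nat \<Rightarrow> int) \<Rightarrow> int" where
  "quadratic_value c k a = (if c then (a 1)\<^sup>2 + (a 2)\<^sup>2 else 0) + (\<Sum>t<k. a (2*t+1) * a (2*t+2))"

definition quadratic_roots :: "bool \<Rightarrow> nat \<Rightarrow> (nat \<Rightarrow> int) set" where
  "quadratic_roots c k = {a \<in> carrier (Z2n (2*k)). odd (quadratic_value c k a)}"

lemma quadratic_roots_III_V: "III_roots k = quadratic_roots True k" "V_roots k = quadratic_roots False k"
proof -
  have "(\<Sum>i=1..k. a (2*i - 1) * a (2*i)) = (\<Sum>t<k. a (2*t+1) * a (2*t+2))" for a :: "nat \<Rightarrow> int"
    by (simp only: One_nat_def sum.atLeast1_atMost_eq) simp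
  thus "III_roots k = quadratic_roots True k" "V_roots k = quadratic_roots False k"
    by (simp_all only: III_roots_def V_roots_def quadratic_roots_def quadratic_value_def odd_iff_mod_2_eq_one) simp_all
qed

context elementary_root_system
begin

context
  assumes quadratic: "\<And>v w. v \<in> carrier G \<Longrightarrow> w \<in> carrier G \<Longrightarrow>
    v \<otimes> w \<in> R \<longleftrightarrow> ((v \<in> R) \<noteq> (w \<in> R)) \<noteq> adj v w"
begin

text \<open>As long as K contains a nonzero nonroot, a plane with a basis of nonroots splits off.
  Otherwise the form is anisotropic and K is a single plane. The anisotropic plane comes last in the
  recursion and so receives index 0.\<close>

lemma quadratic_basis_exists:
  assumes "subgroup K G" "nonsingular_on K"
  obtains k e f c where "symplectic_basis K (replicate k 2) e f"
    "\<And>t. t < k \<Longrightarrow> (e t \<in> R \<longleftrightarrow> c \<and> t = 0) \<and> (f t \<in> R \<longleftrightarrow> c \<and> t = 0)"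
proof -
  have "\<exists>k e f c. symplectic_basis K (replicate k 2) e f \<and>
    (\<forall>t<k. (e t \<in> R \<longleftrightarrow> c \<and> t = 0) \<and> (f t \<in> R \<longleftrightarrow> c \<and> t = 0))"
    using assms
  proof (induction "card K" arbitrary: K rule: less_induct)
    case less
    have K: "subgroup K G" "nonsingular_on K" by fact+
    have Kc: "x \<in> carrier G" if "x \<in> K" for x using subgroup.mem_carrier[OF K(1) that] .
    have Ksub: "K \<subseteq> carrier G" using Kc by blast
    have fin: "finite K" using Ksub finite_carrier by (rule finite_subset)
    have partner: "\<exists>y\<in>K. adj x y" if "x \<in> K" "x \<noteq> \<one>" for x
      using K(2) that unfolding nonsingular_on_def adj_def by blast
    have sq2: "x [^] (2::nat) = \<one>" if "x \<in> K" for x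
      using Kc[OF that] by (simp add: numeral_2_eq_2)
    have prim: "primitive_root_of_unity 2 (\<beta> y x)" if "adj y x" "x \<in> K" "y \<in> K" for x y
      using that Kc bichar_cases[of y x] by (auto simp: primitive_root_2 adj_def)
    have snoc: "symplectic_basis K (replicate (Suc k) 2) (es(k := e)) (fs(k := f))"
      if "e \<in> K" "f \<in> K" "adj f e" "symplectic_basis (perp K f e) (replicate k 2) es fs" for e f es fs k
      using symplectic_basis_snoc[OF K(1) fin K(2) that(2) sq2[OF that(2)] that(1) sq2[OF that(1)]
        prim[OF that(3,1,2)] that(4)]
      by (simp add: replicate_append_same)
    show ?case
    proof (cases "K = {\<one>}")
      case True
      have "symplectic_basis K (replicate 0 2) (\<lambda>_. \<one>) (\<lambda>_. \<one>)"
        using symplectic_basis_empty True by simp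
      thus ?thesis by blast
    next
      case False
      have oneK: "\<one> \<in> K" using subgroup.one_closed[OF K(1)] .
      show ?thesis
      proof (cases "\<exists>v\<in>K. v \<noteq> \<one> \<and> v \<notin> R")
        case True
        then obtain v where v: "v \<in> K" "v \<noteq> \<one>" "v \<notin> R" by blast
        obtain f' where f': "f' \<in> K" "adj v f'" using partner v by blast
        \<comment> \<open>If f' is a root, the form has the value 0 + 1 + 1 = 0 at v + f'.\<close>
        define f where "f = (if f' \<in> R then v \<otimes> f' else f')"
        have f: "f \<in> K" "adj v f" "f \<notin> R"
          using f' v subgroup.m_closed[OF K(1) v(1) f'(1)] quadratic[of v f'] Kc
          by (auto simp: f_def)
        have fv: "adj f v" using f(2) adj_sym[of f v] Kc f v by blast
        note plane = K(1) fin K(2) f(1) sq2[OF f(1)] v(1) sq2[OF v(1)] prim[OF fv v(1) f(1)]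
        have "card (perp K f v) > 0"
          using perp_subgroup[OF plane] fin by (metis (lifting) card_gt_0_iff finite_subset mem_Collect_eq perp_def subgroup_def subsetI empty_iff)
        hence "card (perp K f v) < card K"
          using card_perp[OF plane] by simp
        then obtain k es fs c where IH: "symplectic_basis (perp K f v) (replicate k 2) es fs"
          "\<And>t. t < k \<Longrightarrow> (es t \<in> R \<longleftrightarrow> c \<and> t = 0) \<and> (fs t \<in> R \<longleftrightarrow> c \<and> t = 0)"
          using less.hyps[OF _ perp_subgroup[OF plane] perp_nonsingular[OF plane]] by blast
        \<comment> \<open>Over an empty basis of the complement the flag \<open>c\<close> is
          arbitrary and has to be cleared, because the new plane then has index 0 and its basis
          vectors are nonroots.\<close>
        define c' where "c' = (c \<and> k > 0)"
        have "((es(k := v)) t \<in> R \<longleftrightarrow> c' \<and> t = 0) \<and> ((fs(k := f)) t \<in> R \<longleftrightarrow> c' \<and> t = 0)"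
          if "t < Suc k" for t
        proof (cases "t = k")
          case True
          thus ?thesis using v f by (auto simp: c'_def)
        next
          case False
          hence "t < k" using that by simp
          thus ?thesis using IH(2)[of t] False by (auto simp: c'_def)
        qed
        thus ?thesis using snoc[OF v(1) f(1) fv IH(1)] by blast
      next
        case allR: False
        obtain e where e: "e \<in> K" "e \<noteq> \<one>" using False oneK by blast
        obtain f where f: "f \<in> K" "adj e f" using partner e by blast
        have fe: "adj f e" using f(2) adj_sym[of f e] Kc f e by blast
        have f1: "f \<noteq> \<one>" using f Kc e by auto
        have eR: "e \<in> R" "f \<in> R" using allR e f f1 by auto
        \<comment> \<open>A nonzero w in the complement would make w + e a nonzero nonroot.\<close>
        have "perp K f e = {\<one>}"
        proof -
          have "w = \<one>" if w: "w \<in> perp K f e" for w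
          proof (rule ccontr)
            assume w1: "w \<noteq> \<one>"
            have wK: "w \<in> K" "\<not> adj w e" using w by (auto simp: perp_def adj_def)
            hence "w \<in> R" using allR w1 by blast
            hence "w \<otimes> e \<notin> R" using quadratic[of w e] eR wK Kc by auto
            moreover have "w \<noteq> e" using w fe Kc[OF e(1)] adj_sym[of e f] f Kc
              by (auto simp: perp_def adj_def)
            hence "w \<otimes> e \<noteq> \<one>" using mult_eq_one_iff Kc wK e by blast
            ultimately show False
              using allR subgroup.m_closed[OF K(1) wK(1) e(1)] by blast
          qed
          moreover have "\<one> \<in> perp K f e" using oneK Kc e f by (simp add: perp_def)
          ultimately show ?thesis by blast
        qed
        hence "symplectic_basis (perp K f e) (replicate 0 2) (\<lambda>_. \<one>) (\<lambda>_. \<one>)"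
          using symplectic_basis_empty by simp
        hence "symplectic_basis K (replicate (Suc 0) 2) ((\<lambda>_. \<one>)(0 := e)) ((\<lambda>_. \<one>)(0 := f))"
          using snoc[OF e(1) f(1) fe] by blast
        moreover have "(((\<lambda>_. \<one>)(0 := e)) t \<in> R \<longleftrightarrow> True \<and> t = 0) \<and> (((\<lambda>_. \<one>)(0 := f)) t \<in> R \<longleftrightarrow> True \<and> t = 0)"
          if "t < Suc 0" for t
          using that eR by simp
        ultimately show ?thesis by blast
      qed
    qed
  qed
  thus thesis using that by blast
qed

text \<open>The form is additive over orthogonal planes, so it is the sum of the contributions of
  the planes. The bound 16 = 4^2 leaves k at least 3.\<close>

lemma type_III_or_V:
  assumes "16 < card (carrier G)"
  obtains k where "k \<ge> 3" "of_type (TypeIII k) G \<beta> R \<or> of_type (TypeV k) G \<beta> R"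
proof -
  have "nonsingular_on (carrier G)"
    using nonsingular unfolding nonsingular_on_def nonsingular_def Rad_def by blast
  then obtain k e f c where basis: "symplectic_basis (carrier G) (replicate k 2) e f"
    and q: "\<And>t. t < k \<Longrightarrow> (e t \<in> R \<longleftrightarrow> c \<and> t = 0) \<and> (f t \<in> R \<longleftrightarrow> c \<and> t = 0)"
    using quadratic_basis_exists[OF subgroup_self] by blast
  have "card (carrier G) = 4 ^ k"
    using basis by (simp add: symplectic_basis_def)
  hence "(4::nat) ^ 2 < 4 ^ k" using assms by simp
  hence k: "k \<ge> 3" using power_less_imp_less_exp[of "4::nat" 2 k] by simp
  define x y :: "nat \<Rightarrow> (nat \<Rightarrow> int) \<Rightarrow> int" where "x = (\<lambda>t a. a (2*t+1))" and "y = (\<lambda>t a. a (2*t+2))"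
  let ?M = "Z2n (2*k)"
  have cM: "card (carrier ?M) = (\<Prod>t<length (replicate k 2). replicate k 2 ! t * replicate k 2 ! t)"
    by (simp add: card_Z2n power_mult)
  have hx: "x t \<in> hom ?M (integer_mod_group (replicate k 2 ! t))"
    and hy: "y t \<in> hom ?M (integer_mod_group (replicate k 2 ! t))" if "t < length (replicate k (2::nat))" for t
    using that Z2n_entry_hom[of "2*t+1" "2*k"] Z2n_entry_hom[of "2*t+2" "2*k"] by (simp_all add: x_def y_def)
  have inj: "a = b" if ab: "a \<in> carrier ?M" "b \<in> carrier ?M"
      and eq: "\<And>t. t < length (replicate k (2::nat)) \<Longrightarrow> x t a = x t b \<and> y t a = y t b" for a b
  proof (rule Z2n_ext[OF ab])
    fix i assume i: "1 \<le> i" "i \<le> 2*k"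
    define t where "t = (i - 1) div 2"
    have "t < k" "i = 2*t+1 \<or> i = 2*t+2" using i by (auto simp: t_def)
    thus "a i = b i" using eq[of t] by (auto simp: x_def y_def)
  qed
  note ctx = basis finite_carrier group_Z2n finite_Z2n cM hx hy inj
  define h where "h = coord_map (replicate k 2) e f x y"
  have iso: "h \<in> iso ?M G"
    unfolding h_def by (rule coord_map_iso[OF ctx])
  have ef: "e t \<in> carrier G" "f t \<in> carrier G" "\<beta> (f t) (e t) = -1" if "t < k" for t
    using basis that by (auto simp: symplectic_basis_def primitive_root_2)
  have orth: "\<not> adj (e s) (e t)" "\<not> adj (e s) (f t)" "\<not> adj (f s) (e t)" "\<not> adj (f s) (f t)"
    if "s < k" "t < k" "s \<noteq> t" for s t
    using basis that by (auto simp: symplectic_basis_def adj_def)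
  have bich: "\<beta> (h a) (h b) = symplectic_bichar k a b" if "a \<in> carrier ?M" "b \<in> carrier ?M" for a b
  proof -
    have "\<beta> (h a) (h b) =
        (\<Prod>t<length (replicate k (2::nat)). \<beta> (f t) (e t) powi (y t a * x t b - x t a * y t b))"
      unfolding h_def by (rule bichar_coord_map[OF ctx that])
    also have "\<dots> = (\<Prod>t<k. (-1) powi (y t a * x t b - x t a * y t b))"
      by (rule prod.cong) (simp_all add: ef(3))
    also have "\<dots> = symplectic_bichar k a b"
      by (simp add: minus_one_powi_sum symplectic_bichar_alt x_def y_def)
    finally show ?thesis .
  qed
  have roots: "h a \<in> R \<longleftrightarrow> odd (\<Sum>t<k. (if c \<and> t = 0 then (x t a)\<^sup>2 + (y t a)\<^sup>2 else 0) + x t a * y t a)"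
    if a: "a \<in> carrier ?M" for a
  proof -
    define g where "g t = e t [^] x t a \<otimes> f t [^] y t a" for t
    have gc: "g t \<in> carrier G" if "t < k" for t using ef[OF that] by (simp add: g_def)
    have xy: "x t a = 0 \<or> x t a = 1" "y t a = 0 \<or> y t a = 1" if "t < k" for t
      using Z2n_entry[OF a, of "2*t+1"] Z2n_entry[OF a, of "2*t+2"] that by (auto simp: x_def y_def)
    define w where "w t = (if c \<and> t = 0 then (x t a)\<^sup>2 + (y t a)\<^sup>2 else 0) + x t a * y t a" for t
    have gR: "g t \<in> R \<longleftrightarrow> odd (w t)"
      if "t < k" for t
    proof -
      \<comment> \<open>e t and f t are adjacent and are either both roots or both nonroots, so the
        form is 1 at their sum.\<close>
      have "e t \<otimes> f t \<in> R"
        using quadratic[OF ef(1,2)[OF that]] q[OF that] ef[OF that] adj_sym[of "e t" "f t"]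
        by (auto simp: adj_def)
      thus ?thesis
        using xy[OF that] q[OF that] ef[OF that] by (cases "c \<and> t = 0") (auto simp: g_def w_def)
    qed
    have go: "\<not> adj (g s) (g t)" if "s < k" "t < k" "s \<noteq> t" for s t
      using xy[OF that(1)] xy[OF that(2)] ef[OF that(1)] ef[OF that(2)] orth[OF that]
      by (elim disjE) (simp_all add: g_def)
    have "finprod G g {..<m} \<in> R \<longleftrightarrow>
        odd (\<Sum>t<m. w t)"
      if "m \<le> k" for m
      using that
    proof (induction m)
      case (Suc m)
      have fc: "finprod G g {..<m} \<in> carrier G" using gc Suc by (intro finprod_closed) auto
      have "\<beta> (g m) (finprod G g {..<m}) = (\<Prod>t<m. \<beta> (g m) (g t))"
        using gc Suc by (intro bichar_finprod_right) auto
      also have "\<dots> = 1"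
        using go[of m] Suc by (intro prod.neutral) (auto simp: adj_def)
      finally have "\<not> adj (g m) (finprod G g {..<m})" by (simp add: adj_def)
      moreover have "finprod G g {..<Suc m} = g m \<otimes> finprod G g {..<m}"
        unfolding lessThan_Suc using gc Suc by (intro finprod_insert) auto
      ultimately have "finprod G g {..<Suc m} \<in> R \<longleftrightarrow> (g m \<in> R) \<noteq> (finprod G g {..<m} \<in> R)"
        using quadratic[OF gc[of m] fc] Suc by simp
      also have "finprod G g {..<m} \<in> R \<longleftrightarrow>
          odd (\<Sum>t<m. w t)"
        using Suc by simp
      finally show ?case using gR[of m] Suc by auto
    qed simp
    thus ?thesis unfolding h_def coord_map_def g_def w_def by simp
  qed
  have img: "h ` S = R" if "S = {a \<in> carrier ?M. h a \<in> R}" for S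
  proof -
    have "h ` carrier ?M = carrier G" using iso by (simp add: iso_def bij_betw_def)
    hence "R \<subseteq> h ` carrier ?M" using FRS0_subset by blast
    thus ?thesis unfolding that by blast
  qed
  have val: "(\<Sum>t<k. (if c \<and> t = 0 then (x t a)\<^sup>2 + (y t a)\<^sup>2 else 0) + x t a * y t a) = quadratic_value c k a" for a
    using k by (simp add: quadratic_value_def sum.distrib x_def y_def numeral_2_eq_2)
  have "quadratic_roots c k = {a \<in> carrier ?M. h a \<in> R}"
    using roots unfolding val by (auto simp: quadratic_roots_def)
  hence iso': "frs_isomorphic G \<beta> R ?M (symplectic_bichar k) (quadratic_roots c k)"
    using img[of "quadratic_roots c k"] bich by (intro frs_isomorphicI[OF group_Z2n iso]) auto
  have "of_type (TypeIII k) G \<beta> R \<or> of_type (TypeV k) G \<beta> R"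
    using iso' k by (cases c) (simp_all add: quadratic_roots_III_V)
  thus thesis using that k by blast
qed

end
end

section \<open>The types II and IV\<close>

lemma Z2n_gen_carrier [simp]: "Z2n_gen n i \<in> carrier (Z2n n)"
  by (auto simp: Z2n_gen_def carrier_Z2n)

definition II_root :: "nat \<Rightarrow> nat \<Rightarrow> nat \<Rightarrow> nat \<Rightarrow> int" where
  "II_root n i j = Z2n_gen n i \<otimes>\<^bsub>Z2n n\<^esub> Z2n_gen n j"

lemma II_root_carrier [simp]: "II_root n i j \<in> carrier (Z2n n)"
  unfolding II_root_def by (intro monoid.m_closed group.is_monoid group_Z2n) simp_all

lemma II_root_entry:
  assumes "1 \<le> l" "l \<le> n" "i \<noteq> j"
  shows "II_root n i j l = (if l = i then 1 else 0) + (if l = j then 1 else 0)"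
  using assms by (simp add: II_root_def mult_Z2n) (simp add: Z2n_gen_def)

lemma II_roots_alt: "II_roots n = {II_root n i j | i j. 1 \<le> i \<and> i < j \<and> j \<le> n}"
  by (simp add: II_roots_def II_root_def)

lemma II_root_sym: "II_root n i j = II_root n j i"
proof (rule Z2n_ext[where n = n])
  show "II_root n i j l = II_root n j i l" if "1 \<le> l" "l \<le> n" for l
    using that by (simp add: II_root_def mult_Z2n add.commute)
qed simp_all

lemma II_root_in_roots: "1 \<le> i \<Longrightarrow> i \<le> n \<Longrightarrow> 1 \<le> j \<Longrightarrow> j \<le> n \<Longrightarrow> i \<noteq> j \<Longrightarrow> II_root n i j \<in> II_roots n"
proof -
  assume *: "1 \<le> i" "i \<le> n" "1 \<le> j" "j \<le> n" "i \<noteq> j"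
  show ?thesis
  proof (cases "i < j")
    case True
    thus ?thesis unfolding II_roots_alt using * by blast
  next
    case False
    hence "j < i" using * by simp
    hence "II_root n j i \<in> II_roots n" unfolding II_roots_alt using * by blast
    thus ?thesis using II_root_sym[of n i j] by simp
  qed
qed

lemma II_roots_carrier: "II_roots n \<subseteq> carrier (Z2n n)"
  by (auto simp: II_roots_alt)

lemma group_II_group: "group (II_group n)"
  unfolding II_group_def by (rule group.group_subgroup_generated[OF group_Z2n])

lemma carrier_II_group: "carrier (II_group n) = generate (Z2n n) (II_roots n)"
  using II_roots_carrier[of n] by (simp add: II_group_def carrier_subgroup_generated Int_absorb1)

lemma II_group_subset: "carrier (II_group n) \<subseteq> carrier (Z2n n)"
  unfolding carrier_II_group by (rule group.generate_incl[OF group_Z2n II_roots_carrier])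

lemma II_roots_subset: "II_roots n \<subseteq> carrier (II_group n)"
  unfolding carrier_II_group by (auto intro: generate.incl)

lemma mult_II_group [simp]: "(\<otimes>\<^bsub>II_group n\<^esub>) = (\<otimes>\<^bsub>Z2n n\<^esub>)"
  by (simp add: II_group_def)

lemma one_II_group [simp]: "\<one>\<^bsub>II_group n\<^esub> = \<one>\<^bsub>Z2n n\<^esub>"
  by (simp add: II_group_def)

lemma sum_II_root:
  assumes "1 \<le> i" "i \<le> n" "1 \<le> j" "j \<le> n" "i \<noteq> j"
  shows "(\<Sum>l=1..n. II_root n i j l) = 2" "(\<Sum>l=1..n. a l * II_root n i j l) = a i + a j"
proof -
  have "(\<Sum>l=1..n. II_root n i j l) = (\<Sum>l=1..n. (if l = i then 1 else 0) + (if l = j then 1 else 0))"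
    using assms by (intro sum.cong) (simp_all add: II_root_entry)
  thus "(\<Sum>l=1..n. II_root n i j l) = 2"
    using assms by (simp add: sum.distrib)
  have "(\<Sum>l=1..n. a l * II_root n i j l) = (\<Sum>l=1..n. (if l = i then a l else 0) + (if l = j then a l else 0))"
    using assms by (intro sum.cong) (simp_all add: II_root_entry)
  thus "(\<Sum>l=1..n. a l * II_root n i j l) = a i + a j"
    using assms by (simp add: sum.distrib)
qed

lemma even_sum_mult_Z2n:
  "even (\<Sum>i=1..n. (a \<otimes>\<^bsub>Z2n n\<^esub> b) i) \<longleftrightarrow> even ((\<Sum>i=1..n. a i) + (\<Sum>i=1..n. b i))"
proof -
  have "(\<Sum>i=1..n. (a \<otimes>\<^bsub>Z2n n\<^esub> b) i) mod 2 = (\<Sum>i=1..n. (a i + b i) mod 2) mod 2"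
    by (rule arg_cong[where f = "\<lambda>x. x mod 2"], rule sum.cong) (simp_all add: mult_Z2n)
  also have "\<dots> = ((\<Sum>i=1..n. a i) + (\<Sum>i=1..n. b i)) mod 2"
    by (simp add: mod_sum_eq sum.distrib)
  finally show ?thesis by (simp only: even_iff_mod_2_eq_zero)
qed

lemma II_group_even:
  assumes "a \<in> carrier (II_group n)" shows "even (\<Sum>i=1..n. a i)"
  using assms unfolding carrier_II_group
proof (induction rule: generate.induct)
  case one
  have "(\<Sum>i=1..n. \<one>\<^bsub>Z2n n\<^esub> i) = 0" by (intro sum.neutral) (simp add: one_Z2n)
  thus ?case by simp
next
  case (incl h)
  then obtain i j where "h = II_root n i j" "1 \<le> i" "i < j" "j \<le> n" by (auto simp: II_roots_alt)
  thus ?case using sum_II_root(1)[of i n j] by simp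
next
  case (inv h)
  then obtain i j where "h = II_root n i j" "1 \<le> i" "i < j" "j \<le> n" by (auto simp: II_roots_alt)
  thus ?case using sum_II_root(1)[of i n j] inv_Z2n[of h n] by simp
next
  case (eng h1 h2)
  thus ?case using even_sum_mult_Z2n[of n h1 h2] by simp
qed

lemma II_bichar_root:
  assumes "1 \<le> i" "i \<le> n" "1 \<le> j" "j \<le> n" "i \<noteq> j"
  shows "II_bichar n a (II_root n i j) = (if even (a i + a j) then 1 else -1)"
  unfolding II_bichar_def sum_II_root[OF assms] minus_one_powi by simp

text \<open>For even weight the product of the two weights disappears modulo 2, and only the scalar
  product remains.\<close>

lemma II_bichar_even:
  assumes "even (\<Sum>i=1..n. a i)"
  shows "II_bichar n a b = (if even (\<Sum>i=1..n. a i * b i) then 1 else -1)"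
  using assms by (simp add: II_bichar_def minus_one_powi)

text \<open>Pairing with e_i + e_j compares the entries i and j. Only the zero vector and the
  all-ones vector can therefore lie in the radical.\<close>

lemma Rad_II_group_const:
  assumes a: "a \<in> Rad (II_group n) (II_bichar n)" and i: "1 \<le> i" "i \<le> n" and j: "1 \<le> j" "j \<le> n"
  shows "a i = a j"
proof (cases "i = j")
  case False
  have "II_root n i j \<in> carrier (II_group n)"
    using II_root_in_roots[of i n j] i j False II_roots_subset by blast
  hence "II_bichar n a (II_root n i j) = 1" using a by (simp add: Rad_def)
  hence ev: "even (a i + a j)"
    using II_bichar_root[of i n j a] i j False by (simp split: if_splits)
  have "a \<in> carrier (Z2n n)" using a II_group_subset by (auto simp: Rad_def)
  thus ?thesis
    using Z2n_entry[of a n i] Z2n_entry[of a n j] i j ev by auto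
qed simp

lemma (in group) inj_on_if_trivial_kernel:
  assumes "group M" "h \<in> hom M G" "\<And>a. a \<in> carrier M \<Longrightarrow> h a = \<one> \<Longrightarrow> a = \<one>\<^bsub>M\<^esub>"
  shows "inj_on h (carrier M)"
proof -
  interpret group_hom M G h
    using assms by (simp add: group_hom_def group_hom_axioms_def is_group)
  show ?thesis
    by (rule trivial_ker_imp_inj) (use assms(3) in \<open>auto simp: kernel_def\<close>)
qed

context elementary_root_system
begin

text \<open>The n = |K| + 1 points correspond to 0 and the members of K: h sends e_1 to 0 and the
  other e_i to the clique, so the e_i + e_j go to the members of K and their sums. As
  \<open>\<beta>\<close> is nonsingular, the kernel of h on even-weight vectors is the radical,
  which is trivial for odd n and divided out for even n.\<close>

lemma type_II_or_IV:
  assumes K: "K \<subseteq> R" "\<And>a b. a \<in> K \<Longrightarrow> b \<in> K \<Longrightarrow> a \<noteq> b \<Longrightarrow> adj a b"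
      "R = K \<union> {a \<otimes> b | a b. a \<in> K \<and> b \<in> K \<and> a \<noteq> b}"
    and card: "card K > 3" "card K \<noteq> 5"
  obtains k where "k \<ge> 2" "of_type (TypeII k) G \<beta> R" | k where "k \<ge> 4" "of_type (TypeIV k) G \<beta> R"
proof -
  define n where "n = card K + 1"
  have "finite K" using card by (simp add: card_ge_0_finite)
  moreover have "card {2..n} = card K" by (simp add: n_def)
  ultimately obtain v where v: "bij_betw v {2..n} K"
    using finite_same_card_bij by blast
  have vK: "v i \<in> K" if "i \<in> {2..n}" for i using v that by (auto simp: bij_betw_def)
  have vc: "v i \<in> carrier G" if "i \<in> {2..n}" for i using vK[OF that] K(1) by auto
  have v_adj: "adj (v i) (v j) \<longleftrightarrow> i \<noteq> j" if "i \<in> {2..n}" "j \<in> {2..n}" for i j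
  proof (cases "i = j")
    case False
    hence "v i \<noteq> v j" using inj_onD[OF bij_betw_imp_inj_on[OF v]] that by blast
    thus ?thesis using K(2)[OF vK[OF that(1)] vK[OF that(2)]] False by simp
  qed (use vc that in simp)
  define h where "h a = finprod G (\<lambda>i. v i [^] (a i :: int)) {2..n}" for a
  have sq2: "x [^] (2::nat) = \<one>" if "x \<in> carrier G" for x
    using that by (simp add: numeral_2_eq_2)
  have h_hom: "h \<in> hom (Z2n n) G"
    unfolding h_def
    by (intro finprod_hom group_Z2n int_pow_hom_mod[of _ 2] Z2n_entry_hom vc sq2) auto
  have h_closed: "h a \<in> carrier G" for a
    unfolding h_def using vc by (intro finprod_closed) auto
  have h_gen: "h (Z2n_gen n i) = (if i = 1 then \<one> else v i)" if "1 \<le> i" "i \<le> n" for i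
  proof -
    have "h (Z2n_gen n i) = finprod G (\<lambda>j. if j = i then v j else \<one>) {2..n}"
      unfolding h_def using vc by (intro finprod_cong) (auto simp: Z2n_gen_def simp_implies_def)
    also have "\<dots> = (if i = 1 then \<one> else v i)"
    proof (cases "i = 1")
      case True
      have "finprod G (\<lambda>j. if j = i then v j else \<one>) {2..n} = finprod G (\<lambda>j. \<one>) {2..n}"
        using True by (intro finprod_cong) (auto simp: simp_implies_def)
      thus ?thesis using True by simp
    next
      case False
      thus ?thesis using that vc by (simp add: finprod_singleton_swap Pi_iff)
    qed
    finally show ?thesis .
  qed
  have h_root: "h (II_root n i j) = h (Z2n_gen n i) \<otimes> h (Z2n_gen n j)" for i j
    unfolding II_root_def using h_hom by (simp add: hom_mult)
  have h_roots: "h ` II_roots n = R"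
  proof
    show "h ` II_roots n \<subseteq> R"
    proof clarify
      fix r assume "r \<in> II_roots n"
      then obtain i j where ij: "r = II_root n i j" "1 \<le> i" "i < j" "j \<le> n" by (auto simp: II_roots_alt)
      have j: "j \<in> {2..n}" using ij by auto
      show "h r \<in> R"
      proof (cases "i = 1")
        case True
        thus ?thesis using ij h_root[of i j] h_gen[of i] h_gen[of j] vc[OF j] vK[OF j] K(1) by auto
      next
        case False
        hence i: "i \<in> {2..n}" using ij by auto
        have "adj (v i) (v j)" using v_adj[OF i j] ij by simp
        hence "v i \<otimes> v j \<in> R" using vK[OF i] vK[OF j] K(1) by (intro adj_closed) auto
        thus ?thesis using ij False h_root[of i j] h_gen[of i] h_gen[of j] by simp
      qed
    qed
    show "R \<subseteq> h ` II_roots n"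
    proof
      fix r assume "r \<in> R"
      then consider "r \<in> K" | a b where "a \<in> K" "b \<in> K" "a \<noteq> b" "r = a \<otimes> b"
        using K(3) by auto
      thus "r \<in> h ` II_roots n"
      proof cases
        case 1
        then obtain i where i: "i \<in> {2..n}" "r = v i" using v by (auto simp: bij_betw_def)
        hence "r = h (II_root n 1 i)" using h_root[of 1 i] h_gen[of 1] h_gen[of i] vc[OF i(1)] by simp
        moreover have "II_root n 1 i \<in> II_roots n" using i by (intro II_root_in_roots) auto
        ultimately show ?thesis by blast
      next
        case 2
        then obtain i j where ij: "i \<in> {2..n}" "a = v i" "j \<in> {2..n}" "b = v j"
          using v by (auto simp: bij_betw_def)
        hence "r = h (II_root n i j)" using 2 h_root[of i j] h_gen[of i] h_gen[of j] by simp
        moreover have "II_root n i j \<in> II_roots n" using ij 2 by (intro II_root_in_roots) auto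
        ultimately show ?thesis by blast
      qed
    qed
  qed
  have bich: "\<beta> (h a) (h b) = II_bichar n a b"
    if a: "a \<in> carrier (II_group n)" and b: "b \<in> carrier (II_group n)" for a b
  proof -
    have "\<beta> (h a) (h b) = (\<Prod>i=2..n. \<beta> (v i) (h b) powi a i)"
      unfolding h_def[of a] using vc h_closed by (subst bichar_finprod_left) auto
    also have "\<dots> = (\<Prod>i=2..n. (-1) powi ((\<Sum>j=2..n. b j) * a i - a i * b i))"
    proof (rule prod.cong)
      fix i assume i: "i \<in> {2..n}"
      have "\<beta> (v i) (h b) = (\<Prod>j=2..n. \<beta> (v i) (v j) powi b j)"
        unfolding h_def using vc i by (subst bichar_finprod_right) auto
      also have "\<dots> = (\<Prod>j=2..n. (-1) powi (b j - (if j = i then b j else 0)))"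
        using v_adj[OF i] vc i by (intro prod.cong) (auto simp: bichar_adj)
      also have "\<dots> = (-1) powi ((\<Sum>j=2..n. b j) - b i)"
        using i by (simp add: minus_one_powi_sum sum_subtractf)
      finally show "\<beta> (v i) (h b) powi a i = (-1) powi ((\<Sum>j=2..n. b j) * a i - a i * b i)"
        by (simp add: algebra_simps flip: power_int_mult)
    qed simp
    also have "\<dots> = (-1) powi ((\<Sum>j=2..n. b j) * (\<Sum>i=2..n. a i) - (\<Sum>i=2..n. a i * b i))"
      by (simp add: minus_one_powi_sum sum_subtractf sum_distrib_left)
    also have "\<dots> = II_bichar n a b"
    proof -
      have split: "(\<Sum>i=1..n. g i) = g 1 + (\<Sum>i=2..n. g i)" for g :: "nat \<Rightarrow> int"
        using sum.atLeast_Suc_atMost[of 1 n g] by (simp add: n_def numeral_2_eq_2)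
      \<comment> \<open>Entry 1 does not enter h. Even weight fixes its parity by the other entries,
        and this accounts for the product of the two sums.\<close>
      have "even (a 1 + (\<Sum>i=2..n. a i))" "even (b 1 + (\<Sum>i=2..n. b i))"
        using II_group_even[OF a] II_group_even[OF b] by (simp_all only: split)
      thus ?thesis
        unfolding II_bichar_def minus_one_powi split by auto
    qed
    finally show ?thesis .
  qed
  have h_hom': "h \<in> hom (II_group n) G"
    using h_hom II_group_subset[of n] by (auto simp: hom_def Pi_iff subset_iff)
  interpret h: group_hom "II_group n" G h
    using h_hom' group_II_group by (simp add: group_hom_def group_hom_axioms_def is_group)
  have surj: "h ` carrier (II_group n) = carrier G"
  proof
    have "R \<subseteq> h ` carrier (II_group n)"
      unfolding h_roots[symmetric] using II_roots_subset by blast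
    hence "generate G R \<subseteq> h ` carrier (II_group n)"
      by (intro generate_subgroup_incl h.img_is_subgroup)
    thus "carrier G \<subseteq> h ` carrier (II_group n)" using FRS0_generates by simp
  qed (use h_closed in auto)
  have ker: "kernel (II_group n) G h = Rad (II_group n) (II_bichar n)"
  proof (intro equalityI subsetI)
    fix a assume "a \<in> kernel (II_group n) G h"
    hence a: "a \<in> carrier (II_group n)" "h a = \<one>" by (auto simp: kernel_def)
    thus "a \<in> Rad (II_group n) (II_bichar n)"
      using bich[OF a(1), symmetric] h_closed by (simp add: Rad_def)
  next
    fix a assume "a \<in> Rad (II_group n) (II_bichar n)"
    hence a: "a \<in> carrier (II_group n)" "\<And>b. b \<in> carrier (II_group n) \<Longrightarrow> \<beta> (h a) (h b) = 1"
      using bich by (auto simp: Rad_def)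
    have "\<beta> (h a) x = 1" if "x \<in> R" for x
    proof -
      have "x \<in> h ` carrier (II_group n)" using that surj by auto
      thus ?thesis using a(2) by blast
    qed
    hence "h a = \<one>" by (rule eq_one_if_orthogonal_roots[OF h_closed])
    thus "a \<in> kernel (II_group n) G h" using a by (simp add: kernel_def)
  qed
  show thesis
  proof (cases "odd n")
    case True
    have "inj_on h (carrier (II_group n))"
    proof (rule inj_on_if_trivial_kernel[OF group_II_group h_hom'])
      fix a assume a: "a \<in> carrier (II_group n)" "h a = \<one>"
      hence "a \<in> Rad (II_group n) (II_bichar n)" unfolding ker[symmetric] by (simp add: kernel_def)
      hence const: "a i = a 1" if "1 \<le> i" "i \<le> n" for i
        using Rad_II_group_const[of a n i 1] that by (simp add: n_def)
      have "(\<Sum>i=1..n. a i) = (\<Sum>i=1..n. a 1)"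
      proof (rule sum.cong)
        fix i assume "i \<in> {1..n}"
        thus "a i = a 1" using const[of i] by simp
      qed simp
      hence "even (int n * a 1)" using II_group_even[OF a(1)] by simp
      hence "even (a 1)" using True by simp
      have aZ: "a \<in> carrier (Z2n n)" using a II_group_subset by blast
      hence a1: "a 1 = 0" using Z2n_entry[OF aZ, of 1] \<open>even (a 1)\<close> by (auto simp: n_def)
      have "a = \<one>\<^bsub>Z2n n\<^esub>"
      proof (rule Z2n_ext[OF aZ])
        show "a i = \<one>\<^bsub>Z2n n\<^esub> i" if "1 \<le> i" "i \<le> n" for i
          using const[OF that] a1 one_Z2n[OF that] by simp
      qed (simp add: group.is_monoid[OF group_Z2n] monoid.one_closed)
      thus "a = \<one>\<^bsub>II_group n\<^esub>" by simp
    qed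
    hence iso: "h \<in> iso (II_group n) G" using h_hom' surj by (simp add: iso_def bij_betw_def)
    define k where "k = n div 2"
    have n: "n = 2*k + 1" using True by (simp add: k_def)
    have "k \<ge> 2" using card n by (simp add: n_def)
    moreover have "frs_isomorphic G \<beta> R (II_group n) (II_bichar n) (II_roots n)"
      by (rule frs_isomorphicI[OF group_II_group iso]) (use bich h_roots II_roots_subset in auto)
    ultimately show thesis using that(1)[of k] by (simp add: n)
  next
    case False
    define k where "k = n div 2"
    have n: "n = 2*k" using False by (simp add: k_def)
    \<comment> \<open>For even n the clique has odd size; greater than 3 and different from 5 it has
      at least 7 members, so n is at least 8.\<close>
    have k: "k \<ge> 4" using card n unfolding n_def by presburger
    define H where "H = (\<lambda>A. the_elem (h ` A))"
    have iso: "H \<in> iso (IV_group n) G"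
      unfolding H_def IV_group_def ker[symmetric] by (rule h.FactGroup_iso_set[OF surj])
    have nrm: "kernel (II_group n) G h \<lhd> II_group n" by (rule h.normal_kernel)
    have grp: "group (IV_group n)"
      unfolding IV_group_def ker[symmetric] by (rule normal.factorgroup_is_group[OF nrm])
    define co where "co a = Rad (II_group n) (II_bichar n) #>\<^bsub>II_group n\<^esub> a" for a
    have coset: "h ` co a = {h a}" "co a \<subseteq> carrier (II_group n)" "a \<in> co a" if a: "a \<in> carrier (II_group n)" for a
    proof -
      have sub: "subgroup (kernel (II_group n) G h) (II_group n)" by (rule h.subgroup_kernel)
      show "co a \<subseteq> carrier (II_group n)" unfolding co_def ker[symmetric]
        using a subgroup.subset[OF sub] by (intro h.r_coset_subset_G) auto
      show aco: "a \<in> co a" unfolding co_def ker[symmetric] using h.rcos_self[OF a sub] .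
      have "h b = h a" if "b \<in> co a" for b
      proof -
        obtain z where "z \<in> kernel (II_group n) G h" "b = z \<otimes>\<^bsub>II_group n\<^esub> a"
          using \<open>b \<in> co a\<close> unfolding co_def ker[symmetric] r_coset_def by auto
        thus ?thesis using h.hom_mult[of z a] a h_closed by (simp add: kernel_def)
      qed
      thus "h ` co a = {h a}" using aco by blast
    qed
    have Hco: "H (co a) = h a" if "a \<in> carrier (II_group n)" for a
      using coset(1)[OF that] by (simp add: H_def)
    have carr: "carrier (IV_group n) = co ` carrier (II_group n)"
      unfolding IV_group_def FactGroup_def RCOSETS_def co_def by (simp add: UNION_singleton_eq_range)
    have "frs_isomorphic G \<beta> R (IV_group n) (IV_bichar n) (IV_roots n)"
    proof (rule frs_isomorphicI[OF grp iso])
      fix A B assume "A \<in> carrier (IV_group n)" "B \<in> carrier (IV_group n)"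
      then obtain a b where ab: "a \<in> carrier (II_group n)" "A = co a" "b \<in> carrier (II_group n)" "B = co b"
        unfolding carr by blast
      have "(\<lambda>(a, b). II_bichar n a b) ` (A \<times> B) = {\<beta> (h a) (h b)}"
      proof -
        have "II_bichar n x y = \<beta> (h a) (h b)" if "x \<in> co a" "y \<in> co b" for x y
        proof -
          have "h x = h a" "h y = h b" using coset(1)[OF ab(1)] coset(1)[OF ab(3)] that by blast+
          moreover have "x \<in> carrier (II_group n)" "y \<in> carrier (II_group n)"
            using coset(2) ab that by blast+
          ultimately show ?thesis using bich[of x y] by simp
        qed
        hence "(\<lambda>(a, b). II_bichar n a b) ` (A \<times> B) = (\<lambda>_. \<beta> (h a) (h b)) ` (A \<times> B)"
          using ab by (intro image_cong) auto
        moreover have "(a, b) \<in> A \<times> B" using coset(3) ab by simp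
        ultimately show ?thesis by (simp only: image_constant)
      qed
      thus "\<beta> (H A) (H B) = IV_bichar n A B"
        using Hco ab by (simp add: IV_bichar_def)
    next
      have "IV_roots n = co ` II_roots n" by (simp add: IV_roots_def co_def)
      moreover have "H (co r) = h r" if "r \<in> II_roots n" for r
        using Hco II_roots_subset that by blast
      ultimately show "H ` IV_roots n = R"
        using h_roots by (simp add: image_image)
      show "IV_roots n \<subseteq> carrier (IV_group n)"
        using II_roots_subset unfolding \<open>IV_roots n = co ` II_roots n\<close> carr by blast
    qed
    thus thesis using that(2)[of k] k by (simp add: n)
  qed
qed

end

section \<open>Characters of finite abelian groups\<close>

text \<open>By minimality of m a multiple of g lies in H only if m divides the factor, and there
  \<open>w\<close> agrees with \<open>\<chi>\<close>. The value \<open>w\<close> is left free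
  because separation of elements needs a nontrivial choice.\<close>

lemma (in comm_group) extend_character:
  assumes H: "subgroup H G" and \<chi>: "\<chi> \<in> hom (G\<lparr>carrier := H\<rparr>) Cstar"
    and g: "g \<in> carrier G" and m: "m > 0" "g [^] (m::nat) \<in> H"
    and least: "\<And>i::nat. 0 < i \<Longrightarrow> i < m \<Longrightarrow> g [^] i \<notin> H"
    and w: "w ^ m = \<chi> (g [^] m)"
  obtains H' \<chi>' where "subgroup H' G" "insert g H \<subseteq> H'" "\<chi>' \<in> hom (G\<lparr>carrier := H'\<rparr>) Cstar"
    "\<And>h. h \<in> H \<Longrightarrow> \<chi>' h = \<chi> h" "\<chi>' g = w"
proof -
  have Hc: "h \<in> carrier G" if "h \<in> H" for h using subgroup.mem_carrier[OF H that] .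
  have \<chi>m: "\<chi> (x \<otimes> y) = \<chi> x * \<chi> y" if "x \<in> H" "y \<in> H" for x y
    using \<chi> that by (simp add: hom_def Cstar_def)
  have \<chi>0: "\<chi> x \<noteq> 0" if "x \<in> H" for x
    using \<chi> that by (auto simp: hom_def Cstar_def Pi_iff)
  have one: "\<one> \<in> H" using subgroup.one_closed[OF H] .
  have \<chi>1: "\<chi> \<one> = 1" using \<chi>m[OF one one] \<chi>0[OF one] by simp
  have w0: "w \<noteq> 0" using w \<chi>0[OF m(2)] m(1) by (auto simp: power_0_left)
  have pow: "\<chi> ((g [^] m) [^] (q::nat)) = w ^ (m * q)" for q
  proof (induction q)
    case (Suc q)
    have "(g [^] m) [^] q \<in> H" by (rule subgroup_pow_closed[OF H m(2)])
    thus ?case using Suc \<chi>m[OF _ m(2)] by (simp add: w[symmetric] power_add)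
  qed (simp add: \<chi>1)
  have key: "\<chi> (g [^] i) = w ^ i" if "g [^] i \<in> H" for i :: nat
  proof -
    have dec: "g [^] i = (g [^] m) [^] (i div m) \<otimes> g [^] (i mod m)"
      using g by (simp add: nat_pow_pow nat_pow_mult)
    have mq: "(g [^] m) [^] (i div m) \<in> H" by (rule subgroup_pow_closed[OF H m(2)])
    have "g [^] (i mod m) = inv ((g [^] m) [^] (i div m)) \<otimes> g [^] i"
      unfolding dec using g by (simp add: m_assoc[symmetric])
    hence "g [^] (i mod m) \<in> H"
      using subgroup.m_closed[OF H subgroup.m_inv_closed[OF H mq] that] by simp
    hence "i mod m = 0" using least[of "i mod m"] m by auto
    hence "m * (i div m) = i" by auto
    thus ?thesis using pow[of "i div m"] g by (simp add: nat_pow_pow)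
  qed
  have uniq: "\<chi> h * w ^ i = \<chi> h' * w ^ j"
    if "h \<in> H" "h' \<in> H" and eq: "h \<otimes> g [^] i = h' \<otimes> g [^] j" for h h' and i j :: nat
  proof -
    have *: "\<chi> h * w ^ i = \<chi> h' * w ^ j"
      if "h \<in> H" "h' \<in> H" "j \<le> i" and eq: "h \<otimes> g [^] i = h' \<otimes> g [^] j" for h h' and i j :: nat
    proof -
      have c: "h \<in> carrier G" "h' \<in> carrier G" using Hc that by auto
      have "h \<otimes> g [^] (i - j) \<otimes> g [^] j = h' \<otimes> g [^] j"
        using eq c g \<open>j \<le> i\<close> by (simp add: m_assoc nat_pow_mult)
      hence hh: "h \<otimes> g [^] (i - j) = h'" using c g by simp
      hence "g [^] (i - j) = inv h \<otimes> h'" using c g by (auto simp: m_assoc[symmetric])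
      hence gH: "g [^] (i - j) \<in> H"
        using subgroup.m_closed[OF H subgroup.m_inv_closed[OF H \<open>h \<in> H\<close>] \<open>h' \<in> H\<close>] by simp
      have "\<chi> h' = \<chi> h * w ^ (i - j)"
        using \<chi>m[OF \<open>h \<in> H\<close> gH] key[OF gH] hh by simp
      thus ?thesis using \<open>j \<le> i\<close> by (simp add: mult.assoc flip: power_add)
    qed
    show ?thesis
      using *[of h h' j i] *[of h' h i j] that by (cases "j \<le> i") auto
  qed
  define H' where "H' = {h \<otimes> g [^] i | h (i::nat). h \<in> H}"
  \<comment> \<open>The choice is harmless: \<open>uniq\<close> shows that all representations of x
    give the same value.\<close>
  define \<chi>' where "\<chi>' x = (SOME z. \<exists>h (i::nat). h \<in> H \<and> x = h \<otimes> g [^] i \<and> z = \<chi> h * w ^ i)" for x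
  have \<chi>': "\<chi>' (h \<otimes> g [^] i) = \<chi> h * w ^ i" if "h \<in> H" for h and i :: nat
    unfolding \<chi>'_def
  proof (rule some_equality)
    fix z assume "\<exists>h' j. h' \<in> H \<and> h \<otimes> g [^] i = h' \<otimes> g [^] (j::nat) \<and> z = \<chi> h' * w ^ j"
    thus "z = \<chi> h * w ^ i" using uniq[OF that] by auto
  qed (use that in auto)
  have H'I: "h \<otimes> g [^] i \<in> H'" if "h \<in> H" for h and i :: nat
    using that by (auto simp: H'_def)
  have H'c: "H' \<subseteq> carrier G" using Hc g by (auto simp: H'_def)
  have prod: "(h \<otimes> g [^] i) \<otimes> (h' \<otimes> g [^] j) = (h \<otimes> h') \<otimes> g [^] (i + j)"
    if "h \<in> H" "h' \<in> H" for h h' and i j :: nat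
    using Hc[OF that(1)] Hc[OF that(2)] g by (simp add: m_ac flip: nat_pow_mult)
  have H': "subgroup H' G"
  proof (rule subgroupI[OF H'c])
    show "H' \<noteq> {}" using H'I[OF one] by blast
    fix x assume "x \<in> H'"
    then obtain h i where x: "x = h \<otimes> g [^] (i::nat)" "h \<in> H" by (auto simp: H'_def)
    \<comment> \<open>Elements of \<open>H'\<close> carry natural exponents, so -g is rewritten as
      -(mg) + (m - 1)g with mg in H.\<close>
    have inv_x: "inv x = (inv h \<otimes> inv ((g [^] m) [^] i)) \<otimes> g [^] ((m - 1) * i)"
    proof (rule inv_equality)
      have "g [^] ((m - 1) * i) \<otimes> g [^] i = (g [^] m) [^] i"
      proof -
        have "(m - 1) * i + i = m * i" using m(1) by (cases m) auto
        thus ?thesis using g by (simp add: nat_pow_mult nat_pow_pow)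
      qed
      moreover have "a \<otimes> b \<otimes> q \<otimes> (h \<otimes> s) = (a \<otimes> h) \<otimes> (b \<otimes> (q \<otimes> s))"
        if "a \<in> carrier G" "b \<in> carrier G" "q \<in> carrier G" "s \<in> carrier G" for a b q s
        using that Hc[OF x(2)] by (simp add: m_ac)
      ultimately show "inv h \<otimes> inv ((g [^] m) [^] i) \<otimes> g [^] ((m - 1) * i) \<otimes> x = \<one>"
        using Hc[OF x(2)] g x(1) by simp
    qed (use x Hc[OF x(2)] g in auto)
    have "inv h \<otimes> inv ((g [^] m) [^] i) \<in> H"
      by (intro subgroup.m_closed[OF H] subgroup.m_inv_closed[OF H] x subgroup_pow_closed[OF H] m)
    thus "inv x \<in> H'" unfolding inv_x by (rule H'I)
    fix y assume "y \<in> H'"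
    then obtain h' j where y: "y = h' \<otimes> g [^] (j::nat)" "h' \<in> H" by (auto simp: H'_def)
    show "x \<otimes> y \<in> H'"
      using H'I[OF subgroup.m_closed[OF H x(2) y(2)]] prod[OF x(2) y(2)] x y by simp
  qed
  have "\<chi>' \<in> hom (G\<lparr>carrier := H'\<rparr>) Cstar"
  proof (rule homI)
    fix x assume "x \<in> carrier (G\<lparr>carrier := H'\<rparr>)"
    then obtain h i where x: "x = h \<otimes> g [^] (i::nat)" "h \<in> H" by (auto simp: H'_def)
    show "\<chi>' x \<in> carrier Cstar" using \<chi>'[OF x(2)] \<chi>0[OF x(2)] w0 x by (simp add: Cstar_def)
    fix y assume "y \<in> carrier (G\<lparr>carrier := H'\<rparr>)"
    then obtain h' j where y: "y = h' \<otimes> g [^] (j::nat)" "h' \<in> H" by (auto simp: H'_def)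
    show "\<chi>' (x \<otimes>\<^bsub>G\<lparr>carrier := H'\<rparr>\<^esub> y) = \<chi>' x \<otimes>\<^bsub>Cstar\<^esub> \<chi>' y"
      using \<chi>'[OF x(2)] \<chi>'[OF y(2)] \<chi>'[OF subgroup.m_closed[OF H x(2) y(2)]] prod[OF x(2) y(2)]
        \<chi>m[OF x(2) y(2)] x y by (simp add: Cstar_def power_add)
  qed
  moreover have "\<chi>' h = \<chi> h" if "h \<in> H" for h
    using \<chi>'[OF that, of 0] Hc[OF that] by simp
  moreover have "\<chi>' g = w" using \<chi>'[OF one, of 1] g \<chi>1 by simp
  moreover have "insert g H \<subseteq> H'"
    using H'I[OF one, of 1] H'I[of _ 0] Hc g by auto
  ultimately show thesis using that H' by blast
qed

lemma (in comm_group) least_power_in_subgroup: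
  assumes "finite (carrier G)" "subgroup H G" "g \<in> carrier G"
  obtains m :: nat where "m > 0" "g [^] m \<in> H" "\<And>i::nat. 0 < i \<Longrightarrow> i < m \<Longrightarrow> g [^] i \<notin> H"
proof -
  define P where "P m \<longleftrightarrow> m > 0 \<and> g [^] m \<in> H" for m :: nat
  have "P (ord g)"
    unfolding P_def using order_pos_least[OF assms(1,3)] assms subgroup.one_closed[OF assms(2)] by simp
  hence "P (LEAST m. P m)" by (rule LeastI)
  moreover have "\<not> P i" if "i < (LEAST m. P m)" for i using that by (rule not_less_Least)
  ultimately show thesis using that[of "LEAST m. P m"] by (auto simp: P_def)
qed

text \<open>Nonzero complex numbers have m-th roots, so a character extends to a strictly larger
  subgroup until G is reached.\<close>

lemma (in comm_group) character_extends_to_group: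
  assumes fin: "finite (carrier G)" and H: "subgroup H G" and \<chi>: "\<chi> \<in> hom (G\<lparr>carrier := H\<rparr>) Cstar"
  shows "\<exists>\<sigma>\<in>hom G Cstar. \<forall>h\<in>H. \<sigma> h = \<chi> h"
  using H \<chi>
proof (induction "card (carrier G) - card H" arbitrary: H \<chi> rule: less_induct)
  case less
  have H: "subgroup H G" by fact
  have Hc: "H \<subseteq> carrier G" using subgroup.subset[OF H] .
  show ?case
  proof (cases "H = carrier G")
    case True
    thus ?thesis using less.prems by auto
  next
    case False
    then obtain g where g: "g \<in> carrier G" "g \<notin> H" using Hc by blast
    obtain m :: nat where m: "m > 0" "g [^] m \<in> H" "\<And>i::nat. 0 < i \<Longrightarrow> i < m \<Longrightarrow> g [^] i \<notin> H"
      using least_power_in_subgroup[OF fin H g(1)] by blast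
    have "\<chi> (g [^] m) \<noteq> 0" using less.prems(2) m(2) by (auto simp: hom_def Cstar_def Pi_iff)
    hence "card {w. w ^ m = \<chi> (g [^] m)} = m" using m(1) by (intro card_nth_roots)
    then obtain w where w: "w ^ m = \<chi> (g [^] m)" using m(1) by (cases "{w. w ^ m = \<chi> (g [^] m)} = {}") auto
    obtain H' \<chi>' where H': "subgroup H' G" "insert g H \<subseteq> H'" "\<chi>' \<in> hom (G\<lparr>carrier := H'\<rparr>) Cstar"
      "\<And>h. h \<in> H \<Longrightarrow> \<chi>' h = \<chi> h"
      using extend_character[OF H less.prems(2) g(1) m w] by blast
    have H'c: "H' \<subseteq> carrier G" using subgroup.subset[OF H'(1)] .
    have "H \<subset> H'" using H'(2) g by blast
    hence "card H < card H'" using finite_subset[OF H'c fin] by (intro psubset_card_mono)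
    moreover have "card H' \<le> card (carrier G)" using H'c fin by (intro card_mono)
    ultimately obtain \<sigma> where "\<sigma> \<in> hom G Cstar" "\<forall>h\<in>H'. \<sigma> h = \<chi>' h"
      using less.hyps[OF _ H'(1,3)] by fastforce
    moreover from this have "\<forall>h\<in>H. \<sigma> h = \<chi> h" using H'(2,4) by auto
    ultimately show ?thesis by blast
  qed
qed

text \<open>Starting from the trivial subgroup, m is at least 2, and c can be given as value an m-th
  root of unity other than 1.\<close>

lemma (in comm_group) characters_separate:
  assumes fin: "finite (carrier G)" and c: "c \<in> carrier G" "c \<noteq> \<one>"
  obtains \<sigma> where "\<sigma> \<in> hom G Cstar" "\<sigma> c \<noteq> 1"
proof -
  have T: "subgroup {\<one>} G" by (rule triv_subgroup)
  have triv: "(\<lambda>_. 1) \<in> hom (G\<lparr>carrier := {\<one>}\<rparr>) Cstar" by (simp add: hom_def Cstar_def)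
  obtain m :: nat where m: "m > 0" "c [^] m \<in> {\<one>}" "\<And>i::nat. 0 < i \<Longrightarrow> i < m \<Longrightarrow> c [^] i \<notin> {\<one>}"
    using least_power_in_subgroup[OF fin T c(1)] by blast
  have "m \<noteq> 1" using m(2) c by auto
  hence "card {w::complex. w ^ m = 1} > 1" using card_roots_unity_eq[of m] m(1) by simp
  hence "\<not> {w::complex. w ^ m = 1} \<subseteq> {1}"
    using card_mono[of "{1::complex}" "{w. w ^ m = 1}"] by auto
  then obtain w :: complex where w: "w ^ m = 1" "w \<noteq> 1" by blast
  obtain H' \<chi>' where H': "subgroup H' G" "insert c {\<one>} \<subseteq> H'" "\<chi>' \<in> hom (G\<lparr>carrier := H'\<rparr>) Cstar" "\<chi>' c = w"
    using extend_character[OF T triv c(1) m w(1)] by blast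
  show thesis
    using character_extends_to_group[OF fin H'(1,3)] H'(2,4) w(2) that by fastforce
qed

section \<open>Exponentials of inner derivations\<close>

text \<open>By the Cauchy product a Leibniz rule for the terms becomes multiplicativity of the
  exponentials. The kernel \<open>\<kappa>\<close> will be the structure constants in
  \<open>ad_exp_tmult\<close> and the identity matrix in \<open>ad_exp_inverse\<close>.\<close>

lemma exp_series_bilinear:
  fixes f :: "nat \<Rightarrow> 'a \<Rightarrow> complex" and g :: "nat \<Rightarrow> 'b \<Rightarrow> complex" and h :: "nat \<Rightarrow> complex"
  assumes "finite A" "finite B"
    and f: "\<And>a. a \<in> A \<Longrightarrow> summable (\<lambda>n. norm (f n a / fact n))"
    and g: "\<And>b. b \<in> B \<Longrightarrow> summable (\<lambda>n. norm (g n b / fact n))"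
    and h: "\<And>n. h n = (\<Sum>i\<le>n. of_nat (n choose i) * (\<Sum>a\<in>A. \<Sum>b\<in>B. \<kappa> a b * f i a * g (n - i) b))"
  shows "(\<lambda>n. h n / fact n) sums
    (\<Sum>a\<in>A. \<Sum>b\<in>B. \<kappa> a b * suminf (\<lambda>n. f n a / fact n) * suminf (\<lambda>n. g n b / fact n))"
proof -
  have "(\<lambda>n. \<Sum>a\<in>A. \<Sum>b\<in>B. \<kappa> a b * (\<Sum>i\<le>n. f i a / fact i * (g (n - i) b / fact (n - i)))) sums
    (\<Sum>a\<in>A. \<Sum>b\<in>B. \<kappa> a b * (suminf (\<lambda>n. f n a / fact n) * suminf (\<lambda>n. g n b / fact n)))"
    by (intro sums_sum sums_mult Cauchy_product_sums f g)
  moreover have "h n / fact n =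
    (\<Sum>a\<in>A. \<Sum>b\<in>B. \<kappa> a b * (\<Sum>i\<le>n. f i a / fact i * (g (n - i) b / fact (n - i))))" for n
  proof -
    have "h n / fact n = (\<Sum>i\<le>n. \<Sum>a\<in>A. \<Sum>b\<in>B. \<kappa> a b * (f i a / fact i * (g (n - i) b / fact (n - i))))"
      unfolding h sum_divide_distrib sum_distrib_left
      by (intro sum.cong refl) (simp add: binomial_fact field_simps)
    also have "\<dots> = (\<Sum>a\<in>A. \<Sum>i\<le>n. \<Sum>b\<in>B. \<kappa> a b * (f i a / fact i * (g (n - i) b / fact (n - i))))"
      by (rule sum.swap)
    also have "\<dots> = (\<Sum>a\<in>A. \<Sum>b\<in>B. \<Sum>i\<le>n. \<kappa> a b * (f i a / fact i * (g (n - i) b / fact (n - i))))"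
      by (intro sum.cong refl sum.swap)
    finally show ?thesis by (simp add: sum_distrib_left)
  qed
  ultimately show ?thesis by (simp add: mult.assoc)
qed

lemma sum_fun_apply: "(\<Sum>i\<in>I. f i) c = (\<Sum>i\<in>I. f i c :: 'b :: comm_monoid_add)"
  by (induction I rule: infinite_finite_induct) auto

lemma root_bracket_apply:
  "root_bracket G \<xi> S x y c =
     (\<Sum>a\<in>S. \<Sum>b\<in>S. if c = a \<otimes>\<^bsub>G\<^esub> b then x a * y b * (\<xi> a b - \<xi> b a) else 0)"
  by (simp add: root_bracket_def sum_fun_apply cscale_def unit_vec_def if_distrib[of "(*) _"] cong: if_cong)

section \<open>The twisted group algebra and the exponentials of its inner derivations\<close>

locale finite_abelian_bichar = comm_group G for G :: "('a, 'm) monoid_scheme" (structure) +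
  fixes \<xi> :: "'a \<Rightarrow> 'a \<Rightarrow> complex"
  assumes fin: "finite (carrier G)" and bichar: "bicharacter G \<xi>"
begin

abbreviation "A \<equiv> carrier G"

lemma xi_mult_right: "a \<in> A \<Longrightarrow> b \<in> A \<Longrightarrow> c \<in> A \<Longrightarrow> \<xi> a (b \<otimes> c) = \<xi> a b * \<xi> a c"
  and xi_mult_left: "a \<in> A \<Longrightarrow> b \<in> A \<Longrightarrow> c \<in> A \<Longrightarrow> \<xi> (a \<otimes> b) c = \<xi> a c * \<xi> b c"
  and xi_nonzero: "a \<in> A \<Longrightarrow> b \<in> A \<Longrightarrow> \<xi> a b \<noteq> 0"
  using bichar by (auto simp: bicharacter_def hom_def Cstar_def Pi_iff)

text \<open>The multiplication \<open>u\<^sub>a u\<^sub>b = \<xi>(a,b) u\<^sub>a\<^sub>+\<^sub>b\<close> of the twisted group algebra.\<close>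

definition tmult :: "('a \<Rightarrow> complex) \<Rightarrow> ('a \<Rightarrow> complex) \<Rightarrow> 'a \<Rightarrow> complex" where
  "tmult y z c = (\<Sum>a\<in>A. \<Sum>b\<in>A. if c = a \<otimes> b then \<xi> a b * y a * z b else 0)"

text \<open>On all of G the bracket is the commutator of \<open>tmult\<close>, because G is
  commutative.\<close>

abbreviation "ad \<equiv> root_bracket G \<xi> A"

lemma sum_product_index:
  fixes F :: "'a \<Rightarrow> complex"
  shows "(\<Sum>e\<in>A. F e * (\<Sum>a\<in>A. \<Sum>b\<in>A. if e = a \<otimes> b then H a b else 0)) =
         (\<Sum>a\<in>A. \<Sum>b\<in>A. F (a \<otimes> b) * H a b)"
proof -
  have "(\<Sum>e\<in>A. F e * (\<Sum>a\<in>A. \<Sum>b\<in>A. if e = a \<otimes> b then H a b else 0)) =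
      (\<Sum>e\<in>A. \<Sum>a\<in>A. \<Sum>b\<in>A. if e = a \<otimes> b then F (a \<otimes> b) * H a b else 0)"
    unfolding sum_distrib_left by (intro sum.cong refl) auto
  also have "\<dots> = (\<Sum>a\<in>A. \<Sum>e\<in>A. \<Sum>b\<in>A. if e = a \<otimes> b then F (a \<otimes> b) * H a b else 0)"
    by (rule sum.swap)
  also have "\<dots> = (\<Sum>a\<in>A. \<Sum>b\<in>A. \<Sum>e\<in>A. if e = a \<otimes> b then F (a \<otimes> b) * H a b else 0)"
    by (intro sum.cong refl sum.swap)
  also have "\<dots> = (\<Sum>a\<in>A. \<Sum>b\<in>A. F (a \<otimes> b) * H a b)"
    using fin by (intro sum.cong refl) (simp add: sum.delta)
  finally show ?thesis .
qed

text \<open>Commutators are derivations of an associative product. Concretely, all three terms are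
  brought to sums over the same triples, and bimultiplicativity of \<open>\<xi>\<close> gives
  \<open>k a (b \<otimes> d) * \<xi> b d = \<xi> (a \<otimes> b) d * k a b + \<xi> b (a \<otimes> d)
  * k a d\<close>.\<close>

lemma ad_tmult: "ad x (tmult y z) c = tmult (ad x y) z c + tmult y (ad x z) c"
proof -
  define k where "k a b = \<xi> a b - \<xi> b a" for a b
  have "ad x (tmult y z) c = (\<Sum>a\<in>A. \<Sum>e\<in>A. (if c = a \<otimes> e then x a * k a e else 0) * tmult y z e)"
    unfolding root_bracket_apply k_def by (intro sum.cong refl) auto
  also have "\<dots> = (\<Sum>a\<in>A. \<Sum>b\<in>A. \<Sum>d\<in>A. (if c = a \<otimes> (b \<otimes> d) then x a * k a (b \<otimes> d) else 0) * (\<xi> b d * y b * z d))"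
    unfolding tmult_def by (intro sum.cong refl sum_product_index)
  finally have 1: "ad x (tmult y z) c = \<dots>" .
  have "tmult (ad x y) z c = (\<Sum>d\<in>A. \<Sum>e\<in>A. (if c = e \<otimes> d then \<xi> e d * z d else 0) * ad x y e)"
    unfolding tmult_def by (subst sum.swap) (intro sum.cong refl, auto)
  also have "\<dots> = (\<Sum>d\<in>A. \<Sum>a\<in>A. \<Sum>b\<in>A. (if c = a \<otimes> b \<otimes> d then \<xi> (a \<otimes> b) d * z d else 0) * (x a * y b * k a b))"
    unfolding root_bracket_apply k_def by (intro sum.cong refl sum_product_index)
  also have "\<dots> = (\<Sum>a\<in>A. \<Sum>d\<in>A. \<Sum>b\<in>A. (if c = a \<otimes> b \<otimes> d then \<xi> (a \<otimes> b) d * z d else 0) * (x a * y b * k a b))"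
    by (rule sum.swap)
  also have "\<dots> = (\<Sum>a\<in>A. \<Sum>b\<in>A. \<Sum>d\<in>A. (if c = a \<otimes> b \<otimes> d then \<xi> (a \<otimes> b) d * z d else 0) * (x a * y b * k a b))"
    by (intro sum.cong refl sum.swap)
  finally have 2: "tmult (ad x y) z c = \<dots>" .
  have "tmult y (ad x z) c = (\<Sum>b\<in>A. \<Sum>e\<in>A. (if c = b \<otimes> e then \<xi> b e * y b else 0) * ad x z e)"
    unfolding tmult_def by (intro sum.cong refl) auto
  also have "\<dots> = (\<Sum>b\<in>A. \<Sum>a\<in>A. \<Sum>d\<in>A. (if c = b \<otimes> (a \<otimes> d) then \<xi> b (a \<otimes> d) * y b else 0) * (x a * z d * k a d))"
    unfolding root_bracket_apply k_def by (intro sum.cong refl sum_product_index)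
  also have "\<dots> = (\<Sum>a\<in>A. \<Sum>b\<in>A. \<Sum>d\<in>A. (if c = b \<otimes> (a \<otimes> d) then \<xi> b (a \<otimes> d) * y b else 0) * (x a * z d * k a d))"
    by (rule sum.swap)
  finally have 3: "tmult y (ad x z) c = \<dots>" .
  show ?thesis
    unfolding 1 2 3 sum.distrib[symmetric]
  proof (intro sum.cong refl)
    fix a b d assume *: "a \<in> A" "b \<in> A" "d \<in> A"
    have "a \<otimes> b \<otimes> d = a \<otimes> (b \<otimes> d)" "b \<otimes> (a \<otimes> d) = a \<otimes> (b \<otimes> d)"
      using * by (simp_all add: m_ac)
    thus "(if c = a \<otimes> (b \<otimes> d) then x a * k a (b \<otimes> d) else 0) * (\<xi> b d * y b * z d) =
        (if c = a \<otimes> b \<otimes> d then \<xi> (a \<otimes> b) d * z d else 0) * (x a * y b * k a b) +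
        (if c = b \<otimes> (a \<otimes> d) then \<xi> b (a \<otimes> d) * y b else 0) * (x a * z d * k a d)"
      using * by (simp add: k_def xi_mult_left xi_mult_right algebra_simps)
  qed
qed

definition ad_pow :: "('a \<Rightarrow> complex) \<Rightarrow> nat \<Rightarrow> ('a \<Rightarrow> complex) \<Rightarrow> 'a \<Rightarrow> complex" where
  "ad_pow x n y = (ad x ^^ n) y"

lemma ad_pow_simps [simp]: "ad_pow x 0 y = y" "ad_pow x (Suc n) y = ad x (ad_pow x n y)"
  by (simp_all add: ad_pow_def)

lemma ad_linear: "ad x (\<lambda>c. \<Sum>i\<in>I. k i * f i c) c = (\<Sum>i\<in>I. k i * ad x (f i) c)"
proof -
  have "ad x (\<lambda>c. \<Sum>i\<in>I. k i * f i c) c =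
      (\<Sum>a\<in>A. \<Sum>b\<in>A. \<Sum>i\<in>I. k i * (if c = a \<otimes> b then x a * f i b * (\<xi> a b - \<xi> b a) else 0))"
    unfolding root_bracket_apply
    by (intro sum.cong refl) (auto simp: sum_distrib_left sum_distrib_right mult_ac intro!: sum.cong)
  also have "\<dots> = (\<Sum>a\<in>A. \<Sum>i\<in>I. \<Sum>b\<in>A. k i * (if c = a \<otimes> b then x a * f i b * (\<xi> a b - \<xi> b a) else 0))"
    by (intro sum.cong refl sum.swap)
  also have "\<dots> = (\<Sum>i\<in>I. \<Sum>a\<in>A. \<Sum>b\<in>A. k i * (if c = a \<otimes> b then x a * f i b * (\<xi> a b - \<xi> b a) else 0))"
    by (rule sum.swap)
  finally show ?thesis by (simp add: root_bracket_apply sum_distrib_left)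
qed

text \<open>The Leibniz rule for powers of a derivation; in the induction Pascal's rule merges the
  two shifted sums.\<close>

lemma ad_pow_tmult:
  "ad_pow x n (tmult y z) = (\<lambda>c. \<Sum>i\<le>n. of_nat (n choose i) * tmult (ad_pow x i y) (ad_pow x (n - i) z) c)"
proof (induction n)
  case (Suc n)
  define t where "t i j c = tmult (ad_pow x i y) (ad_pow x j z) c" for i j c
  have "ad_pow x (Suc n) (tmult y z) c = (\<Sum>i\<le>Suc n. of_nat (Suc n choose i) * t i (Suc n - i) c)" for c
  proof -
    have "ad_pow x (Suc n) (tmult y z) c = (\<Sum>i\<le>n. of_nat (n choose i) * ad x (t i (n - i)) c)"
      unfolding ad_pow_simps Suc t_def by (rule ad_linear)
    also have "\<dots> = (\<Sum>i\<le>n. of_nat (n choose i) * (t (Suc i) (n - i) c + t i (Suc n - i) c))"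
      unfolding t_def by (intro sum.cong refl) (simp add: ad_tmult Suc_diff_le)
    also have "\<dots> = (\<Sum>i\<le>n. of_nat (n choose i) * t (Suc i) (n - i) c) + (\<Sum>i\<le>n. of_nat (n choose i) * t i (Suc n - i) c)"
      by (simp add: algebra_simps sum.distrib)
    also have "(\<Sum>i\<le>n. of_nat (n choose i) * t i (Suc n - i) c) = (\<Sum>i\<le>Suc n. of_nat (n choose i) * t i (Suc n - i) c)"
      by (simp add: binomial_eq_0)
    also have "\<dots> = t 0 (Suc n) c + (\<Sum>i\<le>n. of_nat (n choose Suc i) * t (Suc i) (n - i) c)"
      by (subst sum.atMost_Suc_shift) simp
    also have "(\<Sum>i\<le>n. of_nat (n choose i) * t (Suc i) (n - i) c) + (t 0 (Suc n) c + (\<Sum>i\<le>n. of_nat (n choose Suc i) * t (Suc i) (n - i) c)) =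
        t 0 (Suc n) c + (\<Sum>i\<le>n. of_nat (Suc n choose Suc i) * t (Suc i) (n - i) c)"
      by (simp add: algebra_simps sum.distrib)
    also have "\<dots> = (\<Sum>i\<le>Suc n. of_nat (Suc n choose i) * t i (Suc n - i) c)"
      by (subst sum.atMost_Suc_shift) simp
    finally show ?thesis .
  qed
  thus ?case unfolding t_def by blast
qed simp

text \<open>M bounds the operator entrywise, so the terms are dominated by those of the exponential
  series of M.\<close>

lemma ad_pow_summable:
  assumes "c \<in> A" shows "summable (\<lambda>n. norm (ad_pow x n y c / fact n))"
proof -
  define M where "M = (\<Sum>a\<in>A. \<Sum>b\<in>A. norm (x a * (\<xi> a b - \<xi> b a)))"
  define Y where "Y = (\<Sum>a\<in>A. norm (y a))"
  have M: "M \<ge> 0" unfolding M_def by (intro sum_nonneg) auto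
  have bound: "norm (ad_pow x n y c) \<le> M ^ n * Y" if "c \<in> A" for n c
    using that
  proof (induction n arbitrary: c)
    case 0
    thus ?case using fin by (auto simp: Y_def intro!: member_le_sum)
  next
    case (Suc n)
    have "norm (ad_pow x (Suc n) y c) \<le> (\<Sum>a\<in>A. \<Sum>b\<in>A. norm (x a * (\<xi> a b - \<xi> b a)) * (M ^ n * Y))"
      unfolding ad_pow_simps root_bracket_apply
    proof (intro sum_norm_le)
      fix a b assume "a \<in> A" "b \<in> A"
      hence "norm (ad_pow x n y b) \<le> M ^ n * Y" using Suc.IH by blast
      hence "norm (x a * (\<xi> a b - \<xi> b a)) * norm (ad_pow x n y b) \<le> norm (x a * (\<xi> a b - \<xi> b a)) * (M ^ n * Y)"
        by (intro mult_left_mono) auto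
      moreover have "0 \<le> norm (x a * (\<xi> a b - \<xi> b a)) * (M ^ n * Y)"
        using M by (intro mult_nonneg_nonneg zero_le_power) (auto simp: Y_def intro: sum_nonneg)
      ultimately show "norm (if c = a \<otimes> b then x a * ad_pow x n y b * (\<xi> a b - \<xi> b a) else 0) \<le>
          norm (x a * (\<xi> a b - \<xi> b a)) * (M ^ n * Y)"
        by (simp add: norm_mult mult_ac)
    qed
    also have "\<dots> = M * (M ^ n * Y)"
    proof -
      have "(\<Sum>a\<in>A. \<Sum>b\<in>A. norm (x a * (\<xi> a b - \<xi> b a)) * Z) = M * Z" for Z
        unfolding M_def sum_distrib_right ..
      thus ?thesis .
    qed
    also have "\<dots> = M ^ Suc n * Y" by simp
    finally show ?case .
  qed
  show ?thesis
  proof (rule summable_comparison_test)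
    show "summable (\<lambda>n. inverse (fact n) * M ^ n * Y)"
      by (intro summable_mult2 summable_exp)
    show "\<exists>N. \<forall>n\<ge>N. norm (norm (ad_pow x n y c / fact n)) \<le> inverse (fact n) * M ^ n * Y"
      using bound[OF assms] by (auto simp: norm_divide field_simps divide_right_mono)
  qed
qed

definition ad_exp :: "('a \<Rightarrow> complex) \<Rightarrow> ('a \<Rightarrow> complex) \<Rightarrow> 'a \<Rightarrow> complex" where
  "ad_exp x y c = suminf (\<lambda>n. ad_pow x n y c / fact n)"

lemma ad_exp_tmult: 
  assumes c: "c \<in> A" shows "ad_exp x (tmult y z) c = tmult (ad_exp x y) (ad_exp x z) c"
proof -
  have "(\<lambda>n. ad_pow x n (tmult y z) c / fact n) sums
    (\<Sum>a\<in>A. \<Sum>b\<in>A. (if c = a \<otimes> b then \<xi> a b else 0) * suminf (\<lambda>n. ad_pow x n y a / fact n) * suminf (\<lambda>n. ad_pow x n z b / fact n))"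
  proof (rule exp_series_bilinear)
    fix n
    show "ad_pow x n (tmult y z) c = (\<Sum>i\<le>n. of_nat (n choose i) *
        (\<Sum>a\<in>A. \<Sum>b\<in>A. (if c = a \<otimes> b then \<xi> a b else 0) * ad_pow x i y a * ad_pow x (n - i) z b))"
      unfolding ad_pow_tmult tmult_def by (intro sum.cong refl arg_cong[where f = "(*) _"]) auto
  qed (use fin ad_pow_summable in auto)
  hence "ad_exp x (tmult y z) c = (\<Sum>a\<in>A. \<Sum>b\<in>A. (if c = a \<otimes> b then \<xi> a b else 0) * ad_exp x y a * ad_exp x z b)"
    unfolding ad_exp_def by (rule sums_unique[symmetric])
  also have "\<dots> = tmult (ad_exp x y) (ad_exp x z) c"
    unfolding tmult_def by (intro sum.cong refl) auto
  finally show ?thesis .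
qed

text \<open>The powers as matrices: this presents their composition in \<open>ad_exp_inverse\<close>
  in the bilinear form required by \<open>exp_series_bilinear\<close>.\<close>

lemma ad_pow_coord:
  assumes "c \<in> A" shows "ad_pow x n y c = (\<Sum>b\<in>A. ad_pow x n (unit_vec b) c * y b)"
  using assms
proof (induction n arbitrary: c)
  case 0
  have "(\<Sum>b\<in>A. unit_vec b c * y b) = (\<Sum>b\<in>A. if c = b then y b else 0)"
    by (intro sum.cong) (auto simp: unit_vec_def)
  thus ?case using 0 fin by (simp add: sum.delta)
next
  case (Suc n)
  have "ad_pow x (Suc n) y c = ad x (\<lambda>c. \<Sum>b\<in>A. y b * ad_pow x n (unit_vec b) c) c"
    unfolding ad_pow_simps root_bracket_apply
    by (intro sum.cong refl) (simp add: Suc.IH[of _] mult.commute)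
  also have "\<dots> = (\<Sum>b\<in>A. y b * ad_pow x (Suc n) (unit_vec b) c)"
    by (simp add: ad_linear)
  finally show ?case by (simp add: mult.commute)
qed

lemma ad_uminus: "ad (- x) y = - ad x y"
  by (rule ext) (simp add: root_bracket_apply sum_negf[symmetric] if_distrib[of uminus] cong: if_cong)

lemma ad_pow_uminus: "ad_pow (- x) n y c = (-1) ^ n * ad_pow x n y c"
proof (induction n arbitrary: c)
  case (Suc n)
  \<comment> \<open>A sum over a one-element index set lets \<open>ad_linear\<close> serve as
    homogeneity.\<close>
  have "ad_pow (- x) n y = (\<lambda>c. \<Sum>i\<in>{()}. (-1) ^ n * ad_pow x n y c)"
    by (rule ext) (simp only: Suc, simp)
  hence "ad_pow (- x) (Suc n) y c = - ad x (\<lambda>c. \<Sum>i\<in>{()}. (-1) ^ n * ad_pow x n y c) c"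
    by (simp only: ad_pow_simps ad_uminus uminus_apply)
  also have "\<dots> = - (\<Sum>i\<in>{()}. (-1) ^ n * ad x (ad_pow x n y) c)"
    by (subst ad_linear) simp
  also have "\<dots> = (-1) ^ Suc n * ad_pow x (Suc n) y c" by simp
  finally show ?case .
qed simp

lemma ad_pow_add: "ad_pow x i (ad_pow x j y) = ad_pow x (i + j) y"
  by (simp add: ad_pow_def funpow_add)

text \<open>f n is row c of the n-th power for -x. The coefficient of degree n is an alternating sum
  of binomials, which vanishes for positive n.\<close>

lemma ad_exp_inverse:
  assumes c: "c \<in> A" shows "ad_exp (- x) (ad_exp x y) c = y c"
proof -
  define f where "f n b = ad_pow (- x) n (unit_vec b) c" for n b
  have "(\<lambda>n. (if n = 0 then y c else 0) / fact n) sums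
    (\<Sum>a\<in>A. \<Sum>b\<in>A. (if a = b then 1 else 0) * suminf (\<lambda>n. f n a / fact n) * suminf (\<lambda>n. ad_pow x n y b / fact n))"
  proof (rule exp_series_bilinear)
    fix n
    have "(\<Sum>a\<in>A. \<Sum>b\<in>A. (if a = b then 1 else 0) * f i a * ad_pow x (n - i) y b) = (-1) ^ i * ad_pow x n y c"
      if "i \<le> n" for i
    proof -
      have "(\<Sum>a\<in>A. \<Sum>b\<in>A. (if a = b then 1 else 0) * f i a * ad_pow x (n - i) y b) =
          (\<Sum>a\<in>A. \<Sum>b\<in>A. if a = b then f i b * ad_pow x (n - i) y b else 0)"
        by (intro sum.cong refl) auto
      also have "\<dots> = (\<Sum>a\<in>A. f i a * ad_pow x (n - i) y a)"
        using fin by (simp add: sum.delta)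
      also have "\<dots> = ad_pow (- x) i (ad_pow x (n - i) y) c"
        unfolding f_def by (rule ad_pow_coord[OF c, symmetric])
      also have "\<dots> = (-1) ^ i * ad_pow x n y c"
        using that by (simp add: ad_pow_uminus ad_pow_add)
      finally show ?thesis .
    qed
    hence "(\<Sum>i\<le>n. of_nat (n choose i) * (\<Sum>a\<in>A. \<Sum>b\<in>A. (if a = b then 1 else 0) * f i a * ad_pow x (n - i) y b)) =
        (\<Sum>i\<le>n. (-1) ^ i * of_nat (n choose i)) * ad_pow x n y c"
      unfolding sum_distrib_right by (intro sum.cong) auto
    also have "\<dots> = (if n = 0 then y c else 0)"
      using choose_alternating_sum[of n, where 'a = complex] by (cases "n = 0") auto
    finally show "(if n = 0 then y c else 0) = (\<Sum>i\<le>n. of_nat (n choose i) *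
        (\<Sum>a\<in>A. \<Sum>b\<in>A. (if a = b then 1 else 0) * f i a * ad_pow x (n - i) y b))" ..
  qed (use fin ad_pow_summable c in \<open>auto simp: f_def\<close>)
  moreover have "(\<lambda>n. (if n = 0 then y c else 0) / fact n) sums y c"
    using sums_single[of 0 "\<lambda>_. y c"] by (rule back_subst[of "\<lambda>f. f sums _"]) (auto simp: fun_eq_iff)
  ultimately have "y c = (\<Sum>a\<in>A. \<Sum>b\<in>A. (if a = b then 1 else 0) * suminf (\<lambda>n. f n a / fact n) * ad_exp x y b)"
    unfolding ad_exp_def by (rule sums_unique2[rotated])
  also have "\<dots> = (\<Sum>a\<in>A. \<Sum>b\<in>A. if a = b then suminf (\<lambda>n. f n b / fact n) * ad_exp x y b else 0)"
    by (intro sum.cong refl) auto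
  also have "\<dots> = (\<Sum>a\<in>A. suminf (\<lambda>n. f n a / fact n) * ad_exp x y a)"
    using fin by (simp add: sum.delta)
  also have "\<dots> = ad_exp (- x) (ad_exp x y) c"
  proof -
    have "(\<lambda>n. \<Sum>b\<in>A. f n b / fact n * ad_exp x y b) sums (\<Sum>b\<in>A. suminf (\<lambda>n. f n b / fact n) * ad_exp x y b)"
      unfolding f_def using summable_norm_cancel[OF ad_pow_summable[OF c]]
      by (intro sums_sum sums_mult2 summable_sums)
    moreover have "(\<Sum>b\<in>A. f n b / fact n * ad_exp x y b) = ad_pow (- x) n (ad_exp x y) c / fact n" for n
      unfolding f_def by (subst ad_pow_coord[OF c, of _ _ "ad_exp x y"]) (simp add: sum_divide_distrib)
    ultimately show ?thesis unfolding ad_exp_def[of "- x"] by (simp add: sums_iff)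
  qed
  finally show ?thesis ..
qed

lemma ad_exp_coord:
  assumes "S \<subseteq> A" "\<And>n. ad_pow x n y \<in> coord_space S" shows "ad_exp x y \<in> coord_space S"
  using assms(2) by (auto simp: ad_exp_def coord_space_def)

lemma ad_exp_central:
  assumes "c \<in> A" "\<And>b. b \<in> A \<Longrightarrow> \<xi> b c = \<xi> c b" shows "ad_exp x (unit_vec c) = unit_vec c"
proof -
  have "ad x (unit_vec c) = 0"
    using assms by (auto simp: fun_eq_iff root_bracket_apply unit_vec_def intro!: sum.neutral)
  moreover have ad0: "ad x 0 = 0"
    by (auto simp: fun_eq_iff root_bracket_apply intro!: sum.neutral)
  ultimately have Suc: "ad_pow x (Suc n) (unit_vec c) = 0" for n
    by (induction n) auto
  have "(\<lambda>n. ad_pow x n (unit_vec c) d / fact n) sums unit_vec c d" for d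
  proof -
    have "ad_pow x n (unit_vec c) d / fact n = (if n = 0 then unit_vec c d else 0)" for n
      using Suc by (cases n) auto
    thus ?thesis using sums_single[of 0 "\<lambda>_. unit_vec c d"] by simp
  qed
  thus ?thesis by (simp add: ad_exp_def sums_iff fun_eq_iff)
qed

lemma tmult_unit_vec:
  assumes "a \<in> A" "b \<in> A" shows "tmult (unit_vec a) (unit_vec b) = cscale (\<xi> a b) (unit_vec (a \<otimes> b))"
proof
  fix c
  have "tmult (unit_vec a) (unit_vec b) c =
      (\<Sum>a'\<in>A. \<Sum>b'\<in>A. if b' = b then (if a' = a then (if c = a \<otimes> b then \<xi> a b else 0) else 0) else 0)"
    unfolding tmult_def by (intro sum.cong refl) (auto simp: unit_vec_def)
  also have "\<dots> = cscale (\<xi> a b) (unit_vec (a \<otimes> b)) c"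
    using fin assms by (simp add: sum.delta cscale_def unit_vec_def)
  finally show "tmult (unit_vec a) (unit_vec b) c = cscale (\<xi> a b) (unit_vec (a \<otimes> b)) c" .
qed

lemma tmult_cscale: "tmult (cscale s y) (cscale t z) = cscale (s * t) (tmult y z)"
  by (rule ext) (auto simp: tmult_def cscale_def sum_distrib_left intro!: sum.cong)

lemma tmult_coord: "tmult y z \<in> coord_space A"
  by (auto simp: tmult_def coord_space_def intro!: sum.neutral)

lemma ad_coord: "ad x y \<in> coord_space A"
  by (auto simp: root_bracket_apply coord_space_def intro!: sum.neutral)

lemma ad_pow_cscale: "ad_pow x n (cscale s y) c = s * ad_pow x n y c"
proof (induction n arbitrary: c)
  case (Suc n)
  have "ad_pow x n (cscale s y) = (\<lambda>c. \<Sum>i\<in>{()}. s * ad_pow x n y c)"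
    by (rule ext) (simp only: Suc, simp)
  hence "ad_pow x (Suc n) (cscale s y) c = ad x (\<lambda>c. \<Sum>i\<in>{()}. s * ad_pow x n y c) c"
    by (simp only: ad_pow_simps)
  also have "\<dots> = s * ad_pow x (Suc n) y c"
    by (subst ad_linear) simp
  finally show ?case .
qed (simp add: cscale_def)

lemma ad_exp_cscale:
  assumes "c \<in> A" shows "ad_exp x (cscale s y) c = s * ad_exp x y c"
  using suminf_mult[OF summable_norm_cancel[OF ad_pow_summable[OF assms]], of s]
  by (simp add: ad_exp_def ad_pow_cscale)

end

section \<open>Inner automorphisms of the Lie algebra and the radical\<close>

locale root_system_lie = finite_root_system + bichar: finite_abelian_bichar G \<xi> for \<xi> +
  assumes xi_beta: "\<And>a b. a \<in> carrier G \<Longrightarrow> b \<in> carrier G \<Longrightarrow> \<xi> a b * inverse (\<xi> b a) = \<beta> a b"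
begin

abbreviation "br \<equiv> root_bracket G \<xi> R"

lemma xi_eq_iff:
  assumes "a \<in> carrier G" "b \<in> carrier G" shows "\<xi> a b = \<xi> b a \<longleftrightarrow> \<beta> a b = 1"
  using xi_beta[OF assms] bichar.xi_nonzero assms by (auto simp: field_simps)

lemma br_coord: "br x y \<in> coord_space R"
proof -
  have "br x y c = 0" if "c \<notin> R" for c
    unfolding root_bracket_apply
  proof (intro sum.neutral ballI)
    fix a b assume ab: "a \<in> R" "b \<in> R"
    show "(if c = a \<otimes> b then x a * y b * (\<xi> a b - \<xi> b a) else 0) = 0"
    proof (cases "c = a \<otimes> b")
      case True
      hence "\<beta> a b = 1" using that FRS2[OF ab] by blast
      thus ?thesis using xi_eq_iff ab by simp
    qed simp
  qed
  thus ?thesis by (simp add: coord_space_def)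
qed

text \<open>L(R) is a Lie subalgebra of the twisted group algebra under the commutator, so its
  exponentials can be computed in the larger algebra.\<close>

lemma br_eq: 
  assumes "x \<in> coord_space R" "y \<in> coord_space R" shows "br x y = root_bracket G \<xi> (carrier G) x y"
proof
  fix c
  have "(\<Sum>a\<in>R. \<Sum>b\<in>R. if c = a \<otimes> b then x a * y b * (\<xi> a b - \<xi> b a) else 0) =
      (\<Sum>a\<in>R. \<Sum>b\<in>carrier G. if c = a \<otimes> b then x a * y b * (\<xi> a b - \<xi> b a) else 0)"
    using assms finite_carrier by (intro sum.cong refl sum.mono_neutral_left) (auto simp: coord_space_def)
  also have "\<dots> = (\<Sum>a\<in>carrier G. \<Sum>b\<in>carrier G. if c = a \<otimes> b then x a * y b * (\<xi> a b - \<xi> b a) else 0)"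
    using assms finite_carrier
    by (intro sum.mono_neutral_left) (auto simp: coord_space_def intro!: sum.neutral)
  finally show "br x y c = root_bracket G \<xi> (carrier G) x y c"
    by (simp only: root_bracket_apply)
qed

lemma br_pow:
  assumes x: "x \<in> coord_space R" and y: "y \<in> coord_space R"
  shows "(br x ^^ n) y = bichar.ad_pow x n y \<and> bichar.ad_pow x n y \<in> coord_space R"
proof (induction n)
  case (Suc n)
  thus ?case using br_eq[OF x, of "bichar.ad_pow x n y"] br_coord[of x "bichar.ad_pow x n y"] by simp
qed (use y in simp)

lemma exp_ad_eq:
  assumes "x \<in> coord_space R" "y \<in> coord_space R" shows "exp_ad R br x y = bichar.ad_exp x y"
  using br_pow[OF assms] assms(2) by (simp add: exp_ad_def bichar.ad_exp_def fun_eq_iff)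

lemma ad_exp_coord_R: "x \<in> coord_space R \<Longrightarrow> y \<in> coord_space R \<Longrightarrow> bichar.ad_exp x y \<in> coord_space R"
  using br_pow FRS0_subset by (intro bichar.ad_exp_coord) auto

lemma uminus_coord: "x \<in> coord_space S \<Longrightarrow> - x \<in> coord_space S"
  by (simp add: coord_space_def)

lemma ad_exp_inverse_R:
  assumes "x \<in> coord_space R" "y \<in> coord_space R" shows "bichar.ad_exp (- x) (bichar.ad_exp x y) = y"
proof
  fix c
  have *: "bichar.ad_exp (- x) (bichar.ad_exp x y) \<in> coord_space R"
    using assms by (intro ad_exp_coord_R uminus_coord)
  show "bichar.ad_exp (- x) (bichar.ad_exp x y) c = y c"
  proof (cases "c \<in> carrier G")
    case False
    hence "c \<notin> R" by auto
    thus ?thesis using * assms(2) by (simp add: coord_space_def)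
  qed (rule bichar.ad_exp_inverse)
qed

lemma exp_ad_Bij:
  assumes x: "x \<in> coord_space R" shows "exp_ad R br x \<in> Bij (coord_space R)"
proof -
  have "bij_betw (bichar.ad_exp x) (coord_space R) (coord_space R)"
    by (rule bij_betwI[of _ _ _ "bichar.ad_exp (- x)"])
      (use x ad_exp_coord_R uminus_coord ad_exp_inverse_R[OF x] ad_exp_inverse_R[OF uminus_coord[OF x]] in auto)
  hence "bij_betw (exp_ad R br x) (coord_space R) (coord_space R)"
    using exp_ad_eq[OF x] by (simp cong: bij_betw_cong)
  thus ?thesis by (simp add: Bij_def exp_ad_def)
qed

text \<open>Inner automorphisms extend to automorphisms of the twisted group algebra that fix its center,
  which is spanned by the \<open>u\<^sub>c\<close> with \<open>c\<close> in the radical. As the roots generate \<open>G\<close>, a character that acts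
  by an inner automorphism multiplies \<open>u\<^sub>c\<close> by its value at \<open>c\<close>, so it is trivial on the radical.\<close>

definition extends_to_algebra :: "(('a \<Rightarrow> complex) \<Rightarrow> 'a \<Rightarrow> complex) \<Rightarrow> bool" where
  "extends_to_algebra \<phi> \<longleftrightarrow> (\<exists>\<Phi>.
     (\<forall>y\<in>coord_space (carrier G). \<Phi> y \<in> coord_space (carrier G)) \<and>
     (\<forall>y\<in>coord_space R. \<Phi> y = \<phi> y) \<and>
     (\<forall>y\<in>coord_space (carrier G). \<forall>z\<in>coord_space (carrier G).
        \<Phi> (bichar.tmult y z) = bichar.tmult (\<Phi> y) (\<Phi> z)) \<and>
     (\<forall>s. \<forall>y\<in>coord_space (carrier G). \<Phi> (cscale s y) = cscale s (\<Phi> y)) \<and>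
     (\<forall>c\<in>Rad G \<beta>. \<Phi> (unit_vec c) = unit_vec c))"

lemma exp_ad_extends:
  assumes x: "x \<in> coord_space R" shows "extends_to_algebra (exp_ad R br x)"
proof -
  have closed: "bichar.ad_exp x y \<in> coord_space (carrier G)" if "y \<in> coord_space (carrier G)" for y
  proof (rule bichar.ad_exp_coord)
    show "bichar.ad_pow x n y \<in> coord_space (carrier G)" for n
      using that bichar.ad_coord by (cases n) auto
  qed simp
  have eqA: "y = z" if "y \<in> coord_space (carrier G)" "z \<in> coord_space (carrier G)"
    "\<And>c. c \<in> carrier G \<Longrightarrow> y c = z c" for y z :: "'a \<Rightarrow> complex"
    using that by (auto simp: coord_space_def fun_eq_iff) metis
  have cs: "cscale s y \<in> coord_space S" if "y \<in> coord_space S" for s y and S :: "'a set"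
    using that by (simp add: coord_space_def cscale_def)
  show ?thesis
    unfolding extends_to_algebra_def
  proof (intro exI[of _ "bichar.ad_exp x"] conjI ballI allI)
    fix y assume "y \<in> coord_space R"
    thus "bichar.ad_exp x y = exp_ad R br x y" using exp_ad_eq[OF x] by simp
  next
    fix y z :: "'a \<Rightarrow> complex" assume "y \<in> coord_space (carrier G)" "z \<in> coord_space (carrier G)"
    show "bichar.ad_exp x (bichar.tmult y z) = bichar.tmult (bichar.ad_exp x y) (bichar.ad_exp x z)"
      by (rule eqA) (simp_all add: closed bichar.tmult_coord bichar.ad_exp_tmult)
  next
    fix s and y :: "'a \<Rightarrow> complex" assume "y \<in> coord_space (carrier G)"
    thus "bichar.ad_exp x (cscale s y) = cscale s (bichar.ad_exp x y)"
      by (intro eqA) (simp_all add: closed cs bichar.ad_exp_cscale, simp add: cscale_def)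
  next
    fix c assume c: "c \<in> Rad G \<beta>"
    hence "\<xi> b c = \<xi> c b" if "b \<in> carrier G" for b
      using xi_eq_iff[of c b] that by (auto simp: Rad_def)
    thus "bichar.ad_exp x (unit_vec c) = unit_vec c"
      using c by (intro bichar.ad_exp_central) (auto simp: Rad_def)
  qed (use closed in auto)
qed

lemma inner_automorphism_extends:
  assumes "\<phi> \<in> inner_automorphisms R br"
  shows "\<phi> \<in> Bij (coord_space R) \<and> extends_to_algebra \<phi>"
  using assms unfolding inner_automorphisms_def
proof (induction rule: generate.induct)
  case one
  have "extends_to_algebra (\<lambda>y\<in>coord_space R. y)"
    unfolding extends_to_algebra_def by (intro exI[of _ "\<lambda>y. y"]) auto
  moreover have "\<one>\<^bsub>BijGroup (coord_space R)\<^esub> = (\<lambda>y\<in>coord_space R. y)"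
    by (simp add: BijGroup_def)
  ultimately show ?case using id_Bij[of "coord_space R"] by (simp only: simp_thms)
next
  case (incl h)
  thus ?case using exp_ad_Bij exp_ad_extends by blast
next
  case (inv h)
  then obtain x where x: "x \<in> coord_space R" "h = exp_ad R br x" by blast
  have mx: "- x \<in> coord_space R" using x by (intro uminus_coord)
  \<comment> \<open>\<open>generate\<close> inverts generators only, and the inverse of an
    exponential is the exponential of -x.\<close>
  have "inv\<^bsub>BijGroup (coord_space R)\<^esub> h = exp_ad R br (- x)"
  proof (rule group.inv_equality[OF group_BijGroup])
    show "h \<in> carrier (BijGroup (coord_space R))" "exp_ad R br (- x) \<in> carrier (BijGroup (coord_space R))"
      using x mx exp_ad_Bij by (simp_all add: BijGroup_def)
    have "compose (coord_space R) (exp_ad R br (- x)) (exp_ad R br x) = (\<lambda>y\<in>coord_space R. y)"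
    proof
      fix y show "compose (coord_space R) (exp_ad R br (- x)) (exp_ad R br x) y = (\<lambda>y\<in>coord_space R. y) y"
      proof (cases "y \<in> coord_space R")
        case True
        thus ?thesis
          using exp_ad_eq[OF x(1) True] exp_ad_eq[OF mx ad_exp_coord_R[OF x(1) True]] ad_exp_inverse_R[OF x(1) True]
          by (simp add: compose_def)
      qed (simp add: compose_def)
    qed
    thus "exp_ad R br (- x) \<otimes>\<^bsub>BijGroup (coord_space R)\<^esub> h = \<one>\<^bsub>BijGroup (coord_space R)\<^esub>"
      using x mx exp_ad_Bij by (simp add: BijGroup_def)
  qed
  thus ?case using exp_ad_Bij[OF mx] exp_ad_extends[OF mx] by simp
next
  case (eng h1 h2)
  have eq: "h1 \<otimes>\<^bsub>BijGroup (coord_space R)\<^esub> h2 = compose (coord_space R) h1 h2"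
    using eng by (simp add: BijGroup_def)
  have h2: "h2 y \<in> coord_space R" if "y \<in> coord_space R" for y
    using eng that by (auto simp: Bij_def bij_betw_def)
  obtain \<Phi>1 where 1: "\<forall>y\<in>coord_space (carrier G). \<Phi>1 y \<in> coord_space (carrier G)"
     "\<forall>y\<in>coord_space R. \<Phi>1 y = h1 y"
     "\<forall>y\<in>coord_space (carrier G). \<forall>z\<in>coord_space (carrier G).
        \<Phi>1 (bichar.tmult y z) = bichar.tmult (\<Phi>1 y) (\<Phi>1 z)"
     "\<forall>s. \<forall>y\<in>coord_space (carrier G). \<Phi>1 (cscale s y) = cscale s (\<Phi>1 y)"
     "\<forall>c\<in>Rad G \<beta>. \<Phi>1 (unit_vec c) = unit_vec c"
    using eng unfolding extends_to_algebra_def by blast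
  obtain \<Phi>2 where 2: "\<forall>y\<in>coord_space (carrier G). \<Phi>2 y \<in> coord_space (carrier G)"
     "\<forall>y\<in>coord_space R. \<Phi>2 y = h2 y"
     "\<forall>y\<in>coord_space (carrier G). \<forall>z\<in>coord_space (carrier G).
        \<Phi>2 (bichar.tmult y z) = bichar.tmult (\<Phi>2 y) (\<Phi>2 z)"
     "\<forall>s. \<forall>y\<in>coord_space (carrier G). \<Phi>2 (cscale s y) = cscale s (\<Phi>2 y)"
     "\<forall>c\<in>Rad G \<beta>. \<Phi>2 (unit_vec c) = unit_vec c"
    using eng unfolding extends_to_algebra_def by blast
  have "extends_to_algebra (compose (coord_space R) h1 h2)"
    unfolding extends_to_algebra_def
    by (intro exI[of _ "\<lambda>y. \<Phi>1 (\<Phi>2 y)"]) (simp add: 1 2 h2 compose_def)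
  moreover have "compose (coord_space R) h1 h2 \<in> Bij (coord_space R)"
    using eng by (intro compose_Bij) auto
  ultimately show ?case unfolding eq by blast
qed

lemma unit_vec_coord: "a \<in> S \<Longrightarrow> unit_vec a \<in> coord_space S"
  by (auto simp: unit_vec_def coord_space_def)

lemma character_trivial_on_Rad:
  assumes \<sigma>: "\<sigma> \<in> hom G Cstar" and inner: "(\<lambda>x\<in>coord_space R. \<lambda>a. \<sigma> a * x a) \<in> inner_automorphisms R br"
    and c: "c \<in> Rad G \<beta>"
  shows "\<sigma> c = 1"
proof -
  obtain \<Phi> where \<Phi>:
     "\<forall>y\<in>coord_space R. \<Phi> y = (\<lambda>x\<in>coord_space R. \<lambda>a. \<sigma> a * x a) y"
     "\<forall>y\<in>coord_space (carrier G). \<forall>z\<in>coord_space (carrier G).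
        \<Phi> (bichar.tmult y z) = bichar.tmult (\<Phi> y) (\<Phi> z)"
     "\<forall>s. \<forall>y\<in>coord_space (carrier G). \<Phi> (cscale s y) = cscale s (\<Phi> y)"
     "\<forall>c\<in>Rad G \<beta>. \<Phi> (unit_vec c) = unit_vec c"
    using inner_automorphism_extends[OF inner] unfolding extends_to_algebra_def by blast
  have \<sigma>m: "\<sigma> (a \<otimes> b) = \<sigma> a * \<sigma> b" if "a \<in> carrier G" "b \<in> carrier G" for a b
    using \<sigma> that by (simp add: hom_def Cstar_def)
  have \<sigma>0: "\<sigma> a \<noteq> 0" if "a \<in> carrier G" for a
    using \<sigma> that by (auto simp: hom_def Cstar_def Pi_iff)
  have \<sigma>1: "\<sigma> \<one> = 1" using \<sigma>m[of \<one> \<one>] \<sigma>0[of \<one>] by simp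
  have root: "\<Phi> (unit_vec a) = cscale (\<sigma> a) (unit_vec a)" if "a \<in> R" for a
    using \<Phi>(1) unit_vec_coord[OF that] by (auto simp: unit_vec_def cscale_def fun_eq_iff)
  have "\<Phi> (unit_vec a) = cscale (\<sigma> a) (unit_vec a)" if "a \<in> generate G R" for a
    using that
  proof (induction rule: generate.induct)
    case one
    have "\<one> \<in> Rad G \<beta>" by (simp add: Rad_def)
    thus ?case using \<Phi>(4) \<sigma>1 by (simp add: cscale_def)
  next
    case (eng a b)
    have ab: "a \<in> carrier G" "b \<in> carrier G" using eng FRS0_generates by auto
    have u: "unit_vec a \<in> coord_space (carrier G)" "unit_vec b \<in> coord_space (carrier G)"
      "unit_vec (a \<otimes> b) \<in> coord_space (carrier G)"
      using ab by (auto intro!: unit_vec_coord)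
    \<comment> \<open>\<open>u\<^sub>a u\<^sub>b\<close> is a nonzero multiple of the basis vector
      at a + b, so the eigenvalues multiply.\<close>
    have "cscale (\<xi> a b) (\<Phi> (unit_vec (a \<otimes> b))) = \<Phi> (bichar.tmult (unit_vec a) (unit_vec b))"
      using \<Phi>(3) u ab by (simp add: bichar.tmult_unit_vec)
    also have "\<dots> = bichar.tmult (\<Phi> (unit_vec a)) (\<Phi> (unit_vec b))"
      using \<Phi>(2) u by blast
    also have "\<dots> = cscale (\<sigma> a * \<sigma> b) (cscale (\<xi> a b) (unit_vec (a \<otimes> b)))"
      using eng.IH ab by (simp only: bichar.tmult_cscale bichar.tmult_unit_vec)
    finally show ?case
      using bichar.xi_nonzero[OF ab] \<sigma>m[OF ab] by (simp add: cscale_def fun_eq_iff)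
  qed (use root FRS1 in auto)
  moreover have "c \<in> carrier G" using c by (simp add: Rad_def)
  ultimately have "unit_vec c = cscale (\<sigma> c) (unit_vec c)"
    using \<Phi>(4) c FRS0_generates by auto
  hence "unit_vec c c = cscale (\<sigma> c) (unit_vec c) c" by (rule fun_cong)
  thus ?thesis by (simp add: unit_vec_def cscale_def)
qed

end

section \<open>Existence of the type\<close>

text \<open>The span of S is an ideal: if b lies in S and a, b are not orthogonal, then b is not
  orthogonal to a + b either, so a + b lies in S.\<close>

lemma (in root_system_lie) connected_if_simple:
  assumes simple: "simple_lie_algebra R br" and S: "S \<subseteq> R" "S \<noteq> {}"
    and closed: "\<And>a b. a \<in> S \<Longrightarrow> b \<in> R \<Longrightarrow> \<beta> a b \<noteq> 1 \<Longrightarrow> b \<in> S"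
  shows "S = R"
proof -
  have "lie_ideal R br (coord_space S)"
    unfolding lie_ideal_def
  proof (intro conjI ballI)
    show "coord_space S \<subseteq> coord_space R" using S(1) by (auto simp: coord_space_def)
    show "cfun_subspace (coord_space S)"
      by (auto simp: cfun.subspace_def coord_space_def cscale_def)
    fix x y assume "x \<in> coord_space R" and y: "y \<in> coord_space S"
    have "br x y c = 0" if c: "c \<notin> S" for c
      unfolding root_bracket_apply
    proof (intro sum.neutral ballI)
      fix a b assume ab: "a \<in> R" "b \<in> R"
      show "(if c = a \<otimes> b then x a * y b * (\<xi> a b - \<xi> b a) else 0) = 0"
      proof (cases "b \<in> S \<and> \<beta> a b \<noteq> 1")
        case True
        have "\<beta> b a \<noteq> 1" using True ab bichar_eq_1_sym[of a b] by auto
        have "a \<otimes> b \<in> R" using ab True by (intro FRS2) auto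
        moreover have "\<beta> b (a \<otimes> b) \<noteq> 1" using ab \<open>\<beta> b a \<noteq> 1\<close> by simp
        ultimately have "a \<otimes> b \<in> S" using closed[of b "a \<otimes> b"] True by blast
        thus ?thesis using c by auto
      next
        case False
        thus ?thesis using y ab xi_eq_iff[of a b] by (auto simp: coord_space_def)
      qed
    qed
    thus "br x y \<in> coord_space S" by (simp add: coord_space_def)
  qed
  hence "coord_space S = {0} \<or> coord_space S = coord_space R"
    using simple by (simp add: simple_lie_algebra_def)
  thus ?thesis
  proof
    assume *: "coord_space S = {0}"
    obtain a where "a \<in> S" using S(2) by blast
    hence "unit_vec a = (0 :: 'a \<Rightarrow> complex)" using unit_vec_coord[of a S] * by blast
    hence "unit_vec a a = (0 :: 'a \<Rightarrow> complex) a" by (rule fun_cong)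
    thus ?thesis by (simp add: unit_vec_def)
  next
    assume *: "coord_space S = coord_space R"
    have "r \<in> S" if "r \<in> R" for r
    proof -
      have "unit_vec r \<in> coord_space S" using unit_vec_coord[OF that] * by blast
      thus ?thesis by (auto simp: coord_space_def unit_vec_def)
    qed
    thus ?thesis using S(1) by blast
  qed
qed

text \<open>All characters of G act by inner automorphisms and are thus trivial on the radical, yet
  characters separate the elements of G.\<close>

lemma (in root_system_lie) nonsingular_if_good_inner:
  assumes "good_inner_standard_grading G \<xi> R" shows "nonsingular G \<beta>"
proof -
  have "c = \<one>" if c: "c \<in> Rad G \<beta>" for c
  proof (rule ccontr)
    assume "c \<noteq> \<one>"
    moreover have "c \<in> carrier G" using c by (simp add: Rad_def)
    ultimately obtain \<sigma> where \<sigma>: "\<sigma> \<in> hom G Cstar" "\<sigma> c \<noteq> 1"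
      using characters_separate[OF finite_carrier] by blast
    hence "(\<lambda>x\<in>coord_space R. \<lambda>a. \<sigma> a * x a) \<in> inner_automorphisms R br"
      using assms unfolding good_inner_standard_grading_def maximal_quasitorus_in_def dual_group_action_def
      by blast
    thus False using character_trivial_on_Rad[OF \<sigma>(1) _ c] \<sigma>(2) by blast
  qed
  moreover have "\<one> \<in> Rad G \<beta>" by (simp add: Rad_def)
  ultimately show ?thesis unfolding nonsingular_def by blast
qed

lemma (in connected_root_system) listed_type_exists:
  "\<exists>\<tau>\<in>listed_types. of_type \<tau> G \<beta> R"
proof (cases "R = carrier G - {\<one>}")
  case True
  have "carrier G \<noteq> {\<one>}"
    using nontrivial by (auto simp: Rad_def)
  then obtain ns where "divisor_chain ns" "of_type (TypeI ns) G \<beta> R"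
    using type_I_if_all_roots[OF finite_carrier nonsingular _ True] by blast
  thus ?thesis unfolding listed_types_def by blast
next
  case not_all: False
  hence "\<forall>x\<in>carrier G. x \<otimes> x = \<one>" using elementary_or_all_roots by blast
  then interpret elementary_root_system G \<beta> R
    by unfold_locales blast
  have nc: "\<not> collinear a b" for a b
    using all_roots_if_collinear not_all by blast
  show ?thesis
  proof (cases "\<exists>x w1 w2 w3. x \<in> R \<and> w1 \<in> R \<and> w2 \<in> R \<and> w3 \<in> R \<and> adj x w1 \<and> adj x w2 \<and> adj x w3 \<and>
      \<not> adj w1 w2 \<and> \<not> adj w1 w3 \<and> \<not> adj w2 w3 \<and> w1 \<noteq> w2 \<and> w1 \<noteq> w3 \<and> w2 \<noteq> w3")
    case True
    then obtain x w1 w2 w3 where claw: "x \<in> R" "w1 \<in> R" "w2 \<in> R" "w3 \<in> R" "adj x w1" "adj x w2" "adj x w3"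
      "\<not> adj w1 w2" "\<not> adj w1 w3" "\<not> adj w2 w3" "w1 \<noteq> w2" "w1 \<noteq> w3" "w2 \<noteq> w3" by blast
    have "16 < card (carrier G)"
      by (rule card_gt_16_if_claw[OF nc claw(2-4,8-13)])
    then obtain k where "k \<ge> 3" "of_type (TypeIII k) G \<beta> R \<or> of_type (TypeV k) G \<beta> R"
      using type_III_or_V[OF quadratic_if_claw[OF nc claw]] by blast
    thus ?thesis unfolding listed_types_def by blast
  next
    case False
    show ?thesis
    proof (rule clique_if_no_claw)
      fix x w1 w2 w3
      assume *: "x \<in> R" "w1 \<in> R" "w2 \<in> R" "w3 \<in> R" "adj x w1" "adj x w2" "adj x w3"
        "\<not> adj w1 w2" "\<not> adj w1 w3" "\<not> adj w2 w3" "w1 \<noteq> w2" "w1 \<noteq> w3" "w2 \<noteq> w3"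
      show False
        using False by (rule notE) (intro exI[of _ x] exI[of _ w1] exI[of _ w2] exI[of _ w3] conjI *)
    next
      fix K assume K: "K \<subseteq> R" "\<And>a b. a \<in> K \<Longrightarrow> b \<in> K \<Longrightarrow> a \<noteq> b \<Longrightarrow> adj a b"
        "R = K \<union> {a \<otimes> b | a b. a \<in> K \<and> b \<in> K \<and> a \<noteq> b}" "2 \<le> card K"
      have "card K \<noteq> 2 \<and> card K \<noteq> 3 \<and> card K \<noteq> 5"
        by (rule clique_card[OF nc not_all K])
      hence "card K > 3" "card K \<noteq> 5" using K(4) by auto
      from type_II_or_IV[OF K(1-3) this] show ?thesis
        unfolding listed_types_def by blast
    qed
  qed
qed

section \<open>Uniqueness of the type\<close>

lemma even_sum_cong:
  fixes f g :: "'i \<Rightarrow> int"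
  shows "(\<And>i. i \<in> I \<Longrightarrow> even (f i) \<longleftrightarrow> even (g i)) \<Longrightarrow> even (sum f I) \<longleftrightarrow> even (sum g I)"
  by (induction I rule: infinite_finite_induct) auto

lemma II_bichar_sym: "II_bichar n a b = II_bichar n b a"
  by (simp add: II_bichar_def mult.commute)

lemma II_bichar_mult_left:
  assumes "a \<in> carrier (II_group n)" "a' \<in> carrier (II_group n)"
  shows "II_bichar n (a \<otimes>\<^bsub>Z2n n\<^esub> a') b = II_bichar n a b * II_bichar n a' b"
proof -
  have aa: "even (\<Sum>i=1..n. (a \<otimes>\<^bsub>Z2n n\<^esub> a') i)"
    using II_group_even[OF assms(1)] II_group_even[OF assms(2)] even_sum_mult_Z2n[of n a a'] by simp
  have "even (\<Sum>i=1..n. (a \<otimes>\<^bsub>Z2n n\<^esub> a') i * b i) \<longleftrightarrow> even (\<Sum>i=1..n. a i * b i + a' i * b i)"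
    by (rule even_sum_cong) (auto simp: mult_Z2n distrib_right[symmetric])
  thus ?thesis
    unfolding II_bichar_even[OF aa] II_bichar_even[OF II_group_even[OF assms(1)]]
      II_bichar_even[OF II_group_even[OF assms(2)]]
    by (auto simp: sum.distrib)
qed

lemma alternating_II_group: "alternating_group (II_group n) (II_bichar n)"
proof -
  have "comm_group (Z2n n)"
    by (rule group.group_comm_groupI[OF group_Z2n]) (simp add: Z2n_def add.commute)
  hence cg: "comm_group (II_group n)"
    unfolding II_group_def by (rule group.abelian_subgroup_generated[OF group_Z2n])
  have nz: "II_bichar n a b \<noteq> 0" for a b
    by (simp add: II_bichar_def)
  have "alternating_bicharacter (II_group n) (II_bichar n)"
    unfolding alternating_bicharacter_def bicharacter_def
  proof (intro conjI ballI)
    fix a assume a: "a \<in> carrier (II_group n)"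
    show "(\<lambda>b. II_bichar n b a) \<in> hom (II_group n) Cstar"
      using nz by (auto simp: hom_def Cstar_def II_bichar_mult_left)
    thus "(\<lambda>b. II_bichar n a b) \<in> hom (II_group n) Cstar"
      by (subst II_bichar_sym)
    have "a \<in> carrier (Z2n n)" using a II_group_subset by blast
    hence "a i * a i = a i" if "i \<in> {1..n}" for i
      using Z2n_entry[of a n i] that by auto
    hence "(\<Sum>i=1..n. a i * a i) = (\<Sum>i=1..n. a i)" by (intro sum.cong) auto
    thus "II_bichar n a a = 1"
      using II_bichar_even[OF II_group_even[OF a]] II_group_even[OF a] by simp
  qed
  thus ?thesis
    using cg by (simp add: alternating_group_def alternating_group_axioms_def)
qed

text \<open>An invariant that tells type I from types II and IV.\<close>

definition all_sums_roots :: "('a, 'm) monoid_scheme \<Rightarrow> 'a set \<Rightarrow> bool" where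
  "all_sums_roots G R \<longleftrightarrow> (\<forall>x\<in>R. \<forall>y\<in>R. x \<otimes>\<^bsub>G\<^esub> y \<in> insert \<one>\<^bsub>G\<^esub> R)"

text \<open>An invariant that tells types III and V from types II and IV, with two exceptions: five
  points carry no three disjoint transpositions, and among eight points the sum of three is
  congruent to the fourth.\<close>

definition orthogonal_triples_roots ::
  "('a, 'm) monoid_scheme \<Rightarrow> ('a \<Rightarrow> 'a \<Rightarrow> complex) \<Rightarrow> 'a set \<Rightarrow> bool" where
  "orthogonal_triples_roots G \<beta> R \<longleftrightarrow>
     (\<forall>x\<in>R. \<forall>y\<in>R. \<forall>z\<in>R. x \<noteq> y \<and> x \<noteq> z \<and> y \<noteq> z \<and> \<beta> x y = 1 \<and> \<beta> x z = 1 \<and> \<beta> y z = 1 \<longrightarrow>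
        x \<otimes>\<^bsub>G\<^esub> y \<otimes>\<^bsub>G\<^esub> z \<in> R)"

text \<open>The common structure of types \<open>II\<close> and \<open>IV\<close>: the roots are the images of the \<open>e\<^sub>i + e\<^sub>j\<close>.\<close>

locale symmetric_frame = G: group G for G :: "('a, 'm) monoid_scheme" +
  fixes \<beta> :: "'a \<Rightarrow> 'a \<Rightarrow> complex" and R :: "'a set" and n :: nat and \<rho> :: "(nat \<Rightarrow> int) \<Rightarrow> 'a"
  assumes hom: "\<rho> \<in> hom (II_group n) G"
    and image: "\<rho> ` II_roots n = R"
    and ker: "\<And>a. a \<in> carrier (II_group n) \<Longrightarrow> \<rho> a = \<one>\<^bsub>G\<^esub> \<Longrightarrow> a \<in> Rad (II_group n) (II_bichar n)"
    and isometry: "\<And>a b. a \<in> carrier (II_group n) \<Longrightarrow> b \<in> carrier (II_group n) \<Longrightarrow>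
      \<beta> (\<rho> a) (\<rho> b) = II_bichar n a b"
    and size: "odd n \<and> n \<ge> 5 \<or> n \<ge> 8"
begin

sublocale M: alternating_group "II_group n" "II_bichar n"
  by (rule alternating_II_group)

text \<open>Radical elements are constant. The all-ones vector is ruled out by its odd weight for
  odd n, and by a zero entry otherwise.\<close>

lemma Rad_trivial:
  assumes a: "a \<in> Rad (II_group n) (II_bichar n)" and 0: "odd n \<or> (\<exists>i. 1 \<le> i \<and> i \<le> n \<and> a i = 0)"
  shows "a = \<one>\<^bsub>II_group n\<^esub>"
proof -
  have aM: "a \<in> carrier (II_group n)" using a by (simp add: Rad_def)
  hence aZ: "a \<in> carrier (Z2n n)" using II_group_subset by blast
  have n: "1 \<le> n" using size by auto
  have const: "a i = a 1" if "1 \<le> i" "i \<le> n" for i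
    by (rule Rad_II_group_const[OF a]) (use that n in auto)
  have a1: "a 1 = 0"
  proof (cases "odd n")
    case True
    have "(\<Sum>i=1..n. a i) = (\<Sum>i=1..n. a 1)"
    proof (rule sum.cong)
      fix i assume "i \<in> {1..n}" thus "a i = a 1" using const[of i] by simp
    qed simp
    hence "even (a 1)" using II_group_even[OF aM] True by simp
    thus ?thesis using Z2n_entry[OF aZ, of 1] n by auto
  next
    case False
    then obtain i where "1 \<le> i" "i \<le> n" "a i = 0" using 0 by auto
    thus ?thesis using const[of i] by simp
  qed
  have "a = \<one>\<^bsub>Z2n n\<^esub>"
  proof (rule Z2n_ext[OF aZ])
    show "a i = \<one>\<^bsub>Z2n n\<^esub> i" if "1 \<le> i" "i \<le> n" for i
      using const[OF that] a1 one_Z2n[OF that] by simp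
  qed (simp add: group.is_monoid[OF group_Z2n] monoid.one_closed)
  thus ?thesis by simp
qed

lemma \<rho>_mult: "a \<in> carrier (II_group n) \<Longrightarrow> b \<in> carrier (II_group n) \<Longrightarrow>
    \<rho> (a \<otimes>\<^bsub>Z2n n\<^esub> b) = \<rho> a \<otimes>\<^bsub>G\<^esub> \<rho> b"
  using hom_mult[OF hom, of a b] by simp

lemma \<rho>_closed: "a \<in> carrier (II_group n) \<Longrightarrow> \<rho> a \<in> carrier G"
  using hom by (auto simp: hom_def)

lemma closed: "a \<in> carrier (II_group n) \<Longrightarrow> b \<in> carrier (II_group n) \<Longrightarrow> a \<otimes>\<^bsub>Z2n n\<^esub> b \<in> carrier (II_group n)"
  using M.m_closed[of a b] by simp

text \<open>a + b lies in the radical, and an index where a and b agree is a zero entry of a +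
  b.\<close>

lemma \<rho>_eq_imp:
  assumes a: "a \<in> carrier (II_group n)" and b: "b \<in> carrier (II_group n)" and eq: "\<rho> a = \<rho> b"
    and i: "odd n \<or> (\<exists>i. 1 \<le> i \<and> i \<le> n \<and> a i = b i)"
  shows "a = b"
proof -
  interpret \<rho>: group_hom "II_group n" G \<rho>
    using hom by unfold_locales
  have bZ: "b \<in> carrier (Z2n n)" "a \<in> carrier (Z2n n)" using a b II_group_subset by blast+
  have "b \<otimes>\<^bsub>Z2n n\<^esub> b = \<one>\<^bsub>Z2n n\<^esub>"
    using group.r_inv[OF group_Z2n bZ(1)] inv_Z2n[OF bZ(1)] by simp
  hence ib: "inv\<^bsub>II_group n\<^esub> b = b"
    using b by (intro M.inv_equality) simp_all
  have "inv\<^bsub>G\<^esub> \<rho> b = \<rho> b"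
    using \<rho>.hom_inv[OF b] ib by simp
  hence "\<rho> b \<otimes>\<^bsub>G\<^esub> \<rho> b = \<one>\<^bsub>G\<^esub>"
    using G.r_inv[OF \<rho>_closed[OF b]] by simp
  hence "\<rho> (a \<otimes>\<^bsub>II_group n\<^esub> inv\<^bsub>II_group n\<^esub> b) = \<one>\<^bsub>G\<^esub>"
    using a b eq by (simp add: \<rho>_mult ib)
  hence R: "a \<otimes>\<^bsub>II_group n\<^esub> b \<in> Rad (II_group n) (II_bichar n)"
    using ker[of "a \<otimes>\<^bsub>II_group n\<^esub> b"] closed[OF a b] ib by simp
  have "a \<otimes>\<^bsub>II_group n\<^esub> b = \<one>\<^bsub>II_group n\<^esub>"
  proof (rule Rad_trivial[OF R])
    show "odd n \<or> (\<exists>i. 1 \<le> i \<and> i \<le> n \<and> (a \<otimes>\<^bsub>II_group n\<^esub> b) i = 0)"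
      using i Z2n_entry[OF bZ(1)] by (fastforce simp: mult_Z2n)
  qed
  hence "a \<otimes>\<^bsub>II_group n\<^esub> inv\<^bsub>II_group n\<^esub> b = \<one>\<^bsub>II_group n\<^esub>" using ib by simp
  thus ?thesis using a b M.inv_equality M.inv_inv by (metis M.inv_closed)
qed

lemma root_in: "1 \<le> i \<Longrightarrow> i \<le> n \<Longrightarrow> 1 \<le> j \<Longrightarrow> j \<le> n \<Longrightarrow> i \<noteq> j \<Longrightarrow>
    II_root n i j \<in> carrier (II_group n) \<and> \<rho> (II_root n i j) \<in> R"
  using II_root_in_roots II_roots_subset image by blast

text \<open>Supports identify the e_i + e_j with two-element sets. The map \<open>\<rho>\<close>
  keeps them apart, because two of them involve at most four of at least five indices.\<close>

lemma card_roots: "card R = n choose 2"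
proof -
  define supp where "supp r = {l \<in> {1..n}. r l = (1::int)}" for r
  have supp: "supp (II_root n i j) = {i, j}" if "1 \<le> i" "i < j" "j \<le> n" for i j
    using that by (auto simp: supp_def II_root_entry split: if_splits)
  have "bij_betw supp (II_roots n) {B. B \<subseteq> {1..n} \<and> card B = 2}"
  proof (rule bij_betw_imageI)
    show "inj_on supp (II_roots n)"
    proof (rule inj_onI)
      fix r s assume *: "r \<in> II_roots n" "s \<in> II_roots n" "supp r = supp s"
      hence Z: "r \<in> carrier (Z2n n)" "s \<in> carrier (Z2n n)" using II_roots_carrier by blast+
      show "r = s"
      proof (rule Z2n_ext[OF Z])
        fix i assume i: "1 \<le> i" "i \<le> n"
        have "i \<in> supp r \<longleftrightarrow> i \<in> supp s" using *(3) by simp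
        hence "r i = 1 \<longleftrightarrow> s i = 1" using i by (simp add: supp_def)
        thus "r i = s i" using Z2n_entry[OF Z(1) i] Z2n_entry[OF Z(2) i] by auto
      qed
    qed
    show "supp ` II_roots n = {B. B \<subseteq> {1..n} \<and> card B = 2}"
    proof
      show "supp ` II_roots n \<subseteq> {B. B \<subseteq> {1..n} \<and> card B = 2}"
      proof (rule image_subsetI)
        fix r assume "r \<in> II_roots n"
        then obtain i j where ij: "r = II_root n i j" "1 \<le> i" "i < j" "j \<le> n" by (auto simp: II_roots_alt)
        hence "supp r = {i, j}" using supp by blast
        thus "supp r \<in> {B. B \<subseteq> {1..n} \<and> card B = 2}" using ij by simp
      qed
      show "{B. B \<subseteq> {1..n} \<and> card B = 2} \<subseteq> supp ` II_roots n"
      proof clarify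
        fix B assume B: "B \<subseteq> {1..n}" "card B = 2"
        then obtain i j where ij: "B = {i, j}" "i < j"
          by (metis card_2_iff insert_commute linorder_neqE_nat)
        hence "B = supp (II_root n i j)" "II_root n i j \<in> II_roots n"
          using B supp[of i j] II_root_in_roots[of i n j] by auto
        thus "B \<in> supp ` II_roots n" by blast
      qed
    qed
  qed
  hence "card (II_roots n) = n choose 2"
    using n_subsets[of "{1..n}" 2] bij_betw_same_card by fastforce
  moreover have "inj_on \<rho> (II_roots n)"
  proof (rule inj_onI)
    fix r s assume rs: "r \<in> II_roots n" "s \<in> II_roots n" and eq: "\<rho> r = \<rho> s"
    obtain i j where r: "r = II_root n i j" "1 \<le> i" "i < j" "j \<le> n" using rs by (auto simp: II_roots_alt)
    obtain i' j' where s: "s = II_root n i' j'" "1 \<le> i'" "i' < j'" "j' \<le> n" using rs by (auto simp: II_roots_alt)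
    have "card {i, j, i', j'} \<le> 4" by (simp add: card_insert_if)
    hence "card {i, j, i', j'} < card {1..n}" using size by auto
    hence "\<not> {1..n} \<subseteq> {i, j, i', j'}" using card_mono[of "{i, j, i', j'}" "{1..n}"] by auto
    then obtain l where l: "l \<in> {1..n}" "l \<notin> {i, j, i', j'}" by blast
    hence "r l = s l" using r s by (simp add: II_root_entry)
    thus "r = s" using \<rho>_eq_imp[OF _ _ eq] rs II_roots_subset l by (meson atLeastAtMost_iff subsetD)
  qed
  ultimately show ?thesis using image card_image by metis
qed

text \<open>The parity of \<open>n\<close> or an index outside all supports excludes that a sum of disjoint roots is congruent to
  a root modulo the radical.\<close>

lemma sum_not_root:
  assumes a: "a \<in> carrier (II_group n)" and w: "(\<Sum>i=1..n. a i) > 2"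
    and S: "{l \<in> {1..n}. a l \<noteq> 0} \<subseteq> S" "finite S" "odd n \<or> card S + 2 < n"
  shows "\<rho> a \<notin> R"
proof
  assume "\<rho> a \<in> R"
  then obtain r where r: "r \<in> II_roots n" "\<rho> a = \<rho> r" using image by blast
  then obtain i j where ij: "r = II_root n i j" "1 \<le> i" "i < j" "j \<le> n" by (auto simp: II_roots_alt)
  have "a = r"
  proof (rule \<rho>_eq_imp[OF a _ r(2)])
    show "r \<in> carrier (II_group n)" using r II_roots_subset by blast
    show "odd n \<or> (\<exists>l. 1 \<le> l \<and> l \<le> n \<and> a l = r l)"
    proof (cases "odd n")
      case False
      hence "card S + 2 < n" using S(3) by blast
      moreover have "card (insert i (insert j S)) \<le> card S + 2"
        using S(2) by (simp add: card_insert_if)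
      ultimately have "card (insert i (insert j S)) < card {1..n}" by simp
      hence "\<not> {1..n} \<subseteq> insert i (insert j S)"
        using card_mono[of "insert i (insert j S)" "{1..n}"] S(2) by auto
      then obtain l where l: "l \<in> {1..n}" "l \<notin> insert i (insert j S)" by blast
      hence "a l = 0" "r l = 0" using S(1) ij by (auto simp: II_root_entry)
      thus ?thesis using l by auto
    qed simp
  qed
  thus False using w ij sum_II_root(1)[of i n j] by simp
qed

lemma not_all_sums: "\<not> all_sums_roots G R"
proof
  assume *: "all_sums_roots G R"
  have n5: "n \<ge> 5" using size by auto
  \<comment> \<open>Two disjoint transpositions: their sum has weight 4, and the entries 1 and 5
    differ, so it is neither a root nor 0 modulo the radical.\<close>
  define a b where "a = II_root n 1 2" and "b = II_root n 3 4"
  have ab: "a \<in> carrier (II_group n)" "b \<in> carrier (II_group n)" "\<rho> a \<in> R" "\<rho> b \<in> R"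
    using root_in[of 1 2] root_in[of 3 4] n5 by (auto simp: a_def b_def)
  have entry: "(a \<otimes>\<^bsub>Z2n n\<^esub> b) l = a l + b l" if "l \<in> {1..n}" for l
    using that by (auto simp: a_def b_def mult_Z2n II_root_entry)
  have "(\<Sum>l=1..n. (a \<otimes>\<^bsub>Z2n n\<^esub> b) l) = (\<Sum>l=1..n. a l) + (\<Sum>l=1..n. b l)"
    unfolding sum.distrib[symmetric] by (rule sum.cong) (simp_all add: entry)
  hence w: "(\<Sum>l=1..n. (a \<otimes>\<^bsub>Z2n n\<^esub> b) l) = 4"
    using sum_II_root(1)[of 1 n 2] sum_II_root(1)[of 3 n 4] n5 by (simp add: a_def b_def)
  have S: "{l \<in> {1..n}. (a \<otimes>\<^bsub>Z2n n\<^esub> b) l \<noteq> 0} \<subseteq> {1, 2, 3, 4}"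
    using entry by (auto simp: a_def b_def II_root_entry split: if_splits)
  have c: "a \<otimes>\<^bsub>Z2n n\<^esub> b \<in> carrier (II_group n)" using closed ab by blast
  have "\<rho> (a \<otimes>\<^bsub>Z2n n\<^esub> b) \<notin> R"
    by (rule sum_not_root[OF c _ S]) (use size w in auto)
  moreover have "\<rho> (a \<otimes>\<^bsub>Z2n n\<^esub> b) \<noteq> \<one>\<^bsub>G\<^esub>"
  proof
    assume "\<rho> (a \<otimes>\<^bsub>Z2n n\<^esub> b) = \<one>\<^bsub>G\<^esub>"
    hence "a \<otimes>\<^bsub>Z2n n\<^esub> b \<in> Rad (II_group n) (II_bichar n)" using ker c by blast
    hence "(a \<otimes>\<^bsub>Z2n n\<^esub> b) 1 = (a \<otimes>\<^bsub>Z2n n\<^esub> b) 5"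
      by (rule Rad_II_group_const) (use n5 in auto)
    hence "a 1 + b 1 = a 5 + b 5" using n5 entry[of 1] entry[of 5] by simp
    thus False using n5 by (simp add: a_def b_def II_root_entry)
  qed
  ultimately show False using * ab \<rho>_mult[OF ab(1,2)] by (auto simp: all_sums_roots_def)
qed

text \<open>Three disjoint transpositions sum to weight 6. For even n the bound 10 leaves an index
  outside them and any further root; for n = 8 the sum would be complementary, hence congruent, to
  e_7 + e_8.\<close>

lemma not_orthogonal_triples:
  assumes n: "odd n \<and> n \<ge> 7 \<or> n \<ge> 10" shows "\<not> orthogonal_triples_roots G \<beta> R"
proof
  assume *: "orthogonal_triples_roots G \<beta> R"
  have n7: "n \<ge> 7" using n by auto
  define a b d where "a = II_root n 1 2" and "b = II_root n 3 4" and "d = II_root n 5 6"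
  have abd: "a \<in> carrier (II_group n)" "b \<in> carrier (II_group n)" "d \<in> carrier (II_group n)"
      "\<rho> a \<in> R" "\<rho> b \<in> R" "\<rho> d \<in> R"
    using root_in[of 1 2] root_in[of 3 4] root_in[of 5 6] n7 by (auto simp: a_def b_def d_def)
  have orth: "\<beta> (\<rho> a) (\<rho> b) = 1" "\<beta> (\<rho> a) (\<rho> d) = 1" "\<beta> (\<rho> b) (\<rho> d) = 1"
    using isometry abd(1-3) n7 by (simp_all add: a_def b_def d_def II_bichar_root II_root_entry)
  have ne: "\<rho> x \<noteq> \<rho> y" if "x \<in> carrier (II_group n)" "y \<in> carrier (II_group n)" "x 7 = y 7" "x l \<noteq> y l" for x y l
  proof
    assume "\<rho> x = \<rho> y"
    moreover have "\<exists>i. 1 \<le> i \<and> i \<le> n \<and> x i = y i" using that(3) n7 by (intro exI[of _ 7]) simp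
    ultimately have "x = y" using \<rho>_eq_imp[OF that(1,2)] by blast
    thus False using that(4) by simp
  qed
  have ne3: "\<rho> a \<noteq> \<rho> b" "\<rho> a \<noteq> \<rho> d" "\<rho> b \<noteq> \<rho> d"
    using ne[OF abd(1,2), of 1] ne[OF abd(1,3), of 1] ne[OF abd(2,3), of 3] n7
    by (simp_all add: a_def b_def d_def II_root_entry)
  have entry: "(a \<otimes>\<^bsub>Z2n n\<^esub> b \<otimes>\<^bsub>Z2n n\<^esub> d) l = a l + b l + d l" if "l \<in> {1..n}" for l
    using that by (auto simp: a_def b_def d_def mult_Z2n II_root_entry)
  have "(\<Sum>l=1..n. (a \<otimes>\<^bsub>Z2n n\<^esub> b \<otimes>\<^bsub>Z2n n\<^esub> d) l) = (\<Sum>l=1..n. a l) + (\<Sum>l=1..n. b l) + (\<Sum>l=1..n. d l)"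
    unfolding sum.distrib[symmetric] by (rule sum.cong) (simp_all add: entry)
  hence w: "(\<Sum>l=1..n. (a \<otimes>\<^bsub>Z2n n\<^esub> b \<otimes>\<^bsub>Z2n n\<^esub> d) l) = 6"
    using sum_II_root(1)[of 1 n 2] sum_II_root(1)[of 3 n 4] sum_II_root(1)[of 5 n 6] n7
    by (simp add: a_def b_def d_def)
  have S: "{l \<in> {1..n}. (a \<otimes>\<^bsub>Z2n n\<^esub> b \<otimes>\<^bsub>Z2n n\<^esub> d) l \<noteq> 0} \<subseteq> {1, 2, 3, 4, 5, 6}"
    using entry by (auto simp: a_def b_def d_def II_root_entry split: if_splits)
  have "\<rho> (a \<otimes>\<^bsub>Z2n n\<^esub> b \<otimes>\<^bsub>Z2n n\<^esub> d) \<notin> R"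
    by (rule sum_not_root[OF _ _ S]) (use n w abd closed in auto)
  thus False
    using * abd orth ne3 closed[OF abd(1,2)] by (auto simp: orthogonal_triples_roots_def \<rho>_mult)
qed

end

lemma type_II_frame:
  assumes G: "group G" and k: "k \<ge> 2" and type: "of_type (TypeII k) G \<beta> R" and R: "R \<subseteq> carrier G"
  obtains \<rho> where "symmetric_frame G \<beta> R (2*k+1) \<rho>"
proof -
  interpret G: group G by fact
  define n where "n = 2*k+1"
  obtain h where h: "h \<in> iso G (II_group n)"
    "\<And>a b. a \<in> carrier G \<Longrightarrow> b \<in> carrier G \<Longrightarrow> II_bichar n (h a) (h b) = \<beta> a b" "h ` R = II_roots n"
    using type by (auto simp: frs_isomorphic_def n_def)
  define \<rho> where "\<rho> = inv_into (carrier G) h"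
  have \<rho>: "\<rho> \<in> iso (II_group n) G" unfolding \<rho>_def using h(1) by (rule G.iso_set_sym)
  have bij: "bij_betw h (carrier G) (carrier (II_group n))" using h(1) by (simp add: iso_def)
  have \<rho>c: "\<rho> a \<in> carrier G" "h (\<rho> a) = a" if "a \<in> carrier (II_group n)" for a
    using that bij unfolding \<rho>_def by (auto simp: bij_betw_def inv_into_into f_inv_into_f)
  have "symmetric_frame G \<beta> R n \<rho>"
  proof unfold_locales
    show "\<rho> \<in> hom (II_group n) G" using \<rho> by (simp add: iso_def)
    show "\<rho> ` II_roots n = R"
      unfolding h(3)[symmetric] \<rho>_def using R bij by (intro inv_into_image_cancel) (auto simp: bij_betw_def)
    show "\<beta> (\<rho> a) (\<rho> b) = II_bichar n a b" if "a \<in> carrier (II_group n)" "b \<in> carrier (II_group n)" for a b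
      using h(2)[of "\<rho> a" "\<rho> b"] \<rho>c that by simp
    show "odd n \<and> n \<ge> 5 \<or> n \<ge> 8" using k by (simp add: n_def)
    fix a assume a: "a \<in> carrier (II_group n)" "\<rho> a = \<one>\<^bsub>G\<^esub>"
    have "h \<one>\<^bsub>G\<^esub> = \<one>\<^bsub>II_group n\<^esub>"
      using h(1) by (intro hom_one[OF _ G group_II_group]) (simp add: iso_def)
    hence "a = \<one>\<^bsub>II_group n\<^esub>" using \<rho>c(2)[OF a(1)] a(2) by simp
    moreover interpret M: alternating_group "II_group n" "II_bichar n" by (rule alternating_II_group)
    have "\<one>\<^bsub>II_group n\<^esub> \<in> Rad (II_group n) (II_bichar n)"
      using M.bichar_one_left by (simp add: Rad_def del: one_II_group)
    ultimately show "a \<in> Rad (II_group n) (II_bichar n)" by simp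
  qed
  thus thesis using that by (simp add: n_def)
qed

text \<open>The frame is the coset map followed by the inverse of the isomorphism.
  \<open>IV_bichar\<close> is single-valued because elements of the radical pair to 1.\<close>

lemma type_IV_frame:
  assumes G: "group G" and k: "k \<ge> 4" and type: "of_type (TypeIV k) G \<beta> R" and R: "R \<subseteq> carrier G"
  obtains \<rho> where "symmetric_frame G \<beta> R (2*k) \<rho>"
proof -
  interpret G: group G by fact
  define n where "n = 2*k"
  interpret M: alternating_group "II_group n" "II_bichar n" by (rule alternating_II_group)
  let ?Rad = "Rad (II_group n) (II_bichar n)"
  have sub: "subgroup ?Rad (II_group n)" by (rule M.Rad_subgroup)
  hence nrm: "?Rad \<lhd> II_group n" by (rule M.subgroup_imp_normal)
  have grp: "group (IV_group n)"
    unfolding IV_group_def by (rule normal.factorgroup_is_group[OF nrm])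
  obtain h where h: "h \<in> iso G (IV_group n)"
    "\<And>a b. a \<in> carrier G \<Longrightarrow> b \<in> carrier G \<Longrightarrow> IV_bichar n (h a) (h b) = \<beta> a b" "h ` R = IV_roots n"
    using type by (auto simp: frs_isomorphic_def n_def)
  define g where "g = inv_into (carrier G) h"
  have g: "g \<in> iso (IV_group n) G" unfolding g_def using h(1) by (rule G.iso_set_sym)
  have bij: "bij_betw h (carrier G) (carrier (IV_group n))" using h(1) by (simp add: iso_def)
  have gc: "g a \<in> carrier G" "h (g a) = a" if "a \<in> carrier (IV_group n)" for a
    using that bij unfolding g_def by (auto simp: bij_betw_def inv_into_into f_inv_into_f)
  define co where "co a = ?Rad #>\<^bsub>II_group n\<^esub> a" for a
  have co: "co \<in> hom (II_group n) (IV_group n)"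
    unfolding co_def IV_group_def by (rule normal.r_coset_hom_Mod[OF nrm])
  have coc: "co a \<in> carrier (IV_group n)" if "a \<in> carrier (II_group n)" for a
    using co that by (auto simp: hom_def)
  have self: "a \<in> co a" if "a \<in> carrier (II_group n)" for a
    unfolding co_def using M.rcos_self[OF that sub] .
  have bich: "IV_bichar n (co a) (co b) = II_bichar n a b"
    if a: "a \<in> carrier (II_group n)" and b: "b \<in> carrier (II_group n)" for a b
  proof -
    have const: "II_bichar n x y = II_bichar n a b" if "x \<in> co a" "y \<in> co b" for x y
    proof -
      obtain z w where zw: "z \<in> ?Rad" "w \<in> ?Rad" "x = z \<otimes>\<^bsub>II_group n\<^esub> a" "y = w \<otimes>\<^bsub>II_group n\<^esub> b"
        using \<open>x \<in> co a\<close> \<open>y \<in> co b\<close> unfolding co_def r_coset_def by auto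
      have zc: "z \<in> carrier (II_group n)" "w \<in> carrier (II_group n)" using zw by (auto simp: Rad_def)
      have "II_bichar n z y = 1" if "y \<in> carrier (II_group n)" for y using zw that by (simp add: Rad_def)
      moreover have "II_bichar n a w = 1" using zw a by (simp add: Rad_def II_bichar_sym[of n a])
      ultimately show ?thesis
        unfolding zw(3,4) using zc a b M.m_closed[OF zc(2) b]
        by (simp del: mult_II_group)
    qed
    have "(\<lambda>(x, y). II_bichar n x y) ` (co a \<times> co b) = (\<lambda>_. II_bichar n a b) ` (co a \<times> co b)"
      using const by (intro image_cong) auto
    also have "\<dots> = {II_bichar n a b}"
      using self a b by (intro image_constant[of "(a, b)"]) auto
    finally show ?thesis by (simp add: IV_bichar_def)
  qed
  have "symmetric_frame G \<beta> R n (\<lambda>a. g (co a))"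
  proof unfold_locales
    have "g \<in> hom (IV_group n) G" using g by (simp add: iso_def)
    from hom_compose[OF co this] show "(\<lambda>a. g (co a)) \<in> hom (II_group n) G"
      by (simp add: comp_def)
    have "(\<lambda>a. g (co a)) ` II_roots n = g ` IV_roots n"
      by (simp add: IV_roots_def co_def image_image)
    also have "\<dots> = R"
      unfolding h(3)[symmetric] g_def using R bij by (intro inv_into_image_cancel) (auto simp: bij_betw_def)
    finally show "(\<lambda>a. g (co a)) ` II_roots n = R" .
    show "\<beta> (g (co a)) (g (co b)) = II_bichar n a b" if "a \<in> carrier (II_group n)" "b \<in> carrier (II_group n)" for a b
      using h(2)[of "g (co a)" "g (co b)"] gc coc that bich by simp
    show "odd n \<and> n \<ge> 5 \<or> n \<ge> 8" using k by (simp add: n_def)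
    fix a assume a: "a \<in> carrier (II_group n)" "g (co a) = \<one>\<^bsub>G\<^esub>"
    have "h \<one>\<^bsub>G\<^esub> = \<one>\<^bsub>IV_group n\<^esub>"
      using h(1) by (intro hom_one[OF _ G grp]) (simp add: iso_def)
    hence "co a = \<one>\<^bsub>IV_group n\<^esub>" using gc(2)[OF coc[OF a(1)]] a(2) by simp
    hence "co a = ?Rad" by (simp add: IV_group_def FactGroup_def)
    thus "a \<in> ?Rad" using self[OF a(1)] by simp
  qed
  thus thesis using that by (simp add: n_def)
qed

section \<open>Counting roots of quadratic forms\<close>

lemma sum_Z2n_Suc:
  "(\<Sum>a\<in>carrier (Z2n (Suc n)). F a) = (\<Sum>g\<in>carrier (Z2n n). F (g(Suc n := 0)) + F (g(Suc n := 1)))"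
  for F :: "(nat \<Rightarrow> int) \<Rightarrow> int"
proof -
  have 01: "{0..<2::int} = {0, 1}" by auto
  have "carrier (Z2n (Suc n)) = (\<lambda>(y, g). g(Suc n := y)) ` ({0..<2} \<times> carrier (Z2n n))"
  proof -
    have "{1..Suc n} = insert (Suc n) {1..n}" by auto
    thus ?thesis unfolding carrier_Z2n by (simp only: PiE_insert_eq)
  qed
  moreover have "inj_on (\<lambda>(y, g). g(Suc n := y)) ({0..<2} \<times> carrier (Z2n n))"
    unfolding carrier_Z2n by (rule inj_combinator) simp
  ultimately have "sum F (carrier (Z2n (Suc n))) =
      sum (F \<circ> (\<lambda>(y, g). g(Suc n := y))) ({0..<2} \<times> carrier (Z2n n))"
    by (simp only: sum.reindex)
  also have "\<dots> = (\<Sum>(y, g)\<in>{0..<2} \<times> carrier (Z2n n). F (g(Suc n := y)))"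
    by (rule sum.cong) auto
  also have "\<dots> = (\<Sum>y\<in>{0..<2}. \<Sum>g\<in>carrier (Z2n n). F (g(Suc n := y)))"
    by (simp add: sum.cartesian_product)
  finally show ?thesis by (simp add: 01 sum.distrib)
qed

text \<open>The number of roots is read off the sum of the signs \<open>(-1)\<^sup>q\<close>, which doubles with every hyperbolic
  plane that is added to the quadratic form \<open>q\<close>.\<close>

definition parity_sign :: "int \<Rightarrow> int" where
  "parity_sign q = (if even q then 1 else -1)"

text \<open>The four points of the new plane contribute 1 + 1 + 1 - 1 = 2. The hypothesis keeps the
  coordinates 1 and 2 of the extra term out of that plane.\<close>

lemma parity_sign_sum_step:
  assumes "\<not> c \<or> k \<ge> 1"
  shows "(\<Sum>a\<in>carrier (Z2n (2 * Suc k)). parity_sign (quadratic_value c (Suc k) a)) =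
    2 * (\<Sum>a\<in>carrier (Z2n (2*k)). parity_sign (quadratic_value c k a))"
proof -
  have val: "quadratic_value c (Suc k) (g(Suc (2*k) := x, Suc (Suc (2*k)) := y)) = quadratic_value c k g + x * y" for g x y
  proof -
    let ?g = "g(Suc (2*k) := x, Suc (Suc (2*k)) := y)"
    have "(\<Sum>t<k. ?g (2*t+1) * ?g (2*t+2)) = (\<Sum>t<k. g (2*t+1) * g (2*t+2))"
      by (intro sum.cong) auto
    moreover have "c \<longrightarrow> ?g 1 = g 1 \<and> ?g 2 = g 2" using assms by auto
    ultimately show ?thesis by (simp add: quadratic_value_def)
  qed
  have "(\<Sum>a\<in>carrier (Z2n (2 * Suc k)). parity_sign (quadratic_value c (Suc k) a)) =
      (\<Sum>g\<in>carrier (Z2n (2*k)). 2 * parity_sign (quadratic_value c k g))"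
    unfolding mult_Suc_right add_2_eq_Suc sum_Z2n_Suc val
    by (intro sum.cong) (auto simp: parity_sign_def)
  thus ?thesis by (simp add: sum_distrib_left)
qed

lemma parity_sign_sum:
  "(\<Sum>a\<in>carrier (Z2n (2*k)). parity_sign (quadratic_value False k a)) = 2 ^ k"
  "k \<ge> 1 \<Longrightarrow> (\<Sum>a\<in>carrier (Z2n (2*k)). parity_sign (quadratic_value True k a)) = - (2 ^ k)"
proof -
  have Z0: "carrier (Z2n 0) = {\<lambda>_. undefined}" by (simp add: carrier_Z2n)
  show "(\<Sum>a\<in>carrier (Z2n (2*k)). parity_sign (quadratic_value False k a)) = 2 ^ k"
  proof (induction k)
    case 0
    show ?case by (simp add: Z0 quadratic_value_def parity_sign_def)
  next
    case (Suc k)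
    thus ?case using parity_sign_sum_step[of False k] by simp
  qed
  assume "k \<ge> 1"
  thus "(\<Sum>a\<in>carrier (Z2n (2*k)). parity_sign (quadratic_value True k a)) = - (2 ^ k)"
  proof (induction k rule: dec_induct)
    case base
    \<comment> \<open>On the anisotropic plane only 0 is a zero of the form, so the sum is 1 - 3 =
      -2.\<close>
    have "2 * 1 = Suc (Suc 0)" by simp
    thus ?case
      by (simp only: sum_Z2n_Suc Z0) (simp add: quadratic_value_def parity_sign_def numeral_2_eq_2)
  next
    case (step k)
    thus ?case using parity_sign_sum_step[of True k] by simp
  qed
qed

text \<open>The sign is 1 minus twice the indicator of the roots, so the sum of signs determines
  their number.\<close>

lemma card_quadratic_roots:
  assumes "k \<ge> 1"
  shows "int (2 * card (quadratic_roots c k)) = 4 ^ k + (if c then 2 ^ k else - (2 ^ k))"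
proof -
  let ?A = "carrier (Z2n (2*k))"
  have "(\<Sum>a\<in>?A. parity_sign (quadratic_value c k a)) =
      (\<Sum>a\<in>?A. 1 - 2 * (if a \<in> quadratic_roots c k then 1 else 0))"
    by (intro sum.cong) (auto simp: parity_sign_def quadratic_roots_def)
  also have "\<dots> = int (card ?A) - 2 * int (card (?A \<inter> quadratic_roots c k))"
    using finite_Z2n[of "2*k"] by (simp add: sum_subtractf sum_distrib_left[symmetric] sum.If_cases)
  also have "?A \<inter> quadratic_roots c k = quadratic_roots c k" by (auto simp: quadratic_roots_def)
  also have "int (card ?A) = 4 ^ k" by (simp add: card_Z2n power_mult)
  finally show ?thesis using parity_sign_sum[of k] assms by (cases c) auto
qed

lemma quadratic_value_mult:
  assumes "k \<ge> 1" "a \<in> carrier (Z2n (2*k))" "b \<in> carrier (Z2n (2*k))" "symplectic_bichar k a b = 1"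
  shows "even (quadratic_value c k (a \<otimes>\<^bsub>Z2n (2*k)\<^esub> b)) \<longleftrightarrow> even (quadratic_value c k a + quadratic_value c k b)"
proof -
  let ?ab = "a \<otimes>\<^bsub>Z2n (2*k)\<^esub> b"
  have ev: "even (?ab i) \<longleftrightarrow> even (a i + b i)" if "1 \<le> i" "i \<le> 2*k" for i
    using that by (simp add: mult_Z2n)
  have "even (\<Sum>t<k. ?ab (2*t+1) * ?ab (2*t+2)) \<longleftrightarrow>
      even (\<Sum>t<k. a (2*t+1) * a (2*t+2) + b (2*t+1) * b (2*t+2) + (a (2*t+2) * b (2*t+1) - a (2*t+1) * b (2*t+2)))"
    by (rule even_sum_cong) (simp add: ev, blast)
  also have "\<dots> \<longleftrightarrow> even ((\<Sum>t<k. a (2*t+1) * a (2*t+2)) + (\<Sum>t<k. b (2*t+1) * b (2*t+2)))"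
  proof -
    have "even (\<Sum>t<k. a (2*t+2) * b (2*t+1) - a (2*t+1) * b (2*t+2))"
      using assms(4) by (simp add: symplectic_bichar_alt minus_one_powi split: if_splits)
    thus ?thesis by (simp only: sum.distrib) simp
  qed
  finally have "even (\<Sum>t<k. ?ab (2*t+1) * ?ab (2*t+2)) \<longleftrightarrow>
      even ((\<Sum>t<k. a (2*t+1) * a (2*t+2)) + (\<Sum>t<k. b (2*t+1) * b (2*t+2)))" .
  moreover have "even (?ab 1) \<longleftrightarrow> even (a 1 + b 1)" "even (?ab 2) \<longleftrightarrow> even (a 2 + b 2)"
    using ev[of 1] ev[of 2] assms(1) by auto
  ultimately show ?thesis
    by (cases c) (simp_all add: quadratic_value_def, blast)
qed

lemma symplectic_bichar_mult:
  assumes "a \<in> carrier (Z2n (2*k))" "b \<in> carrier (Z2n (2*k))"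
  shows "symplectic_bichar k (a \<otimes>\<^bsub>Z2n (2*k)\<^esub> b) d = symplectic_bichar k a d * symplectic_bichar k b d"
proof -
  let ?ab = "a \<otimes>\<^bsub>Z2n (2*k)\<^esub> b"
  have ev: "even (?ab i) \<longleftrightarrow> even (a i + b i)" if "1 \<le> i" "i \<le> 2*k" for i
    using that by (simp add: mult_Z2n)
  have "even (\<Sum>t<k. ?ab (2*t+2) * d (2*t+1) - ?ab (2*t+1) * d (2*t+2)) \<longleftrightarrow>
      even (\<Sum>t<k. (a (2*t+2) * d (2*t+1) - a (2*t+1) * d (2*t+2)) + (b (2*t+2) * d (2*t+1) - b (2*t+1) * d (2*t+2)))"
    by (rule even_sum_cong) (simp add: ev, blast)
  thus ?thesis
    unfolding symplectic_bichar_alt minus_one_powi sum.distrib by simp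
qed

text \<open>On orthogonal vectors the form is additive, and a sum of three odd values is
  odd.\<close>

lemma orthogonal_triples_quadratic:
  assumes "k \<ge> 1"
  shows "orthogonal_triples_roots (Z2n (2*k)) (symplectic_bichar k) (quadratic_roots c k)"
  unfolding orthogonal_triples_roots_def
proof (intro ballI impI)
  fix x y z
  assume *: "x \<in> quadratic_roots c k" "y \<in> quadratic_roots c k" "z \<in> quadratic_roots c k"
    and o: "x \<noteq> y \<and> x \<noteq> z \<and> y \<noteq> z \<and> symplectic_bichar k x y = 1 \<and> symplectic_bichar k x z = 1 \<and> symplectic_bichar k y z = 1"
  interpret Z: group "Z2n (2*k)" by (rule group_Z2n)
  have c: "x \<in> carrier (Z2n (2*k))" "y \<in> carrier (Z2n (2*k))" "z \<in> carrier (Z2n (2*k))"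
    "odd (quadratic_value c k x)" "odd (quadratic_value c k y)" "odd (quadratic_value c k z)"
    using * by (auto simp: quadratic_roots_def)
  have "symplectic_bichar k (x \<otimes>\<^bsub>Z2n (2*k)\<^esub> y) z = 1"
    using symplectic_bichar_mult[OF c(1,2)] o by simp
  hence "odd (quadratic_value c k (x \<otimes>\<^bsub>Z2n (2*k)\<^esub> y \<otimes>\<^bsub>Z2n (2*k)\<^esub> z))"
    using quadratic_value_mult[OF assms(1) Z.m_closed[OF c(1,2)] c(3), where c = c]
      quadratic_value_mult[OF assms(1) c(1,2), where c = c] o c by simp
  thus "x \<otimes>\<^bsub>Z2n (2*k)\<^esub> y \<otimes>\<^bsub>Z2n (2*k)\<^esub> z \<in> quadratic_roots c k"
    using c by (simp add: quadratic_roots_def)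
qed

lemma orthogonal_triples_transfer:
  assumes iso: "frs_isomorphic G \<beta> R M \<beta>' R'" and R: "R \<subseteq> carrier G" and G: "group G"
    and M: "orthogonal_triples_roots M \<beta>' R'"
  shows "orthogonal_triples_roots G \<beta> R"
proof -
  interpret group G by fact
  obtain h where h: "h \<in> iso G M"
    "\<And>a b. a \<in> carrier G \<Longrightarrow> b \<in> carrier G \<Longrightarrow> \<beta>' (h a) (h b) = \<beta> a b" "h ` R = R'"
    using iso by (auto simp: frs_isomorphic_def)
  have inj: "inj_on h (carrier G)" using h(1) by (simp add: iso_def bij_betw_def)
  have hm: "h (a \<otimes>\<^bsub>G\<^esub> b) = h a \<otimes>\<^bsub>M\<^esub> h b" if "a \<in> carrier G" "b \<in> carrier G" for a b
    using h(1) that by (auto simp: iso_def hom_def)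
  show ?thesis
    unfolding orthogonal_triples_roots_def
  proof (intro ballI impI)
    fix x y z
    assume *: "x \<in> R" "y \<in> R" "z \<in> R"
      and o: "x \<noteq> y \<and> x \<noteq> z \<and> y \<noteq> z \<and> \<beta> x y = 1 \<and> \<beta> x z = 1 \<and> \<beta> y z = 1"
    have c: "x \<in> carrier G" "y \<in> carrier G" "z \<in> carrier G" using * R by auto
    have "h x \<in> R'" "h y \<in> R'" "h z \<in> R'" using * h(3) by auto
    moreover have "h x \<noteq> h y" "h x \<noteq> h z" "h y \<noteq> h z"
      using inj_onD[OF inj] c o by blast+
    moreover have "\<beta>' (h x) (h y) = 1" "\<beta>' (h x) (h z) = 1" "\<beta>' (h y) (h z) = 1"
      using h(2) c o by auto
    ultimately have "h x \<otimes>\<^bsub>M\<^esub> h y \<otimes>\<^bsub>M\<^esub> h z \<in> R'"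
      using M unfolding orthogonal_triples_roots_def by blast
    hence "h (x \<otimes>\<^bsub>G\<^esub> y \<otimes>\<^bsub>G\<^esub> z) \<in> h ` R" using c h(3) by (simp add: hm)
    thus "x \<otimes>\<^bsub>G\<^esub> y \<otimes>\<^bsub>G\<^esub> z \<in> R"
      using inj_on_image_mem_iff[OF inj _ R] c by simp
  qed
qed

lemma frs_isomorphic_card:
  assumes "frs_isomorphic G \<beta> R M \<beta>' R'" "R \<subseteq> carrier G"
  shows "card (carrier G) = card (carrier M)" "card R = card R'"
proof -
  obtain h where h: "bij_betw h (carrier G) (carrier M)" "h ` R = R'"
    using assms(1) by (auto simp: frs_isomorphic_def iso_def)
  show "card (carrier G) = card (carrier M)" using h(1) by (rule bij_betw_same_card)
  have "inj_on h R" using h(1) assms(2) by (auto simp: bij_betw_def intro: inj_on_subset)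
  thus "card R = card R'" using h(2) card_image by metis
qed

lemma quadratic_type_invariants:
  assumes "frs_isomorphic G \<beta> R (Z2n (2*k)) (symplectic_bichar k) (quadratic_roots c k)"
    and "group G" "R \<subseteq> carrier G" "k \<ge> 1"
  shows "card (carrier G) = 4 ^ k" "int (2 * card R) = 4 ^ k + (if c then 2 ^ k else - (2 ^ k))"
    "orthogonal_triples_roots G \<beta> R"
  using frs_isomorphic_card[OF assms(1,3)] card_quadratic_roots[OF assms(4), of c]
    orthogonal_triples_transfer[OF assms(1,3,2) orthogonal_triples_quadratic[OF assms(4)]]
  by (simp_all add: card_Z2n power_mult)

section \<open>Torsion in the groups of type I and uniqueness of divisor chains\<close>

text \<open>The solutions are the multiples of n / gcd n d below n.\<close>

lemma card_gcd_solutions: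
  assumes "n > 0" shows "card {i \<in> {0..<int n}. (int d * i) mod int n = 0} = gcd n d"
proof -
  define g where "g = gcd n d"
  have g: "g > 0" using assms by (simp add: g_def)
  obtain m where m: "n = g * m" using gcd_dvd1[of n d] unfolding g_def by (auto simp: dvd_def)
  obtain e where e: "d = g * e" using gcd_dvd2[of n d] unfolding g_def by (auto simp: dvd_def)
  have m0: "m > 0" using assms m by simp
  have "g * gcd m e = gcd n d" unfolding m e by (rule gcd_mult_distrib_nat)
  also have "\<dots> = g" by (simp only: g_def)
  finally have "gcd m e = 1" using g by simp
  hence cop: "coprime (int m) (int e)" by (simp add: coprime_iff_gcd_eq_1 gcd_int_int_eq)
  have iff: "(int d * i) mod int n = 0 \<longleftrightarrow> int m dvd i" for i
  proof -
    have "(int d * i) mod int n = 0 \<longleftrightarrow> int g * int m dvd int g * (int e * i)"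
      unfolding mod_eq_0_iff_dvd by (simp add: m e mult.assoc)
    also have "\<dots> \<longleftrightarrow> int m dvd int e * i" using g by simp
    also have "\<dots> \<longleftrightarrow> int m dvd i" using cop by (rule coprime_dvd_mult_right_iff)
    finally show ?thesis .
  qed
  have "{i \<in> {0..<int n}. (int d * i) mod int n = 0} = (\<lambda>j. int m * int j) ` {..<g}"
  proof (intro equalityI subsetI)
    fix i assume "i \<in> {i \<in> {0..<int n}. (int d * i) mod int n = 0}"
    hence i: "0 \<le> i" "i < int n" "int m dvd i" using iff by auto
    then obtain j where j: "i = int m * j" by (auto simp: dvd_def)
    have "0 \<le> j" using i(1) j m0 by (simp add: zero_le_mult_iff)
    moreover have "int m * j < int m * int g" using i(2) j by (simp add: m mult.commute)
    hence "j < int g" using m0 by simp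
    ultimately show "i \<in> (\<lambda>j. int m * int j) ` {..<g}"
      using j by (intro image_eqI[of _ _ "nat j"]) auto
  next
    fix i assume "i \<in> (\<lambda>j. int m * int j) ` {..<g}"
    then obtain j where j: "i = int m * int j" "j < g" by auto
    have "int m * int j < int m * int g" using j m0 by simp
    thus "i \<in> {i \<in> {0..<int n}. (int d * i) mod int n = 0}"
      using iff[of i] j by (simp add: m mult.commute)
  qed
  moreover have "inj_on (\<lambda>j. int m * int j) {..<g}" using m0 by (auto simp: inj_on_def)
  ultimately show ?thesis by (simp add: card_image g_def)
qed

lemma group_I_group: "group (I_group ns)"
  unfolding I_group_def by (intro product_group DirProd_group group_integer_mod_group)

lemma I_group_pow:
  assumes "a \<in> carrier (I_group ns)" "t < length ns"
  shows "(a [^]\<^bsub>I_group ns\<^esub> (d::nat)) t = ((int d * fst (a t)) mod int (ns ! t), (int d * snd (a t)) mod int (ns ! t))"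
proof (induction d)
  case 0
  show ?case using assms(2) by (simp add: I_group_def DirProd_def)
next
  case (Suc d)
  have "(a [^]\<^bsub>I_group ns\<^esub> Suc d) t =
      ((fst ((a [^]\<^bsub>I_group ns\<^esub> d) t) + fst (a t)) mod int (ns ! t), (snd ((a [^]\<^bsub>I_group ns\<^esub> d) t) + snd (a t)) mod int (ns ! t))"
    using assms(2) by (simp add: I_group_def DirProd_def case_prod_beta)
  thus ?case unfolding Suc by (simp add: mod_add_left_eq mod_add_right_eq algebra_simps)
qed

lemma card_torsion_I_group:
  assumes "\<And>n. n \<in> set ns \<Longrightarrow> n > 0"
  shows "card {a \<in> carrier (I_group ns). a [^]\<^bsub>I_group ns\<^esub> (d::nat) = \<one>\<^bsub>I_group ns\<^esub>} = (\<Prod>t<length ns. gcd (ns ! t) d)\<^sup>2"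
proof -
  have pos: "ns ! t > 0" if "t < length ns" for t using assms that by simp
  define Z where "Z t = {i \<in> {0..<int (ns ! t)}. (int d * i) mod int (ns ! t) = 0}" for t
  interpret group "I_group ns" by (rule group_I_group)
  have carr: "a \<in> carrier (I_group ns) \<longleftrightarrow> a \<in> PiE {..<length ns} (\<lambda>t. {0..<int (ns ! t)} \<times> {0..<int (ns ! t)})" for a
  proof -
    have "PiE {..<length ns} (\<lambda>t. carrier (integer_mod_group (ns ! t)) \<times> carrier (integer_mod_group (ns ! t))) =
        PiE {..<length ns} (\<lambda>t. {0..<int (ns ! t)} \<times> {0..<int (ns ! t)})"
      using pos by (intro PiE_cong) (auto simp: carrier_integer_mod_group)
    thus ?thesis by (simp add: I_group_def DirProd_def)
  qed
  have "{a \<in> carrier (I_group ns). a [^]\<^bsub>I_group ns\<^esub> d = \<one>\<^bsub>I_group ns\<^esub>} = PiE {..<length ns} (\<lambda>t. Z t \<times> Z t)"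
  proof (intro equalityI subsetI)
    fix a assume "a \<in> {a \<in> carrier (I_group ns). a [^]\<^bsub>I_group ns\<^esub> d = \<one>\<^bsub>I_group ns\<^esub>}"
    hence a: "a \<in> carrier (I_group ns)" "a [^]\<^bsub>I_group ns\<^esub> d = \<one>\<^bsub>I_group ns\<^esub>" by auto
    have "a t \<in> Z t \<times> Z t" if t: "t < length ns" for t
    proof -
      have "(a [^]\<^bsub>I_group ns\<^esub> d) t = (0, 0)"
        using a(2) t by (simp add: I_group_def DirProd_def)
      moreover have "a t \<in> {0..<int (ns ! t)} \<times> {0..<int (ns ! t)}"
        using a(1) t unfolding carr by (auto dest: PiE_mem)
      ultimately show ?thesis using I_group_pow[OF a(1) t, of d] by (auto simp: Z_def mem_Times_iff)
    qed
    thus "a \<in> PiE {..<length ns} (\<lambda>t. Z t \<times> Z t)"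
      using a(1) unfolding carr by (auto simp: PiE_iff)
  next
    fix a assume a: "a \<in> PiE {..<length ns} (\<lambda>t. Z t \<times> Z t)"
    have ac: "a \<in> carrier (I_group ns)"
      unfolding carr using a by (auto simp: PiE_iff Z_def mem_Times_iff)
    have "(a [^]\<^bsub>I_group ns\<^esub> d) = \<one>\<^bsub>I_group ns\<^esub>"
    proof (rule PiE_ext)
      show "a [^]\<^bsub>I_group ns\<^esub> d \<in> PiE {..<length ns} (\<lambda>t. {0..<int (ns ! t)} \<times> {0..<int (ns ! t)})"
        using nat_pow_closed[OF ac, of d] unfolding carr .
      show "\<one>\<^bsub>I_group ns\<^esub> \<in> PiE {..<length ns} (\<lambda>t. {0..<int (ns ! t)} \<times> {0..<int (ns ! t)})"
        using one_closed unfolding carr .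
      fix t assume t: "t \<in> {..<length ns}"
      have "a t \<in> Z t \<times> Z t" using a t by (rule PiE_mem)
      thus "(a [^]\<^bsub>I_group ns\<^esub> d) t = \<one>\<^bsub>I_group ns\<^esub> t"
        using I_group_pow[OF ac, of t d] t by (auto simp: Z_def I_group_def DirProd_def mem_Times_iff)
    qed
    thus "a \<in> {a \<in> carrier (I_group ns). a [^]\<^bsub>I_group ns\<^esub> d = \<one>\<^bsub>I_group ns\<^esub>}" using ac by blast
  qed
  hence "card {a \<in> carrier (I_group ns). a [^]\<^bsub>I_group ns\<^esub> d = \<one>\<^bsub>I_group ns\<^esub>} = (\<Prod>t<length ns. card (Z t) * card (Z t))"
    by (simp add: card_PiE card_cartesian_product)
  also have "\<dots> = (\<Prod>t<length ns. gcd (ns ! t) d * gcd (ns ! t) d)"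
    using card_gcd_solutions[OF pos] by (intro prod.cong) (auto simp: Z_def)
  finally show ?thesis by (simp add: power2_eq_square prod.distrib)
qed

text \<open>Its square counts the d-torsion of the type I group. At d = 0 it is the product of the
  list, its largest value when all entries are positive.\<close>

definition gcd_product :: "nat list \<Rightarrow> nat \<Rightarrow> nat" where
  "gcd_product ns d = prod_list (map (\<lambda>n. gcd n d) ns)"

lemma gcd_product_alt: "gcd_product ns d = (\<Prod>t<length ns. gcd (ns ! t) d)"
  unfolding gcd_product_def prod.list_conv_set_nth by (simp add: atLeast0LessThan)

lemma gcd_product_le: "(\<And>n. n \<in> set ns \<Longrightarrow> n > 0) \<Longrightarrow> gcd_product ns d \<le> gcd_product ns 0"
  by (induction ns) (auto simp: gcd_product_def intro!: mult_le_mono gcd_le1_nat)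

lemma gcd_product_pos: "(\<And>n. n \<in> set ns \<Longrightarrow> n > 0) \<Longrightarrow> gcd_product ns d > 0"
  by (induction ns) (auto simp: gcd_product_def)

lemma gcd_product_snoc: "gcd_product (ns @ [n]) d = gcd_product ns d * gcd n d"
  by (simp add: gcd_product_def)

text \<open>The maximum is attained only if every factor is maximal, in particular the last
  one.\<close>

lemma dvd_if_gcd_product_eq:
  assumes pos: "\<And>n. n \<in> set (ms @ [m]) \<Longrightarrow> n > 0" and eq: "gcd_product (ms @ [m]) d = gcd_product (ms @ [m]) 0"
  shows "m dvd d"
proof -
  have le: "gcd_product ms d \<le> gcd_product ms 0" "gcd m d \<le> m" and p: "gcd_product ms 0 > 0"
    using gcd_product_le[of ms d] gcd_product_pos[of ms 0] pos by (auto intro: gcd_le1_nat)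
  have "gcd m d = m"
  proof (rule ccontr)
    assume "gcd m d \<noteq> m"
    hence "gcd m d < m" using le by simp
    hence "gcd_product ms 0 * gcd m d < gcd_product ms 0 * m" using p by simp
    moreover have "gcd_product ms d * gcd m d \<le> gcd_product ms 0 * gcd m d" using le by simp
    ultimately have "gcd_product ms d * gcd m d < gcd_product ms 0 * m" by linarith
    thus False using eq by (simp add: gcd_product_snoc)
  qed
  thus ?thesis by (metis gcd_dvd2)
qed

lemma divisor_chain_dvd_last:
  fixes ns :: "nat list"
  assumes "\<And>i. Suc i < length ns \<Longrightarrow> ns ! i dvd ns ! Suc i" "ns \<noteq> []" "x \<in> set ns"
  shows "x dvd last ns"
proof -
  have *: "ns ! i dvd ns ! (i + j)" if "i + j < length ns" for i j
    using that
  proof (induction j)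
    case (Suc j)
    hence "ns ! i dvd ns ! (i + j)" by simp
    also have "\<dots> dvd ns ! Suc (i + j)" using Suc.prems assms(1)[of "i + j"] by simp
    finally show ?case by simp
  qed simp
  obtain i where "i < length ns" "x = ns ! i" using assms(3) by (auto simp: in_set_conv_nth)
  thus ?thesis using *[of i "length ns - 1 - i"] assms(2) by (simp add: last_conv_nth)
qed

text \<open>In a divisor chain the last entry attains the maximum of \<open>gcd_product\<close>, and
  any d attaining it is a multiple of that entry. The last entries of both chains hence divide each
  other; they are cancelled and the induction continues from the end.\<close>

lemma divisor_chain_unique:
  assumes "\<And>n. n \<in> set ns \<Longrightarrow> n > 1" "\<And>i. Suc i < length ns \<Longrightarrow> ns ! i dvd ns ! Suc i"
    and "\<And>n. n \<in> set ms \<Longrightarrow> n > 1" "\<And>i. Suc i < length ms \<Longrightarrow> ms ! i dvd ms ! Suc i"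
    and "\<And>d. gcd_product ns d = gcd_product ms d"
  shows "ns = ms"
  using assms
proof (induction ns arbitrary: ms rule: rev_induct)
  case Nil
  show ?case
  proof (cases ms)
    case (Cons m ms')
    have "m * gcd_product ms' 0 = 1" using Nil.prems(5)[of 0] Cons by (simp add: gcd_product_def)
    hence "m = 1" by simp
    thus ?thesis using Nil.prems(3)[of m] Cons by simp
  qed simp
next
  case (snoc n ns)
  note chains = snoc.prems(2,4)
  have "ms \<noteq> []"
  proof
    assume "ms = []"
    hence "gcd_product ns 0 * n = 1" using snoc.prems(5)[of 0] by (simp add: gcd_product_snoc) (simp add: gcd_product_def)
    hence "n = 1" by simp
    thus False using snoc.prems(1)[of n] by simp
  qed
  then obtain ms' m where ms: "ms = ms' @ [m]" by (metis rev_exhaust)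
  have posn: "x > 0" if "x \<in> set (ns @ [n])" for x using snoc.prems(1)[OF that] by simp
  have posm: "x > 0" if "x \<in> set (ms' @ [m])" for x using snoc.prems(3)[of x] that ms by simp
  have full: "gcd_product xs (last xs) = gcd_product xs 0"
    if "\<And>i. Suc i < length xs \<Longrightarrow> xs ! i dvd xs ! Suc i" "xs \<noteq> []" for xs
  proof -
    have "map (\<lambda>n. gcd n (last xs)) xs = map (\<lambda>n. gcd n 0) xs"
      using divisor_chain_dvd_last[of xs, OF that] by (intro map_cong) (auto intro: gcd_nat.absorb1)
    thus ?thesis by (simp add: gcd_product_def)
  qed
  have "gcd_product (ns @ [n]) n = gcd_product (ns @ [n]) 0"
    using full[of "ns @ [n]", OF chains(1)] by simp
  hence "gcd_product (ms' @ [m]) n = gcd_product (ms' @ [m]) 0"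
    using snoc.prems(5) ms by simp
  hence mn: "m dvd n" using dvd_if_gcd_product_eq[of ms' m n] posm by blast
  have "gcd_product (ms' @ [m]) m = gcd_product (ms' @ [m]) 0"
    using full[OF chains(2)] ms by simp
  hence "gcd_product (ns @ [n]) m = gcd_product (ns @ [n]) 0"
    using snoc.prems(5) ms by simp
  hence "n dvd m" using dvd_if_gcd_product_eq[of ns n m] posn by blast
  hence m: "m = n" using mn by (intro dvd_antisym)
  have "ns = ms'"
  proof (rule snoc.IH)
    show "x > 1" if "x \<in> set ns" for x using snoc.prems(1)[of x] that by simp
    show "x > 1" if "x \<in> set ms'" for x using snoc.prems(3)[of x] that ms by simp
    show "ns ! i dvd ns ! Suc i" if "Suc i < length ns" for i
      using chains(1)[of i] that by (simp add: nth_append)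
    show "ms' ! i dvd ms' ! Suc i" if "Suc i < length ms'" for i
      using chains(2)[of i] that ms by (simp add: nth_append)
    fix d
    have "n > 0" using posn[of n] by simp
    thus "gcd_product ns d = gcd_product ms' d"
      using snoc.prems(5)[of d] ms m by (auto simp: gcd_product_snoc)
  qed
  thus ?case using ms m by simp
qed

lemma type_I_invariants:
  assumes G: "group G" and type: "of_type (TypeI ns) G \<beta> R" and R: "R \<subseteq> carrier G"
  shows "all_sums_roots G R" "finite (carrier G) \<Longrightarrow> Suc (card R) = card (carrier G)"
    "card {g \<in> carrier G. g [^]\<^bsub>G\<^esub> (d::nat) = \<one>\<^bsub>G\<^esub>} = (gcd_product ns d)\<^sup>2"
proof -
  interpret G: group G by fact
  let ?M = "I_group ns"
  interpret M: group ?M by (rule group_I_group)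
  have pos: "n > 0" if "n \<in> set ns" for n using type that by (auto simp: divisor_chain_def)
  obtain h where h: "h \<in> iso G ?M" "h ` R = carrier ?M - {\<one>\<^bsub>?M\<^esub>}"
    using type by (auto simp: frs_isomorphic_def)
  interpret h: group_hom G ?M h
    using h(1) by unfold_locales (simp add: iso_def)
  have bij: "bij_betw h (carrier G) (carrier ?M)" using h(1) by (simp add: iso_def)
  have inj: "inj_on h (carrier G)" using bij by (simp add: bij_betw_def)
  have RG: "R = carrier G - {\<one>\<^bsub>G\<^esub>}"
  proof (intro equalityI subsetI)
    fix x assume x: "x \<in> R"
    hence "h x \<noteq> \<one>\<^bsub>?M\<^esub>" using h(2) by blast
    thus "x \<in> carrier G - {\<one>\<^bsub>G\<^esub>}" using x R by auto
  next
    fix x assume x: "x \<in> carrier G - {\<one>\<^bsub>G\<^esub>}"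
    hence "h x \<noteq> h \<one>\<^bsub>G\<^esub>" using inj_onD[OF inj, of x "\<one>\<^bsub>G\<^esub>"] by auto
    hence "h x \<in> h ` R" using x h(2) by simp
    thus "x \<in> R" using inj_on_image_mem_iff[OF inj _ R] x by simp
  qed
  show "all_sums_roots G R" by (auto simp: all_sums_roots_def RG)
  show "Suc (card R) = card (carrier G)" if "finite (carrier G)"
    unfolding RG using that by (rule card_Suc_Diff1) simp
  have "bij_betw h {g \<in> carrier G. g [^]\<^bsub>G\<^esub> d = \<one>\<^bsub>G\<^esub>} {a \<in> carrier ?M. a [^]\<^bsub>?M\<^esub> d = \<one>\<^bsub>?M\<^esub>}"
  proof (rule bij_betw_imageI)
    show "inj_on h {g \<in> carrier G. g [^]\<^bsub>G\<^esub> d = \<one>\<^bsub>G\<^esub>}" using inj by (rule inj_on_subset) auto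
    have pw: "h g [^]\<^bsub>?M\<^esub> d = \<one>\<^bsub>?M\<^esub> \<longleftrightarrow> g [^]\<^bsub>G\<^esub> d = \<one>\<^bsub>G\<^esub>" if "g \<in> carrier G" for g
    proof -
      have "h g [^]\<^bsub>?M\<^esub> d = h (g [^]\<^bsub>G\<^esub> d)" using that by (simp add: h.hom_nat_pow)
      moreover have "h x = \<one>\<^bsub>?M\<^esub> \<longleftrightarrow> x = \<one>\<^bsub>G\<^esub>" if "x \<in> carrier G" for x
        using inj_onD[OF inj _ that G.one_closed] h.hom_one by metis
      ultimately show ?thesis using that by simp
    qed
    show "h ` {g \<in> carrier G. g [^]\<^bsub>G\<^esub> d = \<one>\<^bsub>G\<^esub>} = {a \<in> carrier ?M. a [^]\<^bsub>?M\<^esub> d = \<one>\<^bsub>?M\<^esub>}"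
    proof (intro equalityI subsetI)
      fix a assume a: "a \<in> {a \<in> carrier ?M. a [^]\<^bsub>?M\<^esub> d = \<one>\<^bsub>?M\<^esub>}"
      then obtain g where "g \<in> carrier G" "a = h g" using bij by (auto simp: bij_betw_def)
      thus "a \<in> h ` {g \<in> carrier G. g [^]\<^bsub>G\<^esub> d = \<one>\<^bsub>G\<^esub>}" using a pw by auto
    qed (use pw in auto)
  qed
  thus "card {g \<in> carrier G. g [^]\<^bsub>G\<^esub> d = \<one>\<^bsub>G\<^esub>} = (gcd_product ns d)\<^sup>2"
    using card_torsion_I_group[OF pos, of ns d] by (simp add: bij_betw_same_card gcd_product_alt)
qed

section \<open>Comparison of the invariants\<close>

text \<open>The shift avoids the equal values of \<open>n choose 2\<close> at 0 and 1.\<close>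

lemma strict_mono_choose_two: "strict_mono (\<lambda>n. Suc n choose 2)"
  by (simp add: strict_mono_Suc_iff numeral_2_eq_2)

text \<open>Types II and IV are merged by the number n of points, types III and V by the flag
  \<open>c\<close>, so that three families remain to be compared.\<close>

lemma listed_type_cases:
  assumes G: "group G" and fin: "finite (carrier G)" and R: "R \<subseteq> carrier G"
    and \<tau>: "\<tau> \<in> listed_types" "of_type \<tau> G \<beta> R"
  obtains (I) ns where "\<tau> = TypeI ns" "divisor_chain ns" "all_sums_roots G R" "Suc (card R) = card (carrier G)"
      "\<And>d::nat. card {g \<in> carrier G. g [^]\<^bsub>G\<^esub> d = \<one>\<^bsub>G\<^esub>} = (gcd_product ns d)\<^sup>2"
  | (S) n where "\<tau> = (if odd n then TypeII (n div 2) else TypeIV (n div 2))" "odd n \<and> n \<ge> 5 \<or> n \<ge> 8"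
      "\<not> all_sums_roots G R" "card R = n choose 2"
      "odd n \<and> n \<ge> 7 \<or> n \<ge> 10 \<Longrightarrow> \<not> orthogonal_triples_roots G \<beta> R"
  | (Q) c k where "\<tau> = (if c then TypeIII k else TypeV k)" "k \<ge> 3" "card (carrier G) = 4 ^ k"
      "int (2 * card R) = 4 ^ k + (if c then 2 ^ k else - (2 ^ k))" "orthogonal_triples_roots G \<beta> R"
proof -
  consider ns where "\<tau> = TypeI ns" "divisor_chain ns" | k where "\<tau> = TypeII k" "k \<ge> 2"
    | k where "\<tau> = TypeIII k" "k \<ge> 3" | k where "\<tau> = TypeIV k" "k \<ge> 4" | k where "\<tau> = TypeV k" "k \<ge> 3"
    using \<tau>(1) unfolding listed_types_def by blast
  thus thesis
  proof cases
    case 1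
    thus thesis using I type_I_invariants[OF G \<tau>(2)[unfolded 1(1)] R] fin by blast
  next
    case (2 k)
    obtain \<rho> where "symmetric_frame G \<beta> R (2*k+1) \<rho>"
      using type_II_frame[OF G 2(2) \<tau>(2)[unfolded 2(1)] R] by blast
    then interpret symmetric_frame G \<beta> R "2*k+1" \<rho> .
    show thesis
      by (rule S[of "2*k+1"]) (use 2 size not_all_sums card_roots not_orthogonal_triples in auto)
  next
    case (3 k)
    have "frs_isomorphic G \<beta> R (Z2n (2*k)) (symplectic_bichar k) (quadratic_roots True k)"
      using \<tau>(2) 3 by (simp add: quadratic_roots_III_V)
    from quadratic_type_invariants[OF this G R] show thesis
      using 3 by (intro Q[of True k]) auto
  next
    case (4 k)
    obtain \<rho> where "symmetric_frame G \<beta> R (2*k) \<rho>"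
      using type_IV_frame[OF G 4(2) \<tau>(2)[unfolded 4(1)] R] by blast
    then interpret symmetric_frame G \<beta> R "2*k" \<rho> .
    show thesis
      by (rule S[of "2*k"]) (use 4 size not_all_sums card_roots not_orthogonal_triples in auto)
  next
    case (5 k)
    have "frs_isomorphic G \<beta> R (Z2n (2*k)) (symplectic_bichar k) (quadratic_roots False k)"
      using \<tau>(2) 5 by (simp add: quadratic_roots_III_V)
    from quadratic_type_invariants[OF this G R] show thesis
      using 5 by (intro Q[of False k]) auto
  qed
qed

lemma square_power_two: "(4::int) ^ k = 2 ^ k * 2 ^ k"
  by (simp flip: power_mult_distrib)

lemma eight_le_power_two: "k \<ge> 3 \<Longrightarrow> (8::int) \<le> 2 ^ k"
  using power_increasing[of 3 k "2::int"] by simp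

text \<open>Only n = 5 and n = 8 remain, with 20 and 56 as twice the number of roots. For x = 2^k at
  least 8, x^2 + x and x^2 - x meet these values only in 64 - 8 = 56.\<close>

lemma symmetric_quadratic_coincidence:
  assumes n: "odd n \<and> n \<ge> 5 \<or> n \<ge> 8" "\<not> (odd n \<and> n \<ge> 7 \<or> n \<ge> 10)" and k: "k \<ge> 3"
    and card: "int (2 * (n choose 2)) = 4 ^ k + (if c then 2 ^ k else - (2 ^ k))"
  shows "n = 8 \<and> \<not> c \<and> k = 3"
proof -
  define x :: int where "x = 2 ^ k"
  have x: "x \<ge> 8" using eight_le_power_two[OF k] by (simp add: x_def)
  have "n = 5 \<or> n = 8" using n by presburger
  hence val: "int (2 * (n choose 2)) = (if n = 5 then 20 else 56)"
    by (auto simp: choose_two)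
  define y where "y = x * x"
  have eq: "(if n = 5 then 20 else 56) = y + (if c then x else - x)"
    using card unfolding val square_power_two x_def y_def .
  have "x * 8 \<le> y" unfolding y_def using x by (intro mult_left_mono) auto
  hence "\<not> c \<and> n \<noteq> 5" using eq x by (auto split: if_splits)
  moreover have "k = 3"
  proof (rule ccontr)
    assume "k \<noteq> 3"
    hence "k \<ge> 4" using k by simp
    hence "x \<ge> 16" using power_increasing[of 4 k "2::int"] by (simp add: x_def)
    moreover from this have "x * 16 \<le> y" unfolding y_def by (intro mult_left_mono) auto
    ultimately show False using eq by (auto split: if_splits)
  qed
  ultimately show ?thesis using \<open>n = 5 \<or> n = 8\<close> by blast
qed

lemma listed_type_unique:
  assumes G: "group G" and fin: "finite (carrier G)" and R: "R \<subseteq> carrier G"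
    and \<tau>: "\<tau> \<in> listed_types" "of_type \<tau> G \<beta> R" and \<tau>': "\<tau>' \<in> listed_types" "of_type \<tau>' G \<beta> R"
  shows "\<tau>' = \<tau> \<or> {\<tau>, \<tau>'} = {TypeIV 4, TypeV 3}"
proof -
  \<comment> \<open>Type I has 4^k - 1 roots in a group of order 4^k; equality with the count for a
    quadratic form would mean x^2 = 2 + x or x^2 = 2 - x for x = 2^k, impossible for x at least
    8.\<close>
  have IQ: False if "Suc (card R) = card (carrier G)" "card (carrier G) = 4 ^ k"
    "int (2 * card R) = 4 ^ k + (if c then 2 ^ k else - (2 ^ k))" "k \<ge> 3" for c k
  proof -
    define x :: int where "x = 2 ^ k"
    have x: "x \<ge> 8" using eight_le_power_two[OF that(4)] by (simp add: x_def)
    have "int (card R) + 1 = 4 ^ k" using that(1,2) by (metis of_nat_Suc of_nat_numeral of_nat_power add.commute)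
    define y where "y = x * x"
    have "2 * y - 2 = y + (if c then x else - x)"
      using \<open>int (card R) + 1 = 4 ^ k\<close> that(3) unfolding square_power_two x_def y_def by simp
    moreover have "x * 8 \<le> y" unfolding y_def using x by (intro mult_left_mono) auto
    ultimately show False using x by (auto split: if_splits)
  qed
  show ?thesis
    using G fin R \<tau>
  proof (cases rule: listed_type_cases)
    case (I ns)
    show ?thesis
      using G fin R \<tau>'
    proof (cases rule: listed_type_cases)
      case I': (I ms)
      have "gcd_product ns d = gcd_product ms d" for d
      proof -
        have "(gcd_product ns d)\<^sup>2 = (gcd_product ms d)\<^sup>2" using I(5)[of d] I'(5)[of d] by simp
        thus ?thesis by simp
      qed
      hence "ns = ms"
        using I(2) I'(2) by (intro divisor_chain_unique) (auto simp: divisor_chain_def)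
      thus ?thesis using I(1) I'(1) by simp
    next
      case (S n)
      thus ?thesis using I(3) by blast
    next
      case (Q c k)
      thus ?thesis using IQ[OF I(4) Q(3,4,2)] by blast
    qed
  next
    case (S n)
    show ?thesis
      using G fin R \<tau>'
    proof (cases rule: listed_type_cases)
      case (I ms)
      thus ?thesis using S(3) by blast
    next
      case S': (S m)
      have "Suc (n - 1) choose 2 = Suc (m - 1) choose 2"
        using S(2,4) S'(2,4) by auto
      hence "n - 1 = m - 1" using strict_mono_eq[OF strict_mono_choose_two] by blast
      hence "n = m" using S(2) S'(2) by auto
      thus ?thesis using S(1) S'(1) by simp
    next
      case (Q c k)
      have "n = 8 \<and> \<not> c \<and> k = 3"
        by (rule symmetric_quadratic_coincidence[OF S(2) _ Q(2)]) (use S Q in auto)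
      thus ?thesis using S(1) Q(1) by simp
    qed
  next
    case (Q c k)
    show ?thesis
      using G fin R \<tau>'
    proof (cases rule: listed_type_cases)
      case (I ms)
      thus ?thesis using IQ[OF I(4) Q(3,4,2)] by blast
    next
      case (S n)
      have "n = 8 \<and> \<not> c \<and> k = 3"
        by (rule symmetric_quadratic_coincidence[OF S(2) _ Q(2)]) (use S Q in auto)
      thus ?thesis using S(1) Q(1) by auto
    next
      case Q': (Q c' k')
      have "(4::nat) ^ k = 4 ^ k'" using Q(3) Q'(3) by simp
      hence k: "k = k'" by simp
      moreover have "c = c'"
      proof (rule ccontr)
        assume "c \<noteq> c'"
        hence "(2::int) ^ k = - (2 ^ k)" using Q(4) Q'(4) k by (cases c; cases c') auto
        thus False using eight_le_power_two[OF Q(2)] by simp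
      qed
      ultimately show ?thesis using Q(1) Q'(1) by simp
    qed
  qed
qed

theorem corollary6p4:
  fixes G :: "('a, 'm) monoid_scheme"
    and \<beta> \<xi> :: "'a \<Rightarrow> 'a \<Rightarrow> complex"
    and R :: "'a set"
  assumes frs: "finite_root_system G \<beta> R"
    and xi_bichar: "bicharacter G \<xi>"
    and xi_beta: "\<And>a b. a \<in> carrier G \<Longrightarrow> b \<in> carrier G \<Longrightarrow> \<xi> a b * inverse (\<xi> b a) = \<beta> a b"
    and simple: "simple_lie_algebra R (root_bracket G \<xi> R)"
    and good: "good_inner_standard_grading G \<xi> R"
  shows "nonsingular G \<beta> \<and> \<not> frs_reducible G \<beta> R \<and>
    (\<exists>\<tau>\<in>listed_types. of_type \<tau> G \<beta> R \<and>
       (\<forall>\<tau>'\<in>listed_types. of_type \<tau>' G \<beta> R \<longrightarrow>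
          \<tau>' = \<tau> \<or> {\<tau>, \<tau>'} = {TypeIV 4, TypeV 3}))"
proof -
  interpret finite_root_system G \<beta> R by (rule frs)
  interpret root_system_lie G \<beta> R \<xi>
    by unfold_locales (use finite_carrier xi_bichar xi_beta in auto)
  interpret connected_root_system G \<beta> R
    by unfold_locales (rule nonsingular_if_good_inner[OF good], rule connected_if_simple[OF simple])
  obtain \<tau> where \<tau>: "\<tau> \<in> listed_types" "of_type \<tau> G \<beta> R"
    using listed_type_exists by blast
  have "R \<subseteq> carrier G" by auto
  hence "\<tau>' = \<tau> \<or> {\<tau>, \<tau>'} = {TypeIV 4, TypeV 3}" if "\<tau>' \<in> listed_types" "of_type \<tau>' G \<beta> R" for \<tau>'
    using listed_type_unique[OF is_group finite_carrier _ \<tau> that] by blast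
  thus ?thesis using nonsingular not_reducible \<tau> by blast
qed

end
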